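(* Let $n\geq 4$. (i) $\Delta_D(S_n)$ is perfect if and only if $n\leq 5$. (ii) $\Delta_D(A_n)$ is perfect if and only if $n\leq 7$.
   Context: $S_n$ and $A_n$ are the symmetric and alternating groups. The deep commuting graph $\Delta_D(G)$ has vertex set $G$, distinct vertices adjacent iff their preimages commute in a Schur cover $\tilde G$ of $G$ (a central extension $\{e\}\to M(G)\to\tilde G\to G\to\{e\}$ with kernel contained in $Z(\tilde G)\cap[\tilde G,\tilde G]$, of maximal order; $M(G)$ the Schur multiplier). A graph is perfect if every induced subgraph has clique number equal to its chromatic number. *)

theory Defs
  imports "HOL-Algebra.Sym_Groups" "HOL-Algebra.Generated_Groups"
begin

definition grp_center :: "('a, 'b) monoid_scheme \<Rightarrow> 'a set" where
  "grp_center H = {z \<in> carrier H. \<forall>h \<in> carrier H. z \<otimes>\<^bsub>H\<^esub> h = h \<otimes>\<^bsub>H\<^esub> z}"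

definition stem_extension ::
  "('h, 'c) monoid_scheme \<Rightarrow> ('g, 'd) monoid_scheme \<Rightarrow> ('h \<Rightarrow> 'g) \<Rightarrow> bool" where
  "stem_extension H G \<pi> \<longleftrightarrow>
     group H \<and> group G \<and> finite (carrier H) \<and>
     \<pi> \<in> hom H G \<and> \<pi> ` carrier H = carrier G \<and>
     kernel H G \<pi> \<subseteq> grp_center H \<inter> derived H (carrier H)"

(* Schur cover: a stem extension whose kernel has maximal order among all
   stem extensions of G (every finite group is isomorphic to one carried by nat,
   so comparing against groups on nat covers all extensions) *)
definition schur_cover ::
  "('h, 'c) monoid_scheme \<Rightarrow> ('g, 'd) monoid_scheme \<Rightarrow> ('h \<Rightarrow> 'g) \<Rightarrow> bool" where
  "schur_cover H G \<pi> \<longleftrightarrow>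
     stem_extension H G \<pi> \<and>
     (\<forall>(H' :: nat monoid) \<pi>'. stem_extension H' G \<pi>' \<longrightarrow>
        card (kernel H' G \<pi>') \<le> card (kernel H G \<pi>))"

definition deep_adj ::
  "('h, 'c) monoid_scheme \<Rightarrow> ('h \<Rightarrow> 'g) \<Rightarrow> 'g \<Rightarrow> 'g \<Rightarrow> bool" where
  "deep_adj H \<pi> x y \<longleftrightarrow> x \<noteq> y \<and>
     (\<forall>a \<in> carrier H. \<forall>b \<in> carrier H. \<pi> a = x \<longrightarrow> \<pi> b = y \<longrightarrow>
        a \<otimes>\<^bsub>H\<^esub> b = b \<otimes>\<^bsub>H\<^esub> a)"

definition is_clique :: "('v \<Rightarrow> 'v \<Rightarrow> bool) \<Rightarrow> 'v set \<Rightarrow> bool" where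
  "is_clique E C \<longleftrightarrow> (\<forall>x \<in> C. \<forall>y \<in> C. x \<noteq> y \<longrightarrow> E x y)"

definition clique_number :: "'v set \<Rightarrow> ('v \<Rightarrow> 'v \<Rightarrow> bool) \<Rightarrow> nat" where
  "clique_number W E = Max {card C | C. C \<subseteq> W \<and> is_clique E C}"

definition proper_colouring :: "'v set \<Rightarrow> ('v \<Rightarrow> 'v \<Rightarrow> bool) \<Rightarrow> nat \<Rightarrow> ('v \<Rightarrow> nat) \<Rightarrow> bool" where
  "proper_colouring W E k f \<longleftrightarrow>
     f ` W \<subseteq> {..<k} \<and> (\<forall>x \<in> W. \<forall>y \<in> W. x \<noteq> y \<longrightarrow> E x y \<longrightarrow> f x \<noteq> f y)"

definition chromatic_number :: "'v set \<Rightarrow> ('v \<Rightarrow> 'v \<Rightarrow> bool) \<Rightarrow> nat" where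
  "chromatic_number W E = (LEAST k. \<exists>f. proper_colouring W E k f)"

definition perfect_graph :: "'v set \<Rightarrow> ('v \<Rightarrow> 'v \<Rightarrow> bool) \<Rightarrow> bool" where
  "perfect_graph V E \<longleftrightarrow>
     (\<forall>W \<subseteq> V. clique_number W E = chromatic_number W E)"

end

(* The lifts of commuting group elements x, y have a central commutator that depends only on x and y,
   is invariant under conjugation and is bimultiplicative; distinct x and y are deep adjacent iff it is
   trivial.

   Not perfect: for n >= 8 a five-cycle of 3-subsets of {1..8}, consecutive ones disjoint, gives a hole of
   3-cycles in A_n; the commutator of disjoint 3-cycles has order dividing 3 and is inverted by an even
   permutation. For n >= 6, S_n has a hole of length 5 made of transpositions if disjoint transpositions
   have commuting lifts, and otherwise a hole of length 7 made of transpositions and 3-cycles.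

   Perfect: for A_n with 5 <= n <= 7 and S_n with n = 4, 5, deep adjacent elements generate a cyclic
   group. Distinct commuting involutions do not have commuting lifts: in the spin double cover of A_n all
   involutions lift to elements with square -1, and in a stem extension of S_n with nontrivial kernel
   disjoint transpositions do not have commuting lifts. Disjoint 3-cycles do not have commuting lifts
   because of the triple cover of A_7. Ranking the elements by their orders (others, then 2, 3, 1), the
   neighbours of a vertex with at least its rank are pairwise adjacent, so greedy colouring along this
   ranking uses no more colours than the largest clique has vertices. *)

theory Submission
  imports Defs "HOL-Library.Numeral_Type" "HOL-Library.Function_Algebras" "HOL.Modules"
begin

text \<open>A Schur cover enters only through the maximality of its kernel; neither multiplier is
  computed. The imperfect cases hold in every central extension, which is why the hole in S_n comes
  in two versions. In the perfect cases some lifts must be shown not to commute, and this takes an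
  explicit extension for comparison. For A_n with n >= 5, a perfect group, lifts that commute in a
  Schur cover commute in every finite central extension, so the spin cover and the triple cover can
  be used one at a time. The proof of this domination breaks down for S_n, which is not perfect.
  There, commuting lifts of disjoint transpositions are shown to force a trivial kernel, and the
  spin group, a stem extension whose kernel contains -1, then contradicts maximality. Both explicit
  covers are built from finite data, so that the finiteness demanded by the comparison is
  immediate.\<close>

section \<open>Perfect and imperfect graphs\<close>

lemma proper_colouring_clique_card_le:
  assumes "proper_colouring W E k f" "C \<subseteq> W" "is_clique E C"
  shows "card C \<le> k"
proof -
  have "inj_on f C"
    using assms unfolding proper_colouring_def is_clique_def by (meson inj_onI subsetD)
  moreover have "f ` C \<subseteq> {..<k}"
    using assms unfolding proper_colouring_def by blast
  ultimately show ?thesis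
    using card_inj_on_le[of f C "{..<k}"] by simp
qed

lemma finite_clique_cards:
  assumes "finite W"
  shows "finite {card C | C. C \<subseteq> W \<and> is_clique E C}" "{card C | C. C \<subseteq> W \<and> is_clique E C} \<noteq> {}"
proof -
  have "{card C | C. C \<subseteq> W \<and> is_clique E C} \<subseteq> card ` Pow W" by blast
  then show "finite {card C | C. C \<subseteq> W \<and> is_clique E C}"
    using finite_subset[OF _ finite_imageI[of "Pow W" card]] assms by simp
  show "{card C | C. C \<subseteq> W \<and> is_clique E C} \<noteq> {}"
    by (auto simp: is_clique_def)
qed

lemma card_le_clique_number:
  assumes "finite W" "C \<subseteq> W" "is_clique E C"
  shows "card C \<le> clique_number W E"
  unfolding clique_number_def
proof (rule Max_ge[OF finite_clique_cards(1)[OF assms(1)]])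
  show "card C \<in> {card C | C. C \<subseteq> W \<and> is_clique E C}" using assms(2,3) by blast
qed

lemma clique_number_le:
  assumes "finite W" "\<And>C. C \<subseteq> W \<Longrightarrow> is_clique E C \<Longrightarrow> card C \<le> k"
  shows "clique_number W E \<le> k"
proof -
  have "clique_number W E \<in> {card C | C. C \<subseteq> W \<and> is_clique E C}"
    unfolding clique_number_def by (rule Max_in[OF finite_clique_cards[OF assms(1)]])
  then obtain C where "clique_number W E = card C" "C \<subseteq> W" "is_clique E C" by blast
  then show ?thesis using assms(2) by metis
qed

text \<open>A vertex \<open>x\<close> of least rank and its neighbours form a clique, so the
  neighbours use fewer than \<open>k\<close> colours and one is left for \<open>x\<close> after the
  rest has been coloured. The bound is a free \<open>k\<close>, because the clique number of
  \<open>W - {x}\<close> may drop while the number of colours has to stay.\<close>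

lemma simplicial_colouring:
  fixes r :: "'v \<Rightarrow> nat"
  assumes "finite W"
    and "\<And>x y. x \<in> W \<Longrightarrow> y \<in> W \<Longrightarrow> E x y \<Longrightarrow> E y x"
    and "\<And>x y z. x \<in> W \<Longrightarrow> y \<in> W \<Longrightarrow> z \<in> W \<Longrightarrow> x \<noteq> y \<Longrightarrow> x \<noteq> z \<Longrightarrow> E x y \<Longrightarrow> E x z \<Longrightarrow>
           r x \<le> r y \<Longrightarrow> r x \<le> r z \<Longrightarrow> y \<noteq> z \<Longrightarrow> E y z"
    and "\<And>C. C \<subseteq> W \<Longrightarrow> is_clique E C \<Longrightarrow> card C \<le> k"
  shows "\<exists>f. proper_colouring W E k f"
  using assms
proof (induction "card W" arbitrary: W)
  case 0
  have "W = {}" using 0(1,2) by simp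
  then show ?case by (simp add: proper_colouring_def)
next
  case (Suc m)
  have "W \<noteq> {}" using Suc.hyps(2) by auto
  then obtain x where x: "x \<in> W" "\<And>y. y \<in> W \<Longrightarrow> r x \<le> r y"
    using ex_has_least_nat[of "\<lambda>y. y \<in> W" _ r] by blast
  have "\<exists>f. proper_colouring (W - {x}) E k f"
  proof (rule Suc.hyps(1))
    show "m = card (W - {x})" using Suc.hyps(2) x(1) Suc.prems(1) by simp
    show "finite (W - {x})" using Suc.prems(1) by simp
  next
    fix a b assume "a \<in> W - {x}" "b \<in> W - {x}" "E a b"
    then show "E b a" using Suc.prems(2) by blast
  next
    fix a b c assume "a \<in> W - {x}" "b \<in> W - {x}" "c \<in> W - {x}" "a \<noteq> b" "a \<noteq> c" "E a b" "E a c"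
      "r a \<le> r b" "r a \<le> r c" "b \<noteq> c"
    then show "E b c" using Suc.prems(3)[of a b c] by blast
  next
    fix C assume "C \<subseteq> W - {x}" "is_clique E C"
    then show "card C \<le> k" using Suc.prems(4) by blast
  qed
  then obtain f where f: "proper_colouring (W - {x}) E k f" by blast
  define N where "N = {y \<in> W - {x}. E x y}"
  have fN: "finite N" unfolding N_def using Suc.prems(1) by simp
  have "is_clique E (insert x N)"
    unfolding is_clique_def
  proof (intro ballI impI)
    fix a b assume ab: "a \<in> insert x N" "b \<in> insert x N" "a \<noteq> b"
    then consider "a = x" "b \<in> N" | "b = x" "a \<in> N" | "a \<in> N" "b \<in> N" by blast
    then show "E a b"
    proof cases
      case 2
      then show ?thesis using Suc.prems(2)[of x a] x(1) unfolding N_def by blast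
    next
      case 3
      then show ?thesis using Suc.prems(3)[of x a b] x ab(3) unfolding N_def by blast
    qed (simp add: N_def)
  qed
  moreover have "insert x N \<subseteq> W" using x(1) unfolding N_def by blast
  ultimately have "card (insert x N) \<le> k" using Suc.prems(4) by blast
  then have "card N < k" using fN unfolding N_def by (simp add: card_insert_if)
  then have "card (f ` N) < k" using card_image_le[OF fN, of f] by linarith
  then have "\<not> {..<k} \<subseteq> f ` N" using card_mono[of "f ` N" "{..<k}"] fN by auto
  then obtain c where c: "c < k" "c \<notin> f ` N" by blast
  have "proper_colouring W E k (f(x := c))"
    unfolding proper_colouring_def
  proof (intro conjI ballI impI)
    show "(f(x := c)) ` W \<subseteq> {..<k}"
      using f c(1) unfolding proper_colouring_def by auto
  next
    fix a b assume ab: "a \<in> W" "b \<in> W" "a \<noteq> b" "E a b"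
    have "E b a" using ab Suc.prems(2) by blast
    show "(f(x := c)) a \<noteq> (f(x := c)) b"
    proof (cases "a = x \<or> b = x")
      case True
      then show ?thesis using ab \<open>E b a\<close> c(2) unfolding N_def by auto
    next
      case False
      then show ?thesis using ab f unfolding proper_colouring_def by auto
    qed
  qed
  then show ?case by blast
qed

lemma perfect_graph_if_simplicial:
  fixes r :: "'v \<Rightarrow> nat"
  assumes "finite V"
    and sym: "\<And>x y. x \<in> V \<Longrightarrow> y \<in> V \<Longrightarrow> E x y \<Longrightarrow> E y x"
    and simplicial: "\<And>x y z. x \<in> V \<Longrightarrow> y \<in> V \<Longrightarrow> z \<in> V \<Longrightarrow> x \<noteq> y \<Longrightarrow> x \<noteq> z \<Longrightarrow> E x y \<Longrightarrow> E x z \<Longrightarrow>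
           r x \<le> r y \<Longrightarrow> r x \<le> r z \<Longrightarrow> y \<noteq> z \<Longrightarrow> E y z"
  shows "perfect_graph V E"
  unfolding perfect_graph_def
proof (intro allI impI)
  fix W assume W: "W \<subseteq> V"
  then have fW: "finite W" using assms(1) finite_subset by blast
  have "\<exists>f. proper_colouring W E (clique_number W E) f"
  proof (rule simplicial_colouring[OF fW, where r = r])
    show "card C \<le> clique_number W E" if "C \<subseteq> W" "is_clique E C" for C
      using card_le_clique_number[OF fW that] .
    show "E y x" if "x \<in> W" "y \<in> W" "E x y" for x y
      using sym that W by blast
    show "E y z" if "x \<in> W" "y \<in> W" "z \<in> W" "x \<noteq> y" "x \<noteq> z" "E x y" "E x z" "r x \<le> r y" "r x \<le> r z" "y \<noteq> z"
      for x y z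
      using simplicial[of x y z] that W by blast
  qed
  moreover have "clique_number W E \<le> k" if "\<exists>f. proper_colouring W E k f" for k
    using that proper_colouring_clique_card_le clique_number_le[OF fW] by metis
  ultimately have "(LEAST k. \<exists>f. proper_colouring W E k f) = clique_number W E"
    by (rule Least_equality)
  then show "clique_number W E = chromatic_number W E"
    unfolding chromatic_number_def by simp
qed

text \<open>Without triangles the clique number is at most 2, so perfection would give a colouring
  with two colours. It suffices to refute Boolean colourings, which is immediate for odd
  cycles.\<close>

lemma not_perfect_if_triangle_free:
  assumes "finite W" "W \<subseteq> V"
    and triangle_free: "\<And>x y z. x \<in> W \<Longrightarrow> y \<in> W \<Longrightarrow> z \<in> W \<Longrightarrow> x \<noteq> y \<Longrightarrow> x \<noteq> z \<Longrightarrow> y \<noteq> z \<Longrightarrow>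
           E x y \<Longrightarrow> E x z \<Longrightarrow> E y z \<Longrightarrow> False"
    and not_bipartite: "\<And>f :: 'v \<Rightarrow> bool. \<exists>x \<in> W. \<exists>y \<in> W. x \<noteq> y \<and> E x y \<and> f x = f y"
  shows "\<not> perfect_graph V E"
proof
  assume "perfect_graph V E"
  then have eq: "chromatic_number W E = clique_number W E"
    using assms(2) unfolding perfect_graph_def by simp
  have "clique_number W E \<le> 2"
  proof (rule clique_number_le[OF assms(1)])
    fix C assume C: "C \<subseteq> W" "is_clique E C"
    show "card C \<le> 2"
    proof (rule ccontr)
      assume "\<not> card C \<le> 2"
      then have "3 \<le> card C" by simp
      then obtain D where "D \<subseteq> C" "card D = 3" using obtain_subset_with_card_n by metis
      then obtain x y z where "x \<in> C" "y \<in> C" "z \<in> C" "x \<noteq> y" "x \<noteq> z" "y \<noteq> z"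
        unfolding card_3_iff by blast
      then show False using triangle_free[of x y z] C unfolding is_clique_def by (meson subsetD)
    qed
  qed
  have "\<exists>k f. proper_colouring W E k f"
  proof -
    obtain g :: "'v \<Rightarrow> nat" and n where "g ` W = {i. i < n}" "inj_on g W"
      using finite_imp_inj_to_nat_seg[OF assms(1)] by blast
    then have "proper_colouring W E n g"
      unfolding proper_colouring_def inj_on_def by blast
    then show ?thesis by blast
  qed
  then have "\<exists>f. proper_colouring W E (chromatic_number W E) f"
    unfolding chromatic_number_def by (rule LeastI_ex)
  then obtain f where "proper_colouring W E (chromatic_number W E) f" by blast
  then have f: "f ` W \<subseteq> {..<clique_number W E}"
     and proper: "\<And>x y. x \<in> W \<Longrightarrow> y \<in> W \<Longrightarrow> x \<noteq> y \<Longrightarrow> E x y \<Longrightarrow> f x \<noteq> f y"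
    unfolding proper_colouring_def eq by blast+
  have less2: "f x < 2" if "x \<in> W" for x
  proof -
    have "f x \<in> {..<clique_number W E}" using f that by blast
    then show ?thesis using \<open>clique_number W E \<le> 2\<close> by simp
  qed
  \<comment> \<open>All colours are below 2, so testing for 0 loses nothing.\<close>
  obtain x y where xy: "x \<in> W" "y \<in> W" "x \<noteq> y" "E x y" "(f x = 0) = (f y = 0)"
    using not_bipartite[of "\<lambda>x. f x = 0"] by (elim bexE conjE) (rule that)
  then have "f x = f y" using less2[of x] less2[of y] by linarith
  then show False using proper xy by blast
qed

section \<open>Commutators in central extensions\<close>

text \<open>Unlike \<open>deep_adj\<close> this allows \<open>x = y\<close>, so in a central
  extension the elements related to a given \<open>x\<close> form a subgroup.\<close>

definition lifts_commute ::
  "('h, 'c) monoid_scheme \<Rightarrow> ('h \<Rightarrow> 'g) \<Rightarrow> 'g \<Rightarrow> 'g \<Rightarrow> bool" where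
  "lifts_commute H \<pi> x y \<longleftrightarrow>
     (\<forall>a \<in> carrier H. \<forall>b \<in> carrier H. \<pi> a = x \<longrightarrow> \<pi> b = y \<longrightarrow> a \<otimes>\<^bsub>H\<^esub> b = b \<otimes>\<^bsub>H\<^esub> a)"

lemma deep_adj_iff: "deep_adj H \<pi> x y \<longleftrightarrow> x \<noteq> y \<and> lifts_commute H \<pi> x y"
  unfolding deep_adj_def lifts_commute_def ..

text \<open>Without the stem condition, so that Schur covers and the explicit covers of the
  alternating groups are treated alike.\<close>

locale central_extension = H: group H + G: group G
  for H :: "('h, 'c) monoid_scheme" (structure) and G :: "('g, 'd) monoid_scheme" +
  fixes \<pi> :: "'h \<Rightarrow> 'g"
  assumes hom: "\<pi> \<in> hom H G"
    and surj: "\<pi> ` carrier H = carrier G"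
    and central: "kernel H G \<pi> \<subseteq> grp_center H"
begin

sublocale \<pi>: group_hom H G \<pi>
  by unfold_locales (rule hom)

abbreviation lc :: "'g \<Rightarrow> 'g \<Rightarrow> bool" where "lc \<equiv> lifts_commute H \<pi>"

lemma lift: assumes "x \<in> carrier G" obtains a where "a \<in> carrier H" "\<pi> a = x"
  using assms surj by (metis imageE)

lemma kernel_comm:
  assumes "k \<in> carrier H" "\<pi> k = \<one>\<^bsub>G\<^esub>" "a \<in> carrier H"
  shows "k \<otimes> a = a \<otimes> k"
  using assms central unfolding kernel_def grp_center_def by blast

lemma same_image:
  assumes "a \<in> carrier H" "b \<in> carrier H" "\<pi> a = \<pi> b"
  obtains k where "k \<in> carrier H" "\<pi> k = \<one>\<^bsub>G\<^esub>" "b = a \<otimes> k"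
proof
  show "inv a \<otimes> b \<in> carrier H" "\<pi> (inv a \<otimes> b) = \<one>\<^bsub>G\<^esub>"
    using assms by simp_all
  show "b = a \<otimes> (inv a \<otimes> b)"
    using assms by (simp add: H.m_assoc[symmetric])
qed

lemma comm_mult_kernel:
  assumes "a \<in> carrier H" "b \<in> carrier H" "a \<otimes> b = b \<otimes> a" "k \<in> carrier H" "\<pi> k = \<one>\<^bsub>G\<^esub>"
  shows "(a \<otimes> k) \<otimes> b = b \<otimes> (a \<otimes> k)"
  using assms kernel_comm[OF assms(4,5)] by (metis H.m_assoc)

text \<open>One pair of commuting lifts is enough, as all other lifts differ from it by central
  kernel elements.\<close>

lemma lcI:
  assumes a: "a \<in> carrier H" "\<pi> a = x" and b: "b \<in> carrier H" "\<pi> b = y"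
    and "a \<otimes> b = b \<otimes> a"
  shows "lc x y"
  unfolding lifts_commute_def
proof (intro ballI impI)
  fix a' b' assume *: "a' \<in> carrier H" "b' \<in> carrier H" "\<pi> a' = x" "\<pi> b' = y"
  obtain k where k: "k \<in> carrier H" "\<pi> k = \<one>\<^bsub>G\<^esub>" "a' = a \<otimes> k"
    using same_image[of a a'] a * by metis
  obtain l where l: "l \<in> carrier H" "\<pi> l = \<one>\<^bsub>G\<^esub>" "b' = b \<otimes> l"
    using same_image[of b b'] b * by metis
  have "a' \<otimes> b = b \<otimes> a'"
    using comm_mult_kernel[of a b k] a b assms(5) k by simp
  then show "a' \<otimes> b' = b' \<otimes> a'"
    using comm_mult_kernel[of b a' l] *(1) b l by simp
qed

lemma lcD:
  assumes "lc (\<pi> a) (\<pi> b)" "a \<in> carrier H" "b \<in> carrier H"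
  shows "a \<otimes> b = b \<otimes> a"
  using assms unfolding lifts_commute_def by blast

lemma lc_sym: "lc x y \<Longrightarrow> lc y x"
  unfolding lifts_commute_def by metis

lemma lc_refl: "x \<in> carrier G \<Longrightarrow> lc x x"
  by (metis lift lcI)

lemma lc_commute:
  assumes "lc x y" "x \<in> carrier G" "y \<in> carrier G"
  shows "x \<otimes>\<^bsub>G\<^esub> y = y \<otimes>\<^bsub>G\<^esub> x"
proof -
  obtain a b where "a \<in> carrier H" "\<pi> a = x" "b \<in> carrier H" "\<pi> b = y"
    using lift assms by metis
  then show ?thesis using lcD[of a b] assms(1) by (metis \<pi>.hom_mult)
qed

lemma lc_mult:
  assumes "lc x y" "lc x z" "x \<in> carrier G" "y \<in> carrier G" "z \<in> carrier G"
  shows "lc x (y \<otimes>\<^bsub>G\<^esub> z)"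
proof -
  obtain a b c where *: "a \<in> carrier H" "\<pi> a = x" "b \<in> carrier H" "\<pi> b = y" "c \<in> carrier H" "\<pi> c = z"
    using lift assms(3-5) by metis
  then have "a \<otimes> b = b \<otimes> a" "a \<otimes> c = c \<otimes> a"
    using lcD assms(1,2) by metis+
  then have "a \<otimes> (b \<otimes> c) = (b \<otimes> c) \<otimes> a"
    using * by (metis H.m_assoc)
  then show ?thesis
    using lcI[of a x "b \<otimes> c"] * by simp
qed

lemma lc_inv:
  assumes "lc x y" "x \<in> carrier G" "y \<in> carrier G"
  shows "lc x (inv\<^bsub>G\<^esub> y)"
proof -
  obtain a b where *: "a \<in> carrier H" "\<pi> a = x" "b \<in> carrier H" "\<pi> b = y"
    using lift assms(2,3) by metis
  then have "a \<otimes> b = b \<otimes> a"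
    using lcD assms(1) by metis
  then have "a \<otimes> inv b = inv b \<otimes> a"
    using * by (metis H.inv_closed H.inv_solve_left H.inv_solve_right H.m_assoc H.m_closed)
  then show ?thesis
    using lcI[of a x "inv b"] * by simp
qed

lemma lc_one: "x \<in> carrier G \<Longrightarrow> lc x \<one>\<^bsub>G\<^esub>"
  using lc_mult[OF lc_refl lc_inv[OF lc_refl]] by (metis G.inv_closed G.r_inv)

lemma lc_conj:
  assumes "lc x y" "x \<in> carrier G" "y \<in> carrier G" "g \<in> carrier G"
  shows "lc (g \<otimes>\<^bsub>G\<^esub> x \<otimes>\<^bsub>G\<^esub> inv\<^bsub>G\<^esub> g) (g \<otimes>\<^bsub>G\<^esub> y \<otimes>\<^bsub>G\<^esub> inv\<^bsub>G\<^esub> g)"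
proof -
  obtain a b c where *: "a \<in> carrier H" "\<pi> a = x" "b \<in> carrier H" "\<pi> b = y" "c \<in> carrier H" "\<pi> c = g"
    using lift assms(2-4) by metis
  then have ab: "a \<otimes> b = b \<otimes> a"
    using lcD assms(1) by metis
  have conj: "(c \<otimes> u \<otimes> inv c) \<otimes> (c \<otimes> v \<otimes> inv c) = c \<otimes> (u \<otimes> v) \<otimes> inv c"
    if "u \<in> carrier H" "v \<in> carrier H" for u v
  proof -
    have "inv c \<otimes> (c \<otimes> (v \<otimes> inv c)) = v \<otimes> inv c"
      using that * by (simp add: H.m_assoc[symmetric])
    then show ?thesis using that * by (simp add: H.m_assoc)
  qed
  show ?thesis
    by (rule lcI[of "c \<otimes> a \<otimes> inv c" _ "c \<otimes> b \<otimes> inv c"])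
       (use * conj ab in simp_all)
qed

text \<open>\<open>c\<close> is the commutator of two lifts. Central factors cancel in it, so it
  does not depend on the lifts.\<close>

lemma commutator_exists:
  assumes "x \<in> carrier G" "y \<in> carrier G" "x \<otimes>\<^bsub>G\<^esub> y = y \<otimes>\<^bsub>G\<^esub> x"
  obtains c where "c \<in> carrier H" "\<pi> c = \<one>\<^bsub>G\<^esub>"
    "\<And>a b. a \<in> carrier H \<Longrightarrow> b \<in> carrier H \<Longrightarrow> \<pi> a = x \<Longrightarrow> \<pi> b = y \<Longrightarrow> a \<otimes> b = c \<otimes> (b \<otimes> a)"
proof -
  obtain a b where ab: "a \<in> carrier H" "\<pi> a = x" "b \<in> carrier H" "\<pi> b = y"
    using lift assms by metis
  define c where "c = (a \<otimes> b) \<otimes> inv (b \<otimes> a)"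
  have c: "c \<in> carrier H" unfolding c_def using ab by simp
  have \<pi>c: "\<pi> c = \<one>\<^bsub>G\<^esub>" unfolding c_def using ab assms by simp
  have cab: "a \<otimes> b = c \<otimes> (b \<otimes> a)" unfolding c_def using ab by (simp add: H.m_assoc)
  show ?thesis
  proof (rule that[OF c \<pi>c])
    fix a' b' assume *: "a' \<in> carrier H" "b' \<in> carrier H" "\<pi> a' = x" "\<pi> b' = y"
    obtain k where k: "k \<in> carrier H" "\<pi> k = \<one>\<^bsub>G\<^esub>" "a' = a \<otimes> k"
      using same_image[of a a'] ab * by metis
    obtain l where l: "l \<in> carrier H" "\<pi> l = \<one>\<^bsub>G\<^esub>" "b' = b \<otimes> l"
      using same_image[of b b'] ab * by metis
    have kl: "(u \<otimes> k) \<otimes> (v \<otimes> l) = (u \<otimes> v) \<otimes> (k \<otimes> l)"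
             "(v \<otimes> l) \<otimes> (u \<otimes> k) = (v \<otimes> u) \<otimes> (k \<otimes> l)"
      if "u \<in> carrier H" "v \<in> carrier H" for u v
      using that k(1) l(1) kernel_comm[OF k(1,2)] kernel_comm[OF l(1,2)]
      by (metis H.m_assoc H.m_closed)+
    show "a' \<otimes> b' = c \<otimes> (b' \<otimes> a')"
      unfolding k(3) l(3) using kl[OF ab(1,3)] cab c ab k(1) l(1)
      by (metis H.m_assoc H.m_closed)
  qed
qed

lemma commutator_cases:
  assumes "x \<in> carrier G" "y \<in> carrier G" "x \<otimes>\<^bsub>G\<^esub> y = y \<otimes>\<^bsub>G\<^esub> x"
  obtains c where "c \<in> carrier H"
    "\<And>h. h \<in> carrier H \<Longrightarrow> c \<otimes> h = h \<otimes> c"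
    "\<And>a b. a \<in> carrier H \<Longrightarrow> b \<in> carrier H \<Longrightarrow> \<pi> a = x \<Longrightarrow> \<pi> b = y \<Longrightarrow> a \<otimes> b = c \<otimes> (b \<otimes> a)"
    "c = \<one> \<Longrightarrow> lc x y"
proof -
  obtain c where c: "c \<in> carrier H" "\<pi> c = \<one>\<^bsub>G\<^esub>"
    "\<And>a b. a \<in> carrier H \<Longrightarrow> b \<in> carrier H \<Longrightarrow> \<pi> a = x \<Longrightarrow> \<pi> b = y \<Longrightarrow> a \<otimes> b = c \<otimes> (b \<otimes> a)"
    using commutator_exists[OF assms] by metis
  show ?thesis
  proof (rule that[of c])
    show "c = \<one> \<Longrightarrow> lc x y"
      unfolding lifts_commute_def by (intro ballI impI) (simp add: c(3))
  qed (use c kernel_comm in blast)+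
qed

lemma central_comm_pow:
  fixes k :: nat
  assumes "a \<in> carrier H" "b \<in> carrier H" "c \<in> carrier H"
    "\<And>h. h \<in> carrier H \<Longrightarrow> c \<otimes> h = h \<otimes> c" "a \<otimes> b = c \<otimes> (b \<otimes> a)"
  shows "a \<otimes> b [^] k = c [^] k \<otimes> (b [^] k \<otimes> a)"
proof (induction k)
  case 0
  then show ?case using assms by simp
next
  case (Suc k)
  let ?B = "b [^] k" and ?C = "c [^] k"
  have cl: "?B \<in> carrier H" "?C \<in> carrier H" using assms by simp_all
  have "a \<otimes> (?B \<otimes> b) = (?C \<otimes> (?B \<otimes> a)) \<otimes> b"
    using Suc cl assms by (simp add: H.m_assoc[symmetric])
  also have "\<dots> = ?C \<otimes> (?B \<otimes> (c \<otimes> (b \<otimes> a)))"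
    using cl assms by (simp add: H.m_assoc)
  also have "?B \<otimes> (c \<otimes> (b \<otimes> a)) = c \<otimes> (?B \<otimes> (b \<otimes> a))"
    using cl assms(1-3) assms(4)[OF cl(1)] by (simp add: H.m_assoc[symmetric])
  also have "?C \<otimes> (c \<otimes> (?B \<otimes> (b \<otimes> a))) = (?C \<otimes> c) \<otimes> ((?B \<otimes> b) \<otimes> a)"
    using cl assms(1-3) by (simp add: H.m_assoc)
  finally show ?case by simp
qed

text \<open>The power \<open>b [^] k\<close> lies in the kernel and commutes with \<open>a\<close>,
  while moving \<open>a\<close> across it costs \<open>c [^] k\<close>.\<close>

lemma commutator_torsion:
  fixes k :: nat
  assumes "a \<in> carrier H" "b \<in> carrier H" "c \<in> carrier H"
    "\<And>h. h \<in> carrier H \<Longrightarrow> c \<otimes> h = h \<otimes> c" "a \<otimes> b = c \<otimes> (b \<otimes> a)"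
    and "\<pi> b [^]\<^bsub>G\<^esub> k = \<one>\<^bsub>G\<^esub>"
  shows "c [^] k = \<one>"
proof -
  have "\<pi> (b [^] k) = \<one>\<^bsub>G\<^esub>" using assms by (simp add: \<pi>.hom_nat_pow)
  then have "b [^] k \<otimes> a = a \<otimes> b [^] k"
    using kernel_comm assms(1,2) by simp
  then have "\<one> \<otimes> (b [^] k \<otimes> a) = c [^] k \<otimes> (b [^] k \<otimes> a)"
    using central_comm_pow[OF assms(1-5), of k] assms(1,2) by simp
  then show ?thesis
    using assms(1-3) by (metis H.m_closed H.nat_pow_closed H.one_closed H.right_cancel)
qed

text \<open>The order of \<open>y\<close> gives c^3 = 1. Exchanging the two lifts inverts the
  commutator, so the order of \<open>x\<close> gives c^2 = 1.\<close>

lemma lc_coprime_2_3: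
  assumes "x \<in> carrier G" "y \<in> carrier G" "x \<otimes>\<^bsub>G\<^esub> y = y \<otimes>\<^bsub>G\<^esub> x"
    and "x [^]\<^bsub>G\<^esub> (2::nat) = \<one>\<^bsub>G\<^esub>" "y [^]\<^bsub>G\<^esub> (3::nat) = \<one>\<^bsub>G\<^esub>"
  shows "lc x y"
proof -
  obtain c where c: "c \<in> carrier H" "\<And>h. h \<in> carrier H \<Longrightarrow> c \<otimes> h = h \<otimes> c"
    "\<And>a b. a \<in> carrier H \<Longrightarrow> b \<in> carrier H \<Longrightarrow> \<pi> a = x \<Longrightarrow> \<pi> b = y \<Longrightarrow> a \<otimes> b = c \<otimes> (b \<otimes> a)"
    "c = \<one> \<Longrightarrow> lc x y"
    using commutator_cases[OF assms(1-3)] by metis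
  obtain a b where ab: "a \<in> carrier H" "\<pi> a = x" "b \<in> carrier H" "\<pi> b = y"
    using lift assms by metis
  have c3: "c [^] (3::nat) = \<one>"
    by (rule commutator_torsion[of a b]) (use ab c assms in simp_all)
  have "b \<otimes> a = inv c \<otimes> (a \<otimes> b)"
    using c(1,3) ab by (simp add: H.m_assoc[symmetric])
  moreover have "inv c \<otimes> h = h \<otimes> inv c" if "h \<in> carrier H" for h
    using c(1,2) that by (metis H.inv_closed H.inv_solve_left H.inv_solve_right H.m_assoc H.m_closed)
  ultimately have "(inv c) [^] (2::nat) = \<one>"
    by (intro commutator_torsion[of b a "inv c"]) (use ab c(1) assms in simp_all)
  then have "c [^] (2::nat) = \<one>"
    using c(1) by (simp add: H.nat_pow_inv)
  then have "c = \<one>"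
    using c3 c(1) by (simp add: numeral_3_eq_3 numeral_2_eq_2)
  then show ?thesis by (rule c(4))
qed

text \<open>Conjugation by a lift of \<open>g\<close> leaves the central commutator \<open>c\<close>
  unchanged, yet turns the pair into \<open>x\<close> and the inverse of \<open>y\<close>, whose
  commutator is the inverse of \<open>c\<close>. Hence c^2 = 1, while y^3 = 1 gives c^3 = 1.\<close>

lemma lc_if_inverted:
  assumes "x \<in> carrier G" "y \<in> carrier G" "g \<in> carrier G" "x \<otimes>\<^bsub>G\<^esub> y = y \<otimes>\<^bsub>G\<^esub> x"
    and "y [^]\<^bsub>G\<^esub> (3::nat) = \<one>\<^bsub>G\<^esub>"
    and "g \<otimes>\<^bsub>G\<^esub> x \<otimes>\<^bsub>G\<^esub> inv\<^bsub>G\<^esub> g = x" "g \<otimes>\<^bsub>G\<^esub> y \<otimes>\<^bsub>G\<^esub> inv\<^bsub>G\<^esub> g = inv\<^bsub>G\<^esub> y"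
  shows "lc x y"
proof -
  obtain c where c: "c \<in> carrier H" "\<And>h. h \<in> carrier H \<Longrightarrow> c \<otimes> h = h \<otimes> c"
    "\<And>a b. a \<in> carrier H \<Longrightarrow> b \<in> carrier H \<Longrightarrow> \<pi> a = x \<Longrightarrow> \<pi> b = y \<Longrightarrow> a \<otimes> b = c \<otimes> (b \<otimes> a)"
    "c = \<one> \<Longrightarrow> lc x y"
    using commutator_cases[OF assms(1,2,4)] by metis
  obtain a b d where ab: "a \<in> carrier H" "\<pi> a = x" "b \<in> carrier H" "\<pi> b = y" "d \<in> carrier H" "\<pi> d = g"
    using lift assms(1-3) by metis
  have c3: "c [^] (3::nat) = \<one>"
    by (rule commutator_torsion[of a b]) (use ab c assms in simp_all)
  let ?a = "d \<otimes> a \<otimes> inv d" and ?b = "d \<otimes> b \<otimes> inv d"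
  have im: "?a \<in> carrier H" "\<pi> ?a = x" "?b \<in> carrier H" "\<pi> (inv ?b) = y"
    using ab assms by (simp_all del: H.inv_mult_group)
  have conj: "(d \<otimes> u \<otimes> inv d) \<otimes> (d \<otimes> v \<otimes> inv d) = d \<otimes> (u \<otimes> v) \<otimes> inv d"
    if "u \<in> carrier H" "v \<in> carrier H" for u v
  proof -
    have "inv d \<otimes> (d \<otimes> (v \<otimes> inv d)) = v \<otimes> inv d"
      using that ab by (simp add: H.m_assoc[symmetric])
    then show ?thesis using that ab by (simp add: H.m_assoc)
  qed
  have "?a \<otimes> ?b = d \<otimes> (c \<otimes> (b \<otimes> a)) \<otimes> inv d"
    using conj[of a b] ab c(3)[of a b] by simp
  also have "\<dots> = c \<otimes> (d \<otimes> (b \<otimes> a) \<otimes> inv d)"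
    using c(1) c(2)[of d] ab by (simp add: H.m_assoc[symmetric])
  finally have 1: "?a \<otimes> ?b = c \<otimes> (?b \<otimes> ?a)"
    using conj[of b a] ab by simp
  have 2: "?a \<otimes> inv ?b = c \<otimes> (inv ?b \<otimes> ?a)"
    using c(3)[of ?a "inv ?b"] im by simp
  define A B where "A = ?a" and "B = ?b"
  have AB: "A \<in> carrier H" "B \<in> carrier H" using im unfolding A_def B_def by auto
  note 12 = 1[folded A_def B_def] 2[folded A_def B_def]
  \<comment> \<open>Moving \<open>A\<close> across \<open>B\<close> and across \<open>inv B\<close>
    costs \<open>c\<close> each time, so moving it across their trivial product costs
    \<open>c \<otimes> c\<close>.\<close>
  have "A = (A \<otimes> inv B) \<otimes> B" using AB by (simp add: H.m_assoc)
  also have "\<dots> = c \<otimes> inv B \<otimes> (A \<otimes> B)" using AB c(1) 12(2) by (simp add: H.m_assoc)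
  also have "\<dots> = c \<otimes> (inv B \<otimes> c) \<otimes> (B \<otimes> A)" using AB c(1) 12(1) by (simp add: H.m_assoc)
  also have "\<dots> = c \<otimes> (c \<otimes> inv B) \<otimes> (B \<otimes> A)" using AB c(2)[of "inv B"] by simp
  also have "\<dots> = (c \<otimes> c) \<otimes> ((inv B \<otimes> B) \<otimes> A)"
    using AB c(1) by (metis H.inv_closed H.m_assoc H.m_closed)
  finally have "A = (c \<otimes> c) \<otimes> A" using AB by simp
  then have "\<one> \<otimes> A = (c \<otimes> c) \<otimes> A" using AB by simp
  then have "c \<otimes> c = \<one>" using AB c(1) by (metis H.m_closed H.one_closed H.right_cancel)
  then have "c = \<one>"
    using c3 c(1) by (simp add: numeral_3_eq_3)
  then show ?thesis by (rule c(4))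
qed

end

section \<open>Schur covers of perfect groups\<close>

definition transport_group :: "('h \<Rightarrow> 'k) \<Rightarrow> ('h, 'c) monoid_scheme \<Rightarrow> 'k monoid" where
  "transport_group f H = \<lparr>carrier = f ` carrier H,
     mult = \<lambda>x y. f (inv_into (carrier H) f x \<otimes>\<^bsub>H\<^esub> inv_into (carrier H) f y),
     one = f \<one>\<^bsub>H\<^esub>\<rparr>"

lemma group_transport_group:
  assumes "group H" "inj_on f (carrier H)"
  shows "group (transport_group f H)"
proof -
  interpret H: group H by fact
  show ?thesis
  proof (rule groupI)
    fix x assume "x \<in> carrier (transport_group f H)"
    then obtain a where "a \<in> carrier H" "x = f a" by (auto simp: transport_group_def)
    then show "\<exists>y\<in>carrier (transport_group f H).
        y \<otimes>\<^bsub>transport_group f H\<^esub> x = \<one>\<^bsub>transport_group f H\<^esub>"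
      using assms(2) by (intro bexI[of _ "f (inv\<^bsub>H\<^esub> a)"]) (auto simp: transport_group_def)
  qed (use assms(2) in \<open>auto simp: transport_group_def H.m_assoc\<close>)
qed

lemma stem_extension_transport:
  assumes stem: "stem_extension H G \<pi>" and inj: "inj_on f (carrier H)"
  shows "stem_extension (transport_group f H) G (\<pi> \<circ> inv_into (carrier H) f)"
    and "kernel (transport_group f H) G (\<pi> \<circ> inv_into (carrier H) f) = f ` kernel H G \<pi>"
proof -
  let ?T = "transport_group f H" and ?g = "inv_into (carrier H) f"
  interpret H: group H using stem unfolding stem_extension_def by blast
  interpret T: group ?T using group_transport_group[OF H.is_group inj] .
  have \<pi>: "\<pi> \<in> hom H G" "\<pi> ` carrier H = carrier G"
    "kernel H G \<pi> \<subseteq> grp_center H \<inter> derived H (carrier H)" "finite (carrier H)" "group G"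
    using stem unfolding stem_extension_def by blast+
  have f: "f \<in> hom H ?T"
    using inj by (auto simp: hom_def transport_group_def)
  have carrier: "carrier ?T = f ` carrier H" by (simp add: transport_group_def)
  interpret f: group_hom H ?T f by unfold_locales (rule f)
  show ker: "kernel ?T G (\<pi> \<circ> ?g) = f ` kernel H G \<pi>"
    using inj by (auto simp: kernel_def carrier)
  have derived: "derived ?T (carrier ?T) = f ` derived H (carrier H)"
    using f.derived_img[of "carrier H"] by (simp add: carrier)
  have center: "f ` grp_center H \<subseteq> grp_center ?T"
    by (auto simp: grp_center_def carrier) (metis f.hom_mult)
  show "stem_extension ?T G (\<pi> \<circ> ?g)"
    unfolding stem_extension_def
  proof (intro conjI)
    show "\<pi> \<circ> ?g \<in> hom ?T G"
    proof (rule homI)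
      fix x y assume "x \<in> carrier ?T" "y \<in> carrier ?T"
      then obtain a b where ab: "a \<in> carrier H" "b \<in> carrier H" and xy: "x = f a" "y = f b"
        unfolding carrier by blast
      have "x \<otimes>\<^bsub>?T\<^esub> y = f (a \<otimes>\<^bsub>H\<^esub> b)"
        unfolding xy using f.hom_mult[OF ab] by (rule sym)
      then have "?g x = a" "?g y = b" "?g (x \<otimes>\<^bsub>?T\<^esub> y) = a \<otimes>\<^bsub>H\<^esub> b"
        using xy inv_into_f_f[OF inj] ab H.m_closed[OF ab] by metis+
      then show "(\<pi> \<circ> ?g) (x \<otimes>\<^bsub>?T\<^esub> y) = (\<pi> \<circ> ?g) x \<otimes>\<^bsub>G\<^esub> (\<pi> \<circ> ?g) y"
        using hom_mult[OF \<pi>(1) ab] by (simp only: comp_apply)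
    next
      fix x assume "x \<in> carrier ?T"
      then show "(\<pi> \<circ> ?g) x \<in> carrier G"
        using hom_in_carrier[OF \<pi>(1)] unfolding carrier by (auto simp: inv_into_f_f[OF inj])
    qed
    show "(\<pi> \<circ> ?g) ` carrier ?T = carrier G"
      using inj unfolding carrier image_comp \<pi>(2)[symmetric] by (intro image_cong) auto
    show "kernel ?T G (\<pi> \<circ> ?g) \<subseteq> grp_center ?T \<inter> derived ?T (carrier ?T)"
      unfolding ker derived using \<pi>(3) center by blast
  qed (use \<pi> T.is_group in \<open>simp_all add: carrier\<close>)
qed

text \<open>The definition compares with groups on \<open>nat\<close> only; an injection into
  \<open>nat\<close> carries a finite competitor on any type there.\<close>

lemma schur_cover_kernel_maximal:
  assumes "schur_cover H G \<pi>" "stem_extension H' G \<pi>'"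
  shows "card (kernel H' G \<pi>') \<le> card (kernel H G \<pi>)"
proof -
  have "finite (carrier H')" using assms(2) unfolding stem_extension_def by blast
  then obtain f :: "_ \<Rightarrow> nat" where f: "inj_on f (carrier H')"
    using finite_imp_inj_to_nat_seg by metis
  have "inj_on f (kernel H' G \<pi>')"
    using inj_on_subset[OF f] by (auto simp: kernel_def)
  then have "card (kernel H' G \<pi>') = card (f ` kernel H' G \<pi>')"
    by (simp add: card_image)
  also have "\<dots> \<le> card (kernel H G \<pi>)"
    using assms(1) stem_extension_transport[OF assms(2) f] unfolding schur_cover_def by metis
  finally show ?thesis .
qed

lemma schur_cover_central_extension:
  assumes "schur_cover H G \<pi>"
  shows "central_extension H G \<pi>"
  using assms unfolding schur_cover_def stem_extension_def central_extension_def central_extension_axioms_def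
  by blast

text \<open>The derived subgroup of the fibre product is a stem extension, and by maximality of the kernel
  it projects isomorphically onto the Schur cover.\<close>

lemma schur_cover_dominates:
  assumes cover: "schur_cover H G \<pi>" and perfect: "derived G (carrier G) = carrier G"
    and E: "central_extension E G \<rho>" "finite (carrier E)"
    and lc: "lifts_commute H \<pi> x y" and xy: "x \<in> carrier G" "y \<in> carrier G"
  shows "lifts_commute E \<rho> x y"
proof -
  interpret A: central_extension H G \<pi> using schur_cover_central_extension[OF cover] .
  interpret B: central_extension E G \<rho> by fact
  have stem: "finite (carrier H)" "kernel H G \<pi> \<subseteq> derived H (carrier H)"
    using cover unfolding schur_cover_def stem_extension_def by blast+
  interpret D: group "H \<times>\<times> E" using DirProd_group A.H.is_group B.H.is_group by blast
  let ?D = "H \<times>\<times> E"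
  \<comment> \<open>The fibre product of the two extensions over \<open>G\<close>.\<close>
  define P where "P = {p \<in> carrier ?D. \<pi> (fst p) = \<rho> (snd p)}"
  have P: "subgroup P ?D"
    by (rule D.subgroupI) (auto simp: P_def intro!: exI[of _ "\<one>\<^bsub>H\<^esub>"] exI[of _ "\<one>\<^bsub>E\<^esub>"])
  define Q where "Q = derived ?D P"
  have Q: "subgroup Q ?D"
    unfolding Q_def using D.derived_is_subgroup P subgroup.subset by blast
  have QP: "Q \<subseteq> P" unfolding Q_def using D.derived_incl[OF _ P] by blast
  let ?Q = "?D\<lparr>carrier := Q\<rparr>"
  interpret Q: group ?Q using D.subgroup_imp_group[OF Q] .
  interpret fst: group_hom ?D H fst
    by unfold_locales (auto simp: hom_def)
  have fstP: "fst ` P = carrier H"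
  proof
    show "carrier H \<subseteq> fst ` P"
    proof
      fix h assume h: "h \<in> carrier H"
      then obtain e where "e \<in> carrier E" "\<rho> e = \<pi> h" using B.lift[of "\<pi> h"] by auto
      then have "(h, e) \<in> P" using h by (simp add: P_def)
      then show "h \<in> fst ` P" by force
    qed
  qed (auto simp: P_def)
  \<comment> \<open>The derived subgroup of \<open>H\<close> maps onto the perfect group
    \<open>G\<close> and contains the kernel, so it is all of \<open>H\<close>.\<close>
  have perfectH: "derived H (carrier H) = carrier H"
  proof
    show "derived H (carrier H) \<subseteq> carrier H" using A.H.derived_in_carrier by blast
    show "carrier H \<subseteq> derived H (carrier H)"
    proof
      fix h assume h: "h \<in> carrier H"
      have "\<pi> ` derived H (carrier H) = carrier G"
        using A.\<pi>.derived_img[of "carrier H"] A.surj perfect by simp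
      then obtain d where d: "d \<in> derived H (carrier H)" "\<pi> d = \<pi> h"
        using h by (metis A.\<pi>.hom_closed imageE)
      have sub: "subgroup (derived H (carrier H)) H" using A.H.derived_is_subgroup by blast
      then have dH: "d \<in> carrier H" using d(1) subgroup.subset by blast
      obtain k where "k \<in> carrier H" "\<pi> k = \<one>\<^bsub>G\<^esub>" "h = d \<otimes>\<^bsub>H\<^esub> k"
        using A.same_image[OF dH h d(2)] by metis
      then show "h \<in> derived H (carrier H)"
        using stem(2) d(1) subgroup.m_closed[OF sub] by (auto simp: kernel_def)
    qed
  qed
  have fstQ: "fst ` Q = carrier H"
    unfolding Q_def using fst.derived_img[OF subgroup.subset[OF P]] fstP perfectH by simp
  have decomp: "\<exists>q \<in> Q. \<exists>n \<in> carrier E. \<rho> n = \<one>\<^bsub>G\<^esub> \<and> p = q \<otimes>\<^bsub>?D\<^esub> (\<one>\<^bsub>H\<^esub>, n)" if "p \<in> P" for p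
  proof -
    obtain h e where p: "p = (h, e)" "h \<in> carrier H" "e \<in> carrier E" "\<pi> h = \<rho> e"
      using \<open>p \<in> P\<close> unfolding P_def by auto
    obtain e' where q: "(h, e') \<in> Q" using fstQ p(2) by force
    then have "e' \<in> carrier E" "\<rho> e' = \<rho> e" using QP p(4) unfolding P_def by auto
    then obtain n where "n \<in> carrier E" "\<rho> n = \<one>\<^bsub>G\<^esub>" "e = e' \<otimes>\<^bsub>E\<^esub> n"
      using B.same_image[of e' e] p(3) by metis
    then show ?thesis using q p by (intro bexI[of _ "(h, e')"] bexI[of _ n]) auto
  qed
  have centralD: "(\<one>\<^bsub>H\<^esub>, n) \<otimes>\<^bsub>?D\<^esub> p = p \<otimes>\<^bsub>?D\<^esub> (\<one>\<^bsub>H\<^esub>, n)"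
    if "n \<in> carrier E" "\<rho> n = \<one>\<^bsub>G\<^esub>" "p \<in> carrier ?D" for n p
    using that B.kernel_comm by auto
  \<comment> \<open>Central factors cancel in commutators, so commutators of \<open>P\<close> are
    already commutators of \<open>Q\<close>. Thus \<open>Q\<close> is perfect.\<close>
  have "derived_set ?D P \<subseteq> derived_set ?D Q"
  proof
    fix d assume "d \<in> derived_set ?D P"
    then obtain p p' where "p \<in> P" "p' \<in> P"
      and d: "d = p \<otimes>\<^bsub>?D\<^esub> p' \<otimes>\<^bsub>?D\<^esub> inv\<^bsub>?D\<^esub> p \<otimes>\<^bsub>?D\<^esub> inv\<^bsub>?D\<^esub> p'" by blast
    then have pc: "p \<in> carrier ?D" "p' \<in> carrier ?D"
      using subgroup.subset[OF P] by blast+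
    obtain q n q' n' where q: "q \<in> Q" "q' \<in> Q" and n: "n \<in> carrier E" "\<rho> n = \<one>\<^bsub>G\<^esub>"
      "n' \<in> carrier E" "\<rho> n' = \<one>\<^bsub>G\<^esub>"
      and p: "p = q \<otimes>\<^bsub>?D\<^esub> (\<one>\<^bsub>H\<^esub>, n)" "p' = q' \<otimes>\<^bsub>?D\<^esub> (\<one>\<^bsub>H\<^esub>, n')"
      using decomp \<open>p \<in> P\<close> \<open>p' \<in> P\<close> by metis
    have qc: "q \<in> carrier ?D" "q' \<in> carrier ?D"
      using q subgroup.subset[OF Q] by blast+
    define z z' where "z = (\<one>\<^bsub>H\<^esub>, n)" and "z' = (\<one>\<^bsub>H\<^esub>, n')"
    have z: "z \<in> carrier ?D" "z' \<in> carrier ?D"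
      "\<And>u. u \<in> carrier ?D \<Longrightarrow> z \<otimes>\<^bsub>?D\<^esub> u = u \<otimes>\<^bsub>?D\<^esub> z"
      "\<And>u. u \<in> carrier ?D \<Longrightarrow> z' \<otimes>\<^bsub>?D\<^esub> u = u \<otimes>\<^bsub>?D\<^esub> z'"
      using n centralD unfolding z_def z'_def by auto
    have "p \<otimes>\<^bsub>?D\<^esub> p' = (q \<otimes>\<^bsub>?D\<^esub> q') \<otimes>\<^bsub>?D\<^esub> (z \<otimes>\<^bsub>?D\<^esub> z')"
      unfolding p z_def[symmetric] z'_def[symmetric] using z qc
      by (metis D.m_assoc D.m_closed)
    moreover have "p' \<otimes>\<^bsub>?D\<^esub> p = (q' \<otimes>\<^bsub>?D\<^esub> q) \<otimes>\<^bsub>?D\<^esub> (z \<otimes>\<^bsub>?D\<^esub> z')"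
      unfolding p z_def[symmetric] z'_def[symmetric] using z qc
      by (metis D.m_assoc D.m_closed)
    moreover have "d = (p \<otimes>\<^bsub>?D\<^esub> p') \<otimes>\<^bsub>?D\<^esub> inv\<^bsub>?D\<^esub> (p' \<otimes>\<^bsub>?D\<^esub> p)"
      unfolding d using pc by (simp add: D.inv_mult_group D.m_assoc del: carrier_DirProd)
    moreover have "q \<otimes>\<^bsub>?D\<^esub> q' \<otimes>\<^bsub>?D\<^esub> (z \<otimes>\<^bsub>?D\<^esub> z') \<otimes>\<^bsub>?D\<^esub>
        inv\<^bsub>?D\<^esub> ((q' \<otimes>\<^bsub>?D\<^esub> q) \<otimes>\<^bsub>?D\<^esub> (z \<otimes>\<^bsub>?D\<^esub> z')) =
        q \<otimes>\<^bsub>?D\<^esub> q' \<otimes>\<^bsub>?D\<^esub> inv\<^bsub>?D\<^esub> q \<otimes>\<^bsub>?D\<^esub> inv\<^bsub>?D\<^esub> q'"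
    proof -
      define w where "w = z \<otimes>\<^bsub>?D\<^esub> z'"
      have w: "w \<in> carrier ?D" unfolding w_def using z(1,2) by (rule D.m_closed)
      have "w \<otimes>\<^bsub>?D\<^esub> (inv\<^bsub>?D\<^esub> w \<otimes>\<^bsub>?D\<^esub> u) = u" if "u \<in> carrier ?D" for u
        using w that by (simp add: D.m_assoc[symmetric] del: carrier_DirProd one_DirProd)
      then show ?thesis unfolding w_def[symmetric] using w qc
        by (simp add: D.inv_mult_group D.m_assoc del: carrier_DirProd one_DirProd)
    qed
    ultimately show "d \<in> derived_set ?D Q" using q by auto
  qed
  then have "Q \<subseteq> derived ?D Q"
    unfolding Q_def derived_def[of _ P] derived_def[of _ "generate _ _"] by (rule D.mono_generate)
  then have derivedQ: "Q \<subseteq> derived ?Q Q" using D.derived_consistent[OF _ Q, of Q] by simp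
  have stemQ: "stem_extension ?Q G (\<pi> \<circ> fst)"
    unfolding stem_extension_def
  proof (intro conjI)
    show "group ?Q" by (rule Q.is_group)
    show "group G" by (rule A.G.is_group)
    show "finite (carrier ?Q)"
      using stem(1) E(2) subgroup.subset[OF Q] by (simp add: finite_subset)
    show "\<pi> \<circ> fst \<in> hom ?Q G"
      using subgroup.subset[OF Q] A.\<pi>.hom_mult by (auto simp: hom_def subset_iff)
    show "(\<pi> \<circ> fst) ` carrier ?Q = carrier G"
    proof -
      have "(\<pi> \<circ> fst) ` Q = \<pi> ` fst ` Q" by (rule image_comp[symmetric])
      then show ?thesis unfolding fstQ A.surj by simp
    qed
    show "kernel ?Q G (\<pi> \<circ> fst) \<subseteq> grp_center ?Q \<inter> derived ?Q (carrier ?Q)"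
    proof
      fix q assume "q \<in> kernel ?Q G (\<pi> \<circ> fst)"
      then have q: "q \<in> Q" "\<pi> (fst q) = \<one>\<^bsub>G\<^esub>" by (auto simp: kernel_def)
      moreover have "q \<otimes>\<^bsub>?D\<^esub> p = p \<otimes>\<^bsub>?D\<^esub> q" if "p \<in> Q" for p
      proof -
        have "q \<in> P" "p \<in> P" using q that QP by blast+
        then show ?thesis
          using q A.kernel_comm[of "fst q" "fst p"] B.kernel_comm[of "snd q" "snd p"]
          by (auto simp: P_def mult_DirProd')
      qed
      ultimately show "q \<in> grp_center ?Q \<inter> derived ?Q (carrier ?Q)"
        using derivedQ by (auto simp: grp_center_def)
    qed
  qed
  have finK: "finite (kernel ?Q G (\<pi> \<circ> fst))"
    using stemQ unfolding stem_extension_def kernel_def by simp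
  have img: "fst ` kernel ?Q G (\<pi> \<circ> fst) = kernel H G \<pi>"
  proof
    show "fst ` kernel ?Q G (\<pi> \<circ> fst) \<subseteq> kernel H G \<pi>"
      using subgroup.subset[OF Q] by (auto simp: kernel_def)
    show "kernel H G \<pi> \<subseteq> fst ` kernel ?Q G (\<pi> \<circ> fst)"
    proof
      fix k assume k: "k \<in> kernel H G \<pi>"
      then obtain e where "(k, e) \<in> Q" using fstQ by (force simp: kernel_def)
      then show "k \<in> fst ` kernel ?Q G (\<pi> \<circ> fst)" using k by (force simp: kernel_def)
    qed
  qed
  \<comment> \<open>The kernel of \<open>Q\<close> over \<open>G\<close> maps onto that of
    \<open>H\<close> and, by maximality of the latter, is not larger.\<close>
  have "inj_on fst (kernel ?Q G (\<pi> \<circ> fst))"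
    using schur_cover_kernel_maximal[OF cover stemQ] card_image_le[OF finK, of fst] finK
    unfolding img[symmetric] by (intro eq_card_imp_inj_on) auto
  then have trivial: "n = \<one>\<^bsub>E\<^esub>" if "(\<one>\<^bsub>H\<^esub>, n) \<in> Q" for n
    using that subgroup.one_closed[OF Q] by (force simp: kernel_def inj_on_def)
  obtain a b where ab: "a \<in> carrier H" "\<pi> a = x" "b \<in> carrier H" "\<pi> b = y"
    using A.lift xy by metis
  obtain e f where ef: "(a, e) \<in> Q" "(b, f) \<in> Q"
    using ab fstQ by (metis imageE prod.collapse)
  then have ef': "e \<in> carrier E" "f \<in> carrier E" "\<rho> e = x" "\<rho> f = y"
    using QP ab unfolding P_def by auto
  have comm: "a \<otimes>\<^bsub>H\<^esub> b = b \<otimes>\<^bsub>H\<^esub> a" using A.lcD lc ab by blast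
  \<comment> \<open>The commutator of the two elements of \<open>Q\<close> is trivial in the
    \<open>H\<close> coordinate, hence also in the \<open>E\<close> coordinate.\<close>
  have "((a, e) \<otimes>\<^bsub>?D\<^esub> (b, f)) \<otimes>\<^bsub>?D\<^esub> inv\<^bsub>?D\<^esub> ((b, f) \<otimes>\<^bsub>?D\<^esub> (a, e)) \<in> Q"
    using ef Q by (meson subgroup.m_closed subgroup.m_inv_closed)
  then have "(\<one>\<^bsub>H\<^esub>, (e \<otimes>\<^bsub>E\<^esub> f) \<otimes>\<^bsub>E\<^esub> inv\<^bsub>E\<^esub> (f \<otimes>\<^bsub>E\<^esub> e)) \<in> Q"
    using ab ef' comm by (simp add: inv_DirProd A.H.is_group B.H.is_group)
  then have "(e \<otimes>\<^bsub>E\<^esub> f) \<otimes>\<^bsub>E\<^esub> inv\<^bsub>E\<^esub> (f \<otimes>\<^bsub>E\<^esub> e) = \<one>\<^bsub>E\<^esub>" by (rule trivial)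
  then have "e \<otimes>\<^bsub>E\<^esub> f = f \<otimes>\<^bsub>E\<^esub> e"
    using ef' by (metis B.H.inv_equality B.H.inv_inv B.H.inv_closed B.H.m_closed)
  then show ?thesis using B.lcI ef' by blast
qed

section \<open>The spin double cover\<close>

lemma mod3_cases: obtains "x = (0::3)" | "x = 1" | "x = - 1"
proof (cases x)
  case (of_int z)
  then have "z = 0 \<or> z = 1 \<or> z = 2" by auto
  then show ?thesis using of_int that by auto
qed

lemma mod3_triple: "3 * x = (0::3)"
  by (cases x rule: mod3_cases) simp_all

lemma mod3_neg_eq: "- x = x \<longleftrightarrow> x = (0::3)"
  by (cases x rule: mod3_cases) simp_all

text \<open>The point 8 becomes the index \<open>0\<close>. The order on the type \<open>8\<close>
  only fixes signs, so this wrap-around does no harm.\<close>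

lemma bij_betw_of_nat_8: "bij_betw (of_nat :: nat \<Rightarrow> 8) {1..8} UNIV"
proof -
  have *: "{1..8::nat} = {1,2,3,4,5,6,7,8}" by auto
  have "inj_on (of_nat :: nat \<Rightarrow> 8) {1..8}"
    unfolding * by (simp add: inj_on_def)
  moreover have "card (UNIV :: 8 set) = 8" by simp
  ultimately show ?thesis
    by (intro bij_betw_imageI card_subset_eq) (simp_all add: card_image)
qed

text \<open>The Clifford algebra with generators \<open>e\<^sub>i\<close>, \<open>i\<close> ranging over the type \<open>8\<close>, and coefficients
  modulo 3: a function \<open>F\<close> on index sets stands for \<open>\<Sum>A. F A e\<^sub>A\<close>, and the two operators below are
  left and right multiplication by \<open>e\<^sub>i\<close>. Since \<open>-2 = 1\<close> modulo 3, the elements \<open>e\<^sub>i - e\<^sub>j\<close> have square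
  \<open>-1\<close>, and the scalars of the algebra that are units are \<open>\<plusminus>1\<close>.\<close>

type_synonym clifford = "8 set \<Rightarrow> 3"

definition flip :: "'i \<Rightarrow> 'i set \<Rightarrow> 'i set" where
  "flip i A = (if i \<in> A then A - {i} else insert i A)"

definition parity :: "'i set \<Rightarrow> 3" where
  "parity A = (if even (card A) then 1 else - 1)"

text \<open>The sign counts the generators of smaller index that \<open>e\<^sub>i\<close> passes on
  its way to its place in the product; \<open>e\<^sub>i\<close> has square 1.\<close>

definition lmul :: "8 \<Rightarrow> clifford \<Rightarrow> clifford" where
  "lmul i F = (\<lambda>A. parity {a \<in> A. a < i} * F (flip i A))"

definition rmul :: "8 \<Rightarrow> clifford \<Rightarrow> clifford" where
  "rmul i F = (\<lambda>A. parity {a \<in> A. i < a} * F (flip i A))"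

lemma flip_flip [simp]: "flip i (flip i A) = A"
  by (auto simp: flip_def)

lemma flip_commute: "flip i (flip j A) = flip j (flip i A)"
  by (auto simp: flip_def)

lemma parity_sq [simp]: "parity A * parity A = 1" "parity A * (parity A * x) = x"
  by (simp_all add: parity_def)

lemma parity_flip: "finite A \<Longrightarrow> parity (flip i A) = - parity A"
  by (cases "i \<in> A") (auto simp: parity_def flip_def card_insert_if dest: card_Suc_Diff1 split: if_splits)

lemma parity_filter_flip:
  "parity {a \<in> flip j (A :: 8 set). P a} = (if P j then - parity {a \<in> A. P a} else parity {a \<in> A. P a})"
proof (cases "P j")
  case True
  then have "{a \<in> flip j A. P a} = flip j {a \<in> A. P a}" by (auto simp: flip_def)
  then show ?thesis using True by (simp add: parity_flip)
next
  case False
  then have "{a \<in> flip j A. P a} = {a \<in> A. P a}" by (auto simp: flip_def)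
  then show ?thesis using False by simp
qed

lemma lmul_lmul_same [simp]: "lmul i (lmul i F) = F"
  by (simp add: lmul_def parity_filter_flip fun_eq_iff)

lemma lmul_anticommute: "i \<noteq> j \<Longrightarrow> lmul i (lmul j F) = - lmul j (lmul i F)"
  by (cases i j rule: linorder_cases)
     (auto simp: lmul_def parity_filter_flip fun_eq_iff flip_commute[of i j] mult.left_commute dest: order_less_asym)

lemma lmul_rmul_commute: "lmul i (rmul j F) = rmul j (lmul i F)"
  by (cases i j rule: linorder_cases)
     (auto simp: lmul_def rmul_def parity_filter_flip fun_eq_iff flip_commute[of i j] mult.left_commute dest: order_less_asym)

lemma lmul_add: "lmul i (F + F') = lmul i F + lmul i F'"
  by (simp add: lmul_def fun_eq_iff distrib_left)

lemma lmul_diff: "lmul i (F - F') = lmul i F - lmul i F'"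
  by (simp add: lmul_def fun_eq_iff right_diff_distrib)

lemma lmul_minus: "lmul i (- F) = - lmul i F"
  by (simp add: lmul_def fun_eq_iff)

lemma rmul_diff: "rmul i (F - F') = rmul i F - rmul i F'"
  by (simp add: rmul_def fun_eq_iff right_diff_distrib)

lemma rmul_minus: "rmul i (- F) = - rmul i F"
  by (simp add: rmul_def fun_eq_iff)

section \<open>The centre of the Clifford algebra\<close>

definition delta :: "8 set \<Rightarrow> clifford" where
  "delta A = (\<lambda>B. if B = A then 1 else 0)"

lemma lmul_delta: "i \<notin> A \<Longrightarrow> lmul i (delta A) = (\<lambda>B. parity {a \<in> A. a < i} * delta (insert i A) B)"
  by (auto simp: lmul_def delta_def fun_eq_iff flip_def)
     (metis (mono_tags, lifting) insert_Diff insert_iff order_less_irrefl)+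

lemma rmul_lmul_delta_empty: "rmul i (lmul i (delta {})) = delta {}"
  by (auto simp: lmul_def rmul_def delta_def fun_eq_iff flip_def parity_def cong: conj_cong)

lemma clifford_sum_delta:
  fixes F :: clifford
  shows "F = (\<Sum>A\<in>UNIV. (\<lambda>B. F A * delta A B))"
proof
  fix B
  have "(\<Sum>A\<in>UNIV. (\<lambda>B. F A * delta A B)) B = (\<Sum>A\<in>UNIV. F A * delta A B)"
    by (induction rule: finite_induct[OF finite]) simp_all
  also have "\<dots> = F B" by (simp add: delta_def if_distrib[of "(*) _"] cong: if_cong)
  finally show "F B = (\<Sum>A\<in>UNIV. (\<lambda>B. F A * delta A B)) B" by simp
qed

text \<open>The only scalars modulo 3 are 0, 1 and -1, so additive maps are linear.\<close>

lemma additive_scale3: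
  assumes "additive (u :: clifford \<Rightarrow> clifford)"
  shows "u (\<lambda>B. c * F B) = (\<lambda>B. c * u F B)"
proof (cases c rule: mod3_cases)
  case 1
  then show ?thesis using additive.zero[OF assms] by (simp add: zero_fun_def)
next
  case 3
  then show ?thesis using additive.minus[OF assms, of F] by (simp add: fun_Compl_def)
qed simp

text \<open>Left multiplications produce every basis element, up to sign, from the unit
  \<open>delta {}\<close>.\<close>

lemma additive_commuting_lmul_id:
  assumes u: "additive u" and L: "\<And>i F. u (lmul i F) = lmul i (u F)" and 1: "u (delta {}) = delta {}"
  shows "u = id"
proof -
  have delta: "u (delta A) = delta A" for A
  proof (induction A rule: finite_induct[OF finite])
    case 1
    then show ?case by (rule assms(3))
  next
    case (2 i A)
    define c where "c = parity {a \<in> A. a < i}"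
    have "u (lmul i (delta A)) = lmul i (delta A)" using L 2 by simp
    then have "(\<lambda>B. c * u (delta (insert i A)) B) = (\<lambda>B. c * delta (insert i A) B)"
      using lmul_delta[OF 2(2)] additive_scale3[OF u] by (simp add: c_def)
    then have "c * (c * u (delta (insert i A)) B) = c * (c * delta (insert i A) B)" for B
      by (simp add: fun_eq_iff)
    then show ?case unfolding c_def by (simp add: fun_eq_iff)
  qed
  show ?thesis
  proof
    fix F :: clifford
    have "u F = u (\<Sum>A\<in>UNIV. (\<lambda>B. F A * delta A B))" using clifford_sum_delta[of F] by simp
    also have "\<dots> = (\<Sum>A\<in>UNIV. (\<lambda>B. F A * delta A B))"
      unfolding additive.sum[OF u] additive_scale3[OF u] delta ..
    also have "\<dots> = F" by (rule clifford_sum_delta[symmetric])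
    finally show "u F = id F" by simp
  qed
qed

text \<open>The image \<open>z\<close> of the unit satisfies e_i z e_i = z for all i. On the
  coefficient of e_A this is multiplication by the sign of \<open>A - {i}\<close>; an index inside
  \<open>A\<close> and one outside give opposite signs. So only the scalar coefficient survives, and
  injectivity makes it 1 or -1.\<close>

lemma clifford_centre:
  assumes u: "additive u" "inj u" and L: "\<And>i F. u (lmul i F) = lmul i (u F)"
    and R: "\<And>i F. u (rmul i F) = rmul i (u F)"
  shows "u = id \<or> u = uminus"
proof -
  define z where "z = u (delta {})"
  have vanish: "z A = 0" if "A \<noteq> {}" for A
  proof -
    have z: "rmul i (lmul i z) = z" for i
      unfolding z_def using L R rmul_lmul_delta_empty by metis
    have zA: "(parity {a \<in> A. i < a} * parity {a \<in> A. a < i}) * z A = z A" for i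
      unfolding mult.assoc using fun_cong[OF z[of i], of A] by (simp add: lmul_def rmul_def parity_filter_flip)
    have "parity {a \<in> A. i < a} * parity {a \<in> A. a < i} = parity (A - {i})" for i
    proof -
      have "A - {i} = {a \<in> A. i < a} \<union> {a \<in> A. a < i}" by auto
      moreover have "card ({a \<in> A. i < a} \<union> {a \<in> A. a < i}) = card {a \<in> A. i < a} + card {a \<in> A. a < i}"
        by (rule card_Un_disjoint) auto
      ultimately have "card (A - {i}) = card {a \<in> A. i < a} + card {a \<in> A. a < i}"
        by simp
      then show ?thesis by (simp add: parity_def)
    qed
    then have par: "parity (A - {i}) * z A = z A" for i using zA[of i] by simp
    show ?thesis
    \<comment> \<open>For the product of all generators there is no index outside; it fails to be
      central because the number 8 of generators is even.\<close>
    proof (cases "A = UNIV")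
      case True
      have "card (UNIV - {1::8}) = 7" by (simp add: card_Diff_singleton)
      then show ?thesis using par[of 1] True by (simp add: parity_def mod3_neg_eq)
    next
      case False
      obtain i where i: "i \<in> A" using \<open>A \<noteq> {}\<close> by blast
      obtain j where j: "j \<notin> A" using False by blast
      have "A = flip i (A - {i})" using i by (auto simp: flip_def)
      then have "parity A = - parity (A - {i})" by (metis parity_flip finite)
      then have "- (parity (A - {i}) * z A) = z A" using par[of j] j by simp
      then show ?thesis using par[of i] by (simp add: mod3_neg_eq)
    qed
  qed
  have z: "z = (\<lambda>B. z {} * delta {} B)"
    using vanish by (auto simp: delta_def fun_eq_iff)
  show ?thesis
  proof (cases "z {}" rule: mod3_cases)
    case 1
    then have "u (delta {}) = u 0" using z additive.zero[OF u(1)] unfolding z_def by (simp add: zero_fun_def)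
    then have "delta {} = 0" using u(2) by (simp add: inj_eq)
    then have "delta {} {} = 0" by simp
    then show ?thesis by (simp add: delta_def)
  next
    case 2
    then have "u (delta {}) = delta {}" using z unfolding z_def by simp
    then show ?thesis using additive_commuting_lmul_id[OF u(1) L] by blast
  next
    case 3
    define v where "v F = - u F" for F
    have "additive v" using additive.add[OF u(1)] by (simp add: v_def additive_def)
    moreover have "v (lmul i F) = lmul i (v F)" for i F by (simp add: v_def L lmul_minus)
    moreover have "v (delta {}) = delta {}" using z 3 unfolding z_def v_def by (auto simp: fun_eq_iff)
    ultimately have "v = id" by (rule additive_commuting_lmul_id)
    then have "u F = - F" for F unfolding v_def by (metis id_apply minus_minus)
    then show ?thesis by auto
  qed
qed

section \<open>Lifts of permutations to the Clifford algebra\<close>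

definition signed :: "(nat \<Rightarrow> nat) \<Rightarrow> clifford \<Rightarrow> clifford" where
  "signed g F = (if evenperm g then F else - F)"

text \<open>Commuting with right multiplications makes \<open>u\<close> left multiplication by some
  s, and the last condition reads s e_k = sgn(g) e_(g k) s. The sign is dictated by transpositions:
  (e_a - e_b) e_a = -e_b (e_a - e_b), and e_a - e_b anticommutes with the other generators.\<close>

definition spin_lift :: "(nat \<Rightarrow> nat) \<Rightarrow> (clifford \<Rightarrow> clifford) \<Rightarrow> bool" where
  "spin_lift g u \<longleftrightarrow> additive u \<and> bij u \<and> (\<forall>i F. u (rmul i F) = rmul i (u F)) \<and>
     (\<forall>k \<in> {1..8}. \<forall>F. u (lmul (of_nat k) F) = signed g (lmul (of_nat (g k)) (u F)))"

lemma spin_lift_id: "spin_lift id id"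
  by (simp add: spin_lift_def signed_def additive_def)

lemma spin_lift_uminus: "spin_lift id uminus"
  by (simp add: spin_lift_def signed_def additive_def rmul_minus lmul_minus bij_uminus)

lemma spin_lift_comp:
  assumes g: "g permutes {1..8}" and h: "h permutes {1..8}" and u: "spin_lift g u" and v: "spin_lift h v"
  shows "spin_lift (g \<circ> h) (u \<circ> v)"
proof -
  have perm: "permutation g" "permutation h" using g h permutation_permutes by blast+
  have add: "additive u" "additive v" using u v unfolding spin_lift_def by blast+
  have "u (v (lmul (of_nat k) F)) = signed (g \<circ> h) (lmul (of_nat (g (h k))) (u (v F)))" if "k \<in> {1..8}" for k F
  proof -
    have "h k \<in> {1..8}" using permutes_in_image[OF h] that by blast
    then show ?thesis using that u v additive.minus[OF add(1)]
      by (simp add: spin_lift_def signed_def evenperm_comp[OF perm])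
  qed
  moreover have "additive (u \<circ> v)" using add by (simp add: additive_def)
  ultimately show ?thesis using u v by (simp add: spin_lift_def bij_comp)
qed

lemma spin_lift_inv:
  assumes g: "g permutes {1..8}" and u: "spin_lift g u"
  shows "spin_lift (inv' g) (inv' u)"
proof -
  have add: "additive u" and bij: "bij u" using u unfolding spin_lift_def by blast+
  have uv: "u (inv' u F) = F" "inv' u (u F) = F" for F
    using bij by (simp_all add: bij_is_surj surj_f_inv_f bij_is_inj)
  have eqI: "inv' u F = F'" if "F = u F'" for F F' using that uv by simp
  have "additive (inv' u)"
    unfolding additive_def using additive.add[OF add] uv by (intro allI eqI) simp
  moreover have "inv' u (rmul i F) = rmul i (inv' u F)" for i F
    using u uv by (intro eqI) (simp add: spin_lift_def)
  moreover have "inv' u (lmul (of_nat k) F) = signed (inv' g) (lmul (of_nat (inv' g k)) (inv' u F))" if "k \<in> {1..8}" for k F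
  proof (rule eqI)
    have k: "inv' g k \<in> {1..8}" using permutes_in_image[OF permutes_inv[OF g]] that by blast
    have "g (inv' g k) = k" using g permutes_inverses(1) by metis
    moreover have "evenperm (inv' g) = evenperm g"
      using evenperm_inv g permutation_permutes by blast
    ultimately show "lmul (of_nat k) F = u (signed (inv' g) (lmul (of_nat (inv' g k)) (inv' u F)))"
      using u k additive.minus[OF add] uv by (simp add: spin_lift_def signed_def)
  qed
  ultimately show ?thesis using bij by (simp add: spin_lift_def bij_imp_bij_inv)
qed

definition spin_transp :: "nat \<Rightarrow> nat \<Rightarrow> clifford \<Rightarrow> clifford" where
  "spin_transp a b F = lmul (of_nat a) F - lmul (of_nat b) F"

lemma of_nat_8_neq:
  assumes "a \<in> {1..8}" "b \<in> {1..8}" "a \<noteq> b"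
  shows "(of_nat a :: 8) \<noteq> of_nat b"
  using assms bij_betw_of_nat_8 unfolding bij_betw_def inj_on_def by blast

lemma spin_transp_sq:
  assumes "a \<in> {1..8}" "b \<in> {1..8}" "a \<noteq> b"
  shows "spin_transp a b (spin_transp a b F) = - F"
  using lmul_anticommute[OF of_nat_8_neq[OF assms], of F]
  by (simp add: spin_transp_def lmul_diff fun_eq_iff mod3_triple)

lemma spin_lift_transp:
  assumes ab: "a \<in> {1..8}" "b \<in> {1..8}" "a \<noteq> b"
  shows "spin_lift (transpose a b) (spin_transp a b)"
proof -
  have "additive (spin_transp a b)"
    by (simp add: additive_def spin_transp_def lmul_add)
  moreover have "bij (spin_transp a b)"
  proof (rule o_bij)
    \<comment> \<open>The fourth power is the identity, so the third power is a two-sided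
      inverse.\<close>
    show "(spin_transp a b \<circ> spin_transp a b \<circ> spin_transp a b) \<circ> spin_transp a b = id"
      "spin_transp a b \<circ> (spin_transp a b \<circ> spin_transp a b \<circ> spin_transp a b) = id"
      by (simp_all add: fun_eq_iff[of _ id] spin_transp_sq[OF ab])
  qed
  moreover have "spin_transp a b (rmul i F) = rmul i (spin_transp a b F)" for i F
    by (simp add: spin_transp_def lmul_rmul_commute rmul_diff)
  moreover have "spin_transp a b (lmul (of_nat k) F) =
      - lmul (of_nat (transpose a b k)) (spin_transp a b F)" if k: "k \<in> {1..8}" for k F
  proof -
    consider "k = a" | "k = b" | "k \<noteq> a" "k \<noteq> b" by blast
    then show ?thesis
    proof cases
      case 3
      then show ?thesis
        using lmul_anticommute[OF of_nat_8_neq[OF ab(1) k]] lmul_anticommute[OF of_nat_8_neq[OF ab(2) k]]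
        by (simp add: spin_transp_def lmul_diff)
    qed (simp_all add: spin_transp_def lmul_diff)
  qed
  ultimately show ?thesis
    using ab(3) by (simp add: spin_lift_def signed_def evenperm_swap)
qed

lemma spin_lift_exists:
  assumes "g permutes {1..8}"
  shows "\<exists>u. spin_lift g u"
  using assms finite_atLeastAtMost
proof (induction rule: permutes_induct)
  case id
  then show ?case using spin_lift_id by blast
next
  case (swap a b p)
  have "transpose a b permutes {1..8}" using swap by (simp add: permutes_swap_id)
  then show ?case using swap spin_lift_comp spin_lift_transp by blast
qed

lemma spin_lift_id_cases:
  assumes "spin_lift id u"
  shows "u = id \<or> u = uminus"
proof (rule clifford_centre)
  show "additive u" "inj u" "\<And>i F. u (rmul i F) = rmul i (u F)"
    using assms by (auto simp: spin_lift_def bij_is_inj)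
  fix i :: 8 and F
  obtain k where "k \<in> {1..8}" "i = of_nat k"
    using bij_betw_of_nat_8 unfolding bij_betw_def by blast
  then show "u (lmul i F) = lmul i (u F)"
    using assms by (simp add: spin_lift_def signed_def)
qed

lemma spin_transp_anticommute:
  assumes "{a, b, c, d} \<subseteq> {1..8}" "distinct [a, b, c, d]"
  shows "spin_transp a b (spin_transp c d F) = - spin_transp c d (spin_transp a b F)"
proof -
  have "lmul (of_nat x) (lmul (of_nat y) F) = - lmul (of_nat y) (lmul (of_nat x) F)"
    if "x \<in> {a, b}" "y \<in> {c, d}" for x y
    using that assms by (intro lmul_anticommute of_nat_8_neq) auto
  then show ?thesis by (simp add: spin_transp_def lmul_diff)
qed

text \<open>Two lifts of one permutation agree up to sign, which squaring removes, so the product of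
  \<open>spin_transp a b\<close> and \<open>spin_transp c d\<close> can be squared instead. The
  factors anticommute and have square -1, which leaves -1.\<close>

lemma spin_lift_double_transp_sq:
  assumes "{a, b, c, d} \<subseteq> {1..8}" "distinct [a, b, c, d]"
    and u: "spin_lift (transpose a b \<circ> transpose c d) u"
  shows "u (u F) = - F"
proof -
  define g where "g = transpose a b \<circ> transpose c d"
  define w where "w = spin_transp a b \<circ> spin_transp c d"
  have perm: "transpose a b permutes {1..8}" "transpose c d permutes {1..8}"
    using assms(1) by (auto intro: permutes_swap_id)
  then have g: "g permutes {1..8}" unfolding g_def by (rule permutes_compose[rotated])
  have w: "spin_lift g w"
    unfolding g_def w_def using assms perm by (intro spin_lift_comp spin_lift_transp) auto
  have "spin_lift (g \<circ> inv' g) (u \<circ> inv' w)"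
    using u[folded g_def] spin_lift_inv[OF g w] permutes_inv[OF g] g by (intro spin_lift_comp) simp_all
  then have "u \<circ> inv' w = id \<or> u \<circ> inv' w = uminus"
    using spin_lift_id_cases permutes_inv_o(1)[OF g] by metis
  moreover have "inv' w (w F) = F" for F
    using w by (simp add: spin_lift_def bij_is_inj)
  ultimately consider "\<And>F. u F = w F" | "\<And>F. u F = - w F"
    by (metis comp_apply id_apply)
  then have "u (u F) = w (w F)"
    using w by cases (simp_all add: spin_lift_def additive.minus)
  also have "w (w F) = - spin_transp a b (spin_transp a b (spin_transp c d (spin_transp c d F)))"
  proof -
    have "additive (spin_transp a b)" using spin_lift_transp assms by (simp add: spin_lift_def)
    then show ?thesis
      using spin_transp_anticommute[OF assms(1,2), of "spin_transp c d F"]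
      by (simp add: w_def additive.minus)
  qed
  also have "\<dots> = - F"
    using assms by (simp add: spin_transp_sq)
  finally show ?thesis .
qed

section \<open>Permutation groups and their spin covers\<close>

locale perm_group = group G for G :: "(nat \<Rightarrow> nat) monoid" (structure) +
  fixes n :: nat
  assumes mult_eq: "mult G = (\<circ>)" and one_eq: "one G = id"
    and permutes: "g \<in> carrier G \<Longrightarrow> g permutes {1..n}"
begin

lemma m_inv_eq: assumes "g \<in> carrier G" shows "m_inv G g = inv' g"
proof -
  have "m_inv G g \<circ> g = id" using l_inv[OF assms] by (simp add: mult_eq one_eq)
  then have "m_inv G g \<circ> (g \<circ> inv' g) = inv' g" by (simp add: comp_assoc[symmetric])
  then show ?thesis using permutes_inv_o(1)[OF permutes[OF assms]] by simp
qed

lemma comp_closed: "g \<in> carrier G \<Longrightarrow> h \<in> carrier G \<Longrightarrow> g \<circ> h \<in> carrier G"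
  using m_closed by (simp add: mult_eq)

lemma id_closed: "id \<in> carrier G"
  using one_closed by (simp add: one_eq)

lemma inv_perm_closed: "g \<in> carrier G \<Longrightarrow> inv' g \<in> carrier G"
  using inv_closed m_inv_eq by metis

lemma finite_carrier: "finite (carrier G)"
  by (rule finite_subset[OF _ finite_permutations[of "{1..n}"]]) (use permutes in auto)

end

lemma perm_group_sym: "perm_group (sym_group n) n"
  using sym_group_is_group
  by (simp add: perm_group_def perm_group_axioms_def sym_group_mult sym_group_one sym_group_carrier)

lemma perm_group_alt: "perm_group (alt_group n) n"
  using alt_group_is_group
  by (simp add: perm_group_def perm_group_axioms_def alt_group_mult alt_group_one alt_group_carrier)

text \<open>Recording the permutation beside its lift makes the projection to \<open>G\<close> equal
  to \<open>fst\<close>.\<close>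

definition spin_group :: "(nat \<Rightarrow> nat) monoid \<Rightarrow> ((nat \<Rightarrow> nat) \<times> (clifford \<Rightarrow> clifford)) monoid" where
  "spin_group G = \<lparr>carrier = {(g, u). g \<in> carrier G \<and> spin_lift g u},
     mult = \<lambda>(g, u) (h, v). (g \<circ> h, u \<circ> v), one = (id, id)\<rparr>"

context perm_group
begin

context
  assumes n8: "n \<le> 8"
begin

lemma permutes8: "g \<in> carrier G \<Longrightarrow> g permutes {1..8}"
  using permutes permutes_subset n8 by (metis atLeastatMost_subset_iff order_refl)

lemma group_spin_group: "group (spin_group G)"
proof (rule groupI)
  fix x assume "x \<in> carrier (spin_group G)"
  then obtain g u where x: "x = (g, u)" "g \<in> carrier G" "spin_lift g u"
    by (auto simp: spin_group_def)
  then have "(inv' g, inv' u) \<in> carrier (spin_group G)"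
    using spin_lift_inv permutes8 inv_perm_closed by (simp add: spin_group_def)
  moreover have "inv' u \<circ> u = id" using x(3) by (simp add: spin_lift_def bij_is_inj)
  moreover have "inv' g \<circ> g = id" using permutes_inv_o(2)[OF permutes[OF x(2)]] .
  ultimately show "\<exists>y\<in>carrier (spin_group G). y \<otimes>\<^bsub>spin_group G\<^esub> x = \<one>\<^bsub>spin_group G\<^esub>"
    using x(1) by (intro bexI[of _ "(inv' g, inv' u)"]) (auto simp: spin_group_def)
qed (auto simp: spin_group_def comp_closed id_closed spin_lift_id comp_assoc
       intro: spin_lift_comp permutes8)

lemma finite_spin_group: "finite (carrier (spin_group G))"
  by (rule finite_subset[of _ "carrier G \<times> UNIV"]) (auto simp: spin_group_def finite_carrier)

lemma central_extension_spin_group: "central_extension (spin_group G) G fst"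
proof -
  interpret S: group "spin_group G" by (rule group_spin_group)
  show ?thesis
  proof
    show "fst \<in> hom (spin_group G) G"
      by (auto simp: hom_def spin_group_def mult_eq)
    show "fst ` carrier (spin_group G) = carrier G"
      using spin_lift_exists permutes8 by (force simp: spin_group_def)
    show "kernel (spin_group G) G fst \<subseteq> grp_center (spin_group G)"
    proof
      fix x assume "x \<in> kernel (spin_group G) G fst"
      then obtain u where x: "x = (id, u)" "spin_lift id u" "(id, u) \<in> carrier (spin_group G)"
        by (auto simp: kernel_def spin_group_def one_eq)
      have "u \<circ> v = v \<circ> u" if "spin_lift g v" for g v
        using spin_lift_id_cases[OF x(2)] that
        by (auto simp: fun_eq_iff[of "_ \<circ> _"] spin_lift_def additive.minus)
      then show "x \<in> grp_center (spin_group G)"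
        using x by (auto simp: grp_center_def spin_group_def)
    qed
  qed
qed

lemma spin_double_transp_sq:
  assumes "{a, b, c, d} \<subseteq> {1..8}" "distinct [a, b, c, d]"
    and "s \<in> carrier (spin_group G)" "fst s = transpose a b \<circ> transpose c d"
  shows "s \<otimes>\<^bsub>spin_group G\<^esub> s = (id, uminus)"
proof -
  obtain u where "s = (transpose a b \<circ> transpose c d, u)" "spin_lift (transpose a b \<circ> transpose c d) u"
    using assms(3,4) by (cases s) (auto simp: spin_group_def)
  moreover have "transpose c d \<circ> transpose a b = transpose a b \<circ> transpose c d"
    using assms(2) by (auto simp: fun_eq_iff transpose_def)
  then have "(transpose a b \<circ> transpose c d) \<circ> (transpose a b \<circ> transpose c d) = id"
    by (metis comp_assoc comp_id transpose_comp_involutory)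
  ultimately show ?thesis
    using spin_lift_double_transp_sq[OF assms(1,2)]
    by (auto simp: spin_group_def fun_eq_iff[of "_ \<circ> _" uminus])
qed

end

end

lemma spin_group_uminus_neq_one: "(uminus :: clifford \<Rightarrow> clifford) \<noteq> id"
proof
  assume "(uminus :: clifford \<Rightarrow> clifford) = id"
  then have "(- delta {}) {} = delta {} {}" by simp
  then show False by (simp add: delta_def)
qed

text \<open>The lifts of (1 2) and (3 4) anticommute, so their commutator is -1; this puts the whole
  kernel into the derived subgroup.\<close>

lemma stem_extension_spin_sym:
  assumes "4 \<le> n" "n \<le> 8"
  shows "stem_extension (spin_group (sym_group n)) (sym_group n) fst"
    and "(id, uminus) \<in> kernel (spin_group (sym_group n)) (sym_group n) fst"
proof -
  let ?S = "spin_group (sym_group n)"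
  interpret P: perm_group "sym_group n" n by (rule perm_group_sym)
  interpret C: central_extension ?S "sym_group n" fst
    by (rule P.central_extension_spin_group[OF assms(2)])
  let ?a = "(transpose (1::nat) 2, spin_transp 1 2)" and ?b = "(transpose (3::nat) 4, spin_transp 3 4)"
  have ab: "?a \<in> carrier ?S" "?b \<in> carrier ?S"
    using assms by (auto simp: spin_group_def sym_group_carrier intro!: permutes_swap_id spin_lift_transp)
  have z: "(id, uminus) \<in> carrier ?S"
    by (simp add: spin_group_def spin_lift_uminus P.id_closed)
  have "transpose 1 2 \<circ> transpose 3 4 = transpose 3 4 \<circ> (transpose 1 2 :: nat \<Rightarrow> nat)"
    by (auto simp: fun_eq_iff transpose_def)
  moreover have "spin_transp 1 2 \<circ> spin_transp 3 4 = uminus \<circ> (spin_transp 3 4 \<circ> spin_transp 1 2)"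
    using spin_transp_anticommute[of 1 2 3 4] by (simp add: fun_eq_iff[of "_ \<circ> _"])
  ultimately have comm: "?a \<otimes>\<^bsub>?S\<^esub> ?b = (id, uminus) \<otimes>\<^bsub>?S\<^esub> (?b \<otimes>\<^bsub>?S\<^esub> ?a)"
    by (simp add: spin_group_def)
  define A B where "A = ?a" and "B = ?b"
  have "A \<otimes>\<^bsub>?S\<^esub> B \<otimes>\<^bsub>?S\<^esub> inv\<^bsub>?S\<^esub> A \<otimes>\<^bsub>?S\<^esub> inv\<^bsub>?S\<^esub> B = (id, uminus)"
    using comm ab z unfolding A_def[symmetric] B_def[symmetric]
    by (simp add: C.H.m_assoc C.H.inv_solve_right')
  then have "(id, uminus) \<in> derived_set ?S (carrier ?S)"
    using ab unfolding A_def[symmetric] B_def[symmetric] by force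
  then have z': "(id, uminus) \<in> derived ?S (carrier ?S)"
    unfolding derived_def by (rule generate.incl)
  have ker: "kernel ?S (sym_group n) fst \<subseteq> {\<one>\<^bsub>?S\<^esub>, (id, uminus)}"
    by (auto simp: kernel_def spin_group_def sym_group_one dest: spin_lift_id_cases)
  have "\<one>\<^bsub>?S\<^esub> \<in> derived ?S (carrier ?S)"
    unfolding derived_def by (rule generate.one)
  with z' ker have "kernel ?S (sym_group n) fst \<subseteq> derived ?S (carrier ?S)" by blast
  then show "stem_extension ?S (sym_group n) fst"
    using C.central C.hom C.surj C.H.is_group P.is_group P.finite_spin_group[OF assms(2)]
    unfolding stem_extension_def by blast
  show "(id, uminus) \<in> kernel ?S (sym_group n) fst"
    using z by (simp add: kernel_def sym_group_one)
qed

section \<open>The triple cover of the alternating group of degree 7\<close>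

text \<open>The Kneser graph on the 2-subsets of \<open>{1..7}\<close>, with disjoint sets adjacent, is the 1-skeleton of the
  matching complex of \<open>K\<^sub>7\<close>, which has first homology of order 3. The arcs below, with values \<open>1\<close> on
  \<open>({a, b}, {c, d})\<close> and \<open>-1\<close> on the reversed arc, form a nontrivial 1-cocycle modulo 3 (the 3-fold covering
  is the Conway-Smith graph). Its class is invariant under the alternating group, and the group of
  automorphisms of the covering above alternating permutations is the triple cover.\<close>

definition arcs :: "(nat \<times> nat \<times> nat \<times> nat) list" where
  "arcs = [(3, 4, 1, 2), (1, 2, 3, 5), (4, 6, 1, 2), (1, 2, 4, 7), (1, 2, 5, 6), (5, 7, 1, 2),
    (2, 3, 1, 4), (2, 5, 1, 4), (1, 4, 2, 7), (1, 4, 3, 6), (1, 4, 5, 6), (6, 7, 1, 4),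
    (1, 5, 2, 3), (1, 5, 2, 4), (2, 7, 1, 5), (3, 6, 1, 5), (4, 6, 1, 5), (1, 5, 6, 7),
    (1, 6, 2, 4), (2, 5, 1, 6), (1, 6, 3, 4), (3, 5, 1, 6), (4, 7, 1, 6), (1, 6, 5, 7),
    (2, 4, 1, 7), (1, 7, 2, 5), (1, 7, 4, 6), (5, 6, 1, 7), (2, 3, 4, 6), (4, 7, 2, 3),
    (5, 6, 2, 3), (2, 3, 5, 7), (2, 4, 3, 5), (2, 4, 3, 6), (3, 7, 2, 4), (3, 4, 2, 5),
    (3, 6, 2, 5), (2, 5, 3, 7), (2, 7, 3, 4), (3, 5, 2, 7), (5, 6, 3, 4), (3, 4, 6, 7),
    (3, 5, 4, 6), (6, 7, 3, 5), (3, 6, 4, 7), (5, 7, 3, 6), (4, 6, 3, 7), (3, 7, 5, 6)]"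

text \<open>Nested conditionals, so that evaluation by rewriting stops at the first mismatch.\<close>

fun is_arc :: "(nat \<times> nat \<times> nat \<times> nat) list \<Rightarrow> nat \<Rightarrow> nat \<Rightarrow> nat \<Rightarrow> nat \<Rightarrow> bool" where
  "is_arc [] a b c d = False"
| "is_arc ((a', b', c', d') # l) a b c d =
     (if a = a' then if b = b' then if c = c' then if d = d' then True
        else is_arc l a b c d else is_arc l a b c d else is_arc l a b c d else is_arc l a b c d)"

text \<open>\<open>arcs\<close> lists the two points of each pair in increasing order, hence
  \<open>min\<close> and \<open>max\<close>.\<close>

definition arc_value :: "nat \<Rightarrow> nat \<Rightarrow> nat \<Rightarrow> nat \<Rightarrow> int" where
  "arc_value a b c d = (if is_arc arcs (min a b) (max a b) (min c d) (max c d) then 1 else 0)"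

definition voltage :: "nat \<Rightarrow> nat \<Rightarrow> nat \<Rightarrow> nat \<Rightarrow> int" where
  "voltage a b c d = arc_value a b c d - arc_value c d a b"

lemma voltage_swap: "voltage b a c d = voltage a b c d" "voltage a b d c = voltage a b c d"
  by (simp_all add: voltage_def arc_value_def min.commute max.commute)

lemma voltage_reverse: "voltage c d a b = - voltage a b c d"
  by (simp add: voltage_def)

definition table :: "int list list \<Rightarrow> nat \<Rightarrow> nat \<Rightarrow> int" where
  "table T a b = T ! (a - 1) ! (b - 2)"

text \<open>Only pairs with \<open>a < b\<close>, \<open>c < d\<close> and \<open>a < c\<close> are
  tested; \<open>potential_if_check\<close> recovers the others from the symmetries of
  \<open>voltage\<close>.\<close>

definition potential_check :: "(nat \<Rightarrow> nat) \<Rightarrow> int list list \<Rightarrow> bool" where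
  "potential_check g T \<longleftrightarrow> list_all (\<lambda>a. list_all (\<lambda>b. list_all (\<lambda>c. list_all (\<lambda>d.
     if c = b then True else if d = b then True else
     (voltage (g a) (g b) (g c) (g d) - voltage a b c d - table T c d + table T a b) mod 3 = 0)
      [Suc c..<8]) [Suc a..<8]) [Suc a..<8]) [1..<8]"

definition cyc :: "nat \<Rightarrow> nat \<Rightarrow> nat \<Rightarrow> nat \<Rightarrow> nat" where
  "cyc a b c = cycle_of_list [a, b, c]"

lemma cyc_apply:
  "a \<noteq> b \<Longrightarrow> b \<noteq> c \<Longrightarrow> a \<noteq> c \<Longrightarrow> cyc a b c x = (if x = a then b else if x = b then c else if x = c then a else x)"
  by (simp add: cyc_def transpose_def)

text \<open>For \<open>a < b\<close>, the entry of row \<open>a\<close> and column \<open>b - 1\<close> of a table is the value at \<open>{a, b}\<close> of a potential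
  found by propagation along a spanning tree.\<close>

lemma potential_check_3: "potential_check (\<lambda>x. if x = 1 then 2 else if x = 2 then 3 else if x = 3 then 1 else x)
  [[0,0,2,1,0,0], [0,0,2,1,0,0], [0,0,2,1,0,0], [0,0,0,0,2,1], [0,0,0,0,1,2], [0,0,0,0,0,0]]"
  by code_simp

lemma potential_check_4: "potential_check (\<lambda>x. if x = 1 then 2 else if x = 2 then 4 else if x = 4 then 1 else x)
  [[0,0,2,1,2,1], [0,2,1,0,1,2], [0,0,1,0,1,2], [0,0,0,2,0,0], [0,0,0,0,2,1], [0,0,0,0,0,0]]"
  by code_simp

lemma potential_check_5: "potential_check (\<lambda>x. if x = 1 then 2 else if x = 2 then 5 else if x = 5 then 1 else x)
  [[0,0,2,1,1,2], [0,1,0,2,2,1], [0,0,0,2,2,1], [0,0,0,1,1,2], [0,0,0,0,0,0], [0,0,0,0,0,0]]"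
  by code_simp

lemma potential_check_6: "potential_check (\<lambda>x. if x = 1 then 2 else if x = 2 then 6 else if x = 6 then 1 else x)
  [[0,0,1,2,0,0], [0,0,1,2,0,0], [0,0,1,2,0,0], [0,0,0,0,1,2], [0,0,0,0,2,1], [0,0,0,0,0,0]]"
  by code_simp

lemma potential_check_7: "potential_check (\<lambda>x. if x = 1 then 2 else if x = 2 then 7 else if x = 7 then 1 else x)
  [[0,0,0,0,0,0], [0,0,2,1,0,0], [0,0,2,1,0,0], [0,0,0,0,1,1], [0,0,0,0,2,2], [0,0,0,0,0,0]]"
  by code_simp

text \<open>For any potential of (4 5 6), this is its value at {2, 7} minus its value at {1, 7},
  computed along the path through {3, 4}. Commuting lifts of (1 2 3) and (4 5 6) would make it 0
  modulo 3.\<close>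

lemma voltage_123_456:
  "(voltage 3 5 2 7 - voltage 3 4 2 7 + (voltage 1 7 3 5 - voltage 1 7 3 4)) mod 3 = 2"
  by code_simp

section \<open>Lifts of permutations to the threefold covering\<close>

definition pairs7 :: "nat set set" where
  "pairs7 = {e. e \<subseteq> {1..7} \<and> card e = 2}"

lemma finite_pairs7: "finite pairs7"
  by (rule finite_subset[of _ "Pow {1..7}"]) (auto simp: pairs7_def)

lemma pair_in_pairs7: "{a, b} \<subseteq> {1..7} \<Longrightarrow> a \<noteq> b \<Longrightarrow> {a, b} \<in> pairs7"
  by (simp add: pairs7_def)

lemma pairs7E:
  assumes "e \<in> pairs7"
  obtains a b where "e = {a, b}" "{a, b} \<subseteq> {1..7}" "a \<noteq> b"
  using assms unfolding pairs7_def card_2_iff by blast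

lemma image_in_pairs7:
  assumes "g permutes {1..7}"
  shows "g ` e \<in> pairs7 \<longleftrightarrow> e \<in> pairs7"
proof -
  have "inj g" using permutes_inj[OF assms] .
  then have "card (g ` e) = card e" by (simp add: card_image inj_on_subset)
  moreover have "g ` e \<subseteq> {1..7} \<longleftrightarrow> e \<subseteq> {1..7}"
    using permutes_in_image[OF assms] by blast
  ultimately show ?thesis by (simp add: pairs7_def)
qed

text \<open>\<open>f\<close> encodes the lift of \<open>g\<close> that sends a point (e, t) of the
  covering to (g e, t + f e); the equation says that edges go to edges. Fixing the value 0 off
  \<open>pairs7\<close> keeps the set of potentials finite.\<close>

definition potential :: "(nat \<Rightarrow> nat) \<Rightarrow> (nat set \<Rightarrow> 3) \<Rightarrow> bool" where
  "potential g f \<longleftrightarrow> (\<forall>e. e \<notin> pairs7 \<longrightarrow> f e = 0) \<and>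
     (\<forall>a b c d. {a, b, c, d} \<subseteq> {1..7} \<longrightarrow> distinct [a, b, c, d] \<longrightarrow>
        of_int (voltage (g a) (g b) (g c) (g d)) - of_int (voltage a b c d) = f {c, d} - f {a, b})"

lemma finite_potentials: "finite {f. potential g f}"
proof (rule finite_subset)
  show "{f. potential g f} \<subseteq> {f. \<forall>e. (e \<in> pairs7 \<longrightarrow> f e \<in> UNIV) \<and> (e \<notin> pairs7 \<longrightarrow> f e = 0)}"
    by (auto simp: potential_def)
qed (intro finite_set_of_finite_funs finite_pairs7 finite)

lemma potential_id: "potential id (\<lambda>e. 0)"
  by (simp add: potential_def)

lemma potential_comp:
  assumes h: "h permutes {1..7}" and f: "potential g f" and k: "potential h k"
  shows "potential (g \<circ> h) (\<lambda>e. k e + f (h ` e))"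
  unfolding potential_def
proof (intro conjI allI impI)
  fix e assume "e \<notin> pairs7"
  then show "k e + f (h ` e) = 0"
    using f k image_in_pairs7[OF h, of e] by (simp add: potential_def)
next
  fix a b c d :: nat assume *: "{a, b, c, d} \<subseteq> {1..7}" "distinct [a, b, c, d]"
  then have "{h a, h b, h c, h d} \<subseteq> {1..7}" using permutes_in_image[OF h] by blast
  moreover have "distinct [h a, h b, h c, h d]"
    using *(2) permutes_inj[OF h] by (auto simp: inj_eq)
  ultimately have "of_int (voltage (g (h a)) (g (h b)) (g (h c)) (g (h d))) - of_int (voltage (h a) (h b) (h c) (h d))
      = f {h c, h d} - f {h a, h b}"
    using f unfolding potential_def by blast
  moreover have "of_int (voltage (h a) (h b) (h c) (h d)) - of_int (voltage a b c d) = k {c, d} - k {a, b}"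
    using k * unfolding potential_def by blast
  ultimately show "of_int (voltage ((g \<circ> h) a) ((g \<circ> h) b) ((g \<circ> h) c) ((g \<circ> h) d)) - of_int (voltage a b c d)
      = k {c, d} + f (h ` {c, d}) - (k {a, b} + f (h ` {a, b}))"
    by (simp add: algebra_simps)
qed

lemma potential_inv:
  assumes g: "g permutes {1..7}" and f: "potential g f"
  shows "potential (inv' g) (\<lambda>e. - f (inv' g ` e))"
  unfolding potential_def
proof (intro conjI allI impI)
  fix e assume "e \<notin> pairs7"
  then show "- f (inv' g ` e) = 0"
    using f image_in_pairs7[OF permutes_inv[OF g], of e] by (simp add: potential_def)
next
  let ?h = "inv' g"
  fix a b c d :: nat assume *: "{a, b, c, d} \<subseteq> {1..7}" "distinct [a, b, c, d]"
  then have "{?h a, ?h b, ?h c, ?h d} \<subseteq> {1..7}" using permutes_in_image[OF permutes_inv[OF g]] by blast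
  moreover have "distinct [?h a, ?h b, ?h c, ?h d]"
    using *(2) permutes_inj[OF permutes_inv[OF g]] by (auto simp: inj_eq)
  ultimately have "of_int (voltage (g (?h a)) (g (?h b)) (g (?h c)) (g (?h d))) - of_int (voltage (?h a) (?h b) (?h c) (?h d))
      = f {?h c, ?h d} - f {?h a, ?h b}"
    using f unfolding potential_def by blast
  then show "of_int (voltage (?h a) (?h b) (?h c) (?h d)) - of_int (voltage a b c d)
      = - f (?h ` {c, d}) - - f (?h ` {a, b})"
    using permutes_inverses(1)[OF g] by (simp add: algebra_simps)
qed

text \<open>A potential of the identity agrees on disjoint pairs, and every pair has a common
  neighbour with \<open>{1, 2}\<close> in the Kneser graph, since at least 3 of the 7 points avoid
  both.\<close>

lemma potential_id_const:
  assumes f: "potential id f"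
  obtains t where "\<And>e. e \<in> pairs7 \<Longrightarrow> f e = t"
proof
  have disjoint: "f {a, b} = f {c, d}" if "{a, b, c, d} \<subseteq> {1..7}" "distinct [a, b, c, d]" for a b c d
  proof -
    have "of_int (voltage (id a) (id b) (id c) (id d)) - of_int (voltage a b c d) = f {c, d} - f {a, b}"
      using f that unfolding potential_def by blast
    then show ?thesis by simp
  qed
  fix e :: "nat set" assume "e \<in> pairs7"
  then obtain a b where ab: "e = {a, b}" "{a, b} \<subseteq> {1..7}" "a \<noteq> b" by (rule pairs7E)
  have "card ({1..7} - {a, b, 1, 2}) \<ge> card {1..7::nat} - card {a, b, 1, 2}"
    by (rule diff_card_le_card_Diff) simp
  moreover have "card {a, b, 1, 2} \<le> 4" by (simp add: card_insert_if)
  ultimately have "2 \<le> card ({1..7} - {a, b, 1, 2})" by simp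
  then obtain D where "D \<subseteq> {1..7} - {a, b, 1, 2}" "card D = 2" using obtain_subset_with_card_n by metis
  then obtain c d where "c \<noteq> d" "{c, d} \<subseteq> {1..7} - {a, b, 1, 2}" unfolding card_2_iff by blast
  then show "f e = f {1, 2}"
    using disjoint[of a b c d] disjoint[of c d 1 2] ab by auto
qed

lemma of_int_mod3:
  assumes "z mod 3 = (0::int)"
  shows "(of_int z :: 3) = 0"
proof -
  obtain k where "z = 3 * k" using assms by (metis mod_0_imp_dvd dvd_def)
  then show ?thesis by (simp add: mod3_triple)
qed

lemma potential_if_check:
  assumes "potential_check g T"
  shows "\<exists>f. potential g f"
proof -
  define f :: "nat set \<Rightarrow> 3" where "f e = (if e \<in> pairs7 then of_int (table T (Min e) (Max e)) else 0)" for e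
  define eq where "eq a b c d \<longleftrightarrow>
    (of_int (voltage (g a) (g b) (g c) (g d)) - of_int (voltage a b c d) :: 3) = f {c, d} - f {a, b}" for a b c d
  have sorted: "eq a b c d" if "{a, b, c, d} \<subseteq> {1..7}" "distinct [a, b, c, d]" "a < b" "c < d" "a < c" for a b c d
  proof -
    have "(voltage (g a) (g b) (g c) (g d) - voltage a b c d - table T c d + table T a b) mod 3 = 0"
      using assms that unfolding potential_check_def list_all_iff by (auto split: if_splits)
    then have "(of_int (voltage (g a) (g b) (g c) (g d) - voltage a b c d - table T c d + table T a b) :: 3) = 0"
      by (rule of_int_mod3)
    then show ?thesis
      using that pair_in_pairs7[of a b] pair_in_pairs7[of c d] by (simp add: eq_def f_def algebra_simps)
  qed
  have swap: "eq b a c d \<longleftrightarrow> eq a b c d" "eq a b d c \<longleftrightarrow> eq a b c d" for a b c d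
    by (simp_all add: eq_def voltage_swap insert_commute)
  have reverse: "eq c d a b" if "eq a b c d" for a b c d
    using that unfolding eq_def voltage_reverse[of "g c" "g d"] voltage_reverse[of c d]
    by (simp add: algebra_simps)
  have half: "eq a b c d" if "{a, b, c, d} \<subseteq> {1..7}" "distinct [a, b, c, d]" "a < b" "c < d" for a b c d
    using that sorted[of a b c d] reverse[OF sorted[of c d a b]] by (cases a c rule: linorder_cases) auto
  have half': "eq a b c d" if "{a, b, c, d} \<subseteq> {1..7}" "distinct [a, b, c, d]" "a < b" for a b c d
    using that half[of a b c d] half[of a b d c] swap(2)[of a b d c] by (cases c d rule: linorder_cases) auto
  have "eq a b c d" if "{a, b, c, d} \<subseteq> {1..7}" "distinct [a, b, c, d]" for a b c d
    using that half'[of a b c d] half'[of b a c d] swap(1)[of b a c d] by (cases a b rule: linorder_cases) auto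
  then have "potential g f" unfolding potential_def eq_def by (simp add: f_def)
  then show ?thesis by blast
qed

section \<open>Even permutations of 7 points lift\<close>

definition liftable :: "(nat \<Rightarrow> nat) set" where
  "liftable = {g. g permutes {1..7} \<and> (\<exists>f. potential g f)}"

lemma liftable_id: "id \<in> liftable"
  using potential_id by (auto simp: liftable_def permutes_id)

lemma liftable_comp: "g \<in> liftable \<Longrightarrow> h \<in> liftable \<Longrightarrow> g \<circ> h \<in> liftable"
  unfolding liftable_def using potential_comp permutes_compose by blast

lemma liftable_inv: "g \<in> liftable \<Longrightarrow> inv' g \<in> liftable"
  unfolding liftable_def using potential_inv permutes_inv by blast

lemma cyc_permutes:
  assumes "{a, b, c} \<subseteq> S"
  shows "cyc a b c permutes S"
proof -
  have "transpose a b permutes S" "transpose b c permutes S"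
    using assms by (auto intro: permutes_swap_id)
  then show ?thesis by (simp add: cyc_def permutes_compose)
qed

lemma cyc_in_alt_group:
  assumes "{a, b, c} \<subseteq> {1..n}" "distinct [a, b, c]"
  shows "cyc a b c \<in> carrier (alt_group n)"
  using assms cyc_permutes[OF assms(1)]
  by (simp add: alt_group_carrier cyc_def evenperm_comp permutation_swap_id evenperm_swap)

lemma cyc_rotate: "a \<noteq> b \<Longrightarrow> b \<noteq> c \<Longrightarrow> a \<noteq> c \<Longrightarrow> cyc b c a = cyc a b c"
  by (rule ext) (simp add: cyc_apply)

lemma cyc_inverse: "a \<noteq> b \<Longrightarrow> b \<noteq> c \<Longrightarrow> a \<noteq> c \<Longrightarrow> cyc a b c \<circ> cyc a b c = cyc a c b"
  by (rule ext) (simp add: cyc_apply)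

lemma cyc_cube: "a \<noteq> b \<Longrightarrow> b \<noteq> c \<Longrightarrow> a \<noteq> c \<Longrightarrow> cyc a b c \<circ> (cyc a b c \<circ> cyc a b c) = id"
  by (rule ext) (simp add: cyc_apply)

lemma cyc_conj:
  assumes "bij p" "distinct [a, b, c]"
  shows "p \<circ> cyc a b c \<circ> inv' p = cyc (p a) (p b) (p c)"
  using conjugation_of_cycle[OF assms(2,1)] by (simp add: cyc_def)

lemma liftable_conj:
  assumes "p \<in> liftable" "cyc a b c \<in> liftable" "distinct [a, b, c]"
  shows "cyc (p a) (p b) (p c) \<in> liftable"
proof -
  have "bij p" using assms(1) permutes_bij unfolding liftable_def by blast
  then show ?thesis
    using cyc_conj[OF _ assms(3)] liftable_comp[OF liftable_comp[OF assms(1,2)] liftable_inv[OF assms(1)]] by simp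
qed

lemma liftable_cyc_1_2:
  assumes "k \<in> {3..7}"
  shows "cyc 1 2 k \<in> liftable"
proof -
  have "k = 3 \<or> k = 4 \<or> k = 5 \<or> k = 6 \<or> k = 7" using assms by auto
  moreover have "cyc 1 2 k = (\<lambda>x. if x = 1 then 2 else if x = 2 then k else if x = k then 1 else x)"
    using assms by (intro ext) (simp add: cyc_apply)
  ultimately have "\<exists>f. potential (cyc 1 2 k) f"
    using potential_if_check[OF potential_check_3] potential_if_check[OF potential_check_4]
      potential_if_check[OF potential_check_5] potential_if_check[OF potential_check_6]
      potential_if_check[OF potential_check_7]
    by (elim disjE) (simp_all only:)
  then show ?thesis using assms cyc_permutes[of 1 2 k "{1..7}"] by (simp add: liftable_def)
qed

lemma liftable_cyc_1:
  assumes "1 < a" "1 < b" "a \<le> 7" "b \<le> 7" "a \<noteq> b"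
  shows "cyc 1 a b \<in> liftable"
proof -
  consider "a = 2" | "b = 2" | "a \<noteq> 2" "b \<noteq> 2" by blast
  then show ?thesis
  proof cases
    case 1
    then show ?thesis using assms liftable_cyc_1_2[of b] by simp
  next
    case 2
    then have "cyc 1 2 a \<in> liftable" using assms liftable_cyc_1_2[of a] by simp
    then have "cyc 1 2 a \<circ> cyc 1 2 a \<in> liftable" using liftable_comp by blast
    then show ?thesis using assms 2 by (simp add: cyc_inverse)
  next
    case 3
    then have ab: "a \<in> {3..7}" "b \<in> {3..7}" using assms by simp_all
    have "cyc 1 2 b \<circ> cyc 1 2 b \<in> liftable" using liftable_cyc_1_2[OF ab(2)] liftable_comp by blast
    then have "cyc 1 b 2 \<in> liftable" using assms ab by (simp add: cyc_inverse)
    \<comment> \<open>Conjugating (1 2 a) by (1 b 2) gives (b 1 a).\<close>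
    from liftable_conj[OF this liftable_cyc_1_2[OF ab(1)]]
    have "cyc b 1 a \<in> liftable" using ab assms by (simp add: cyc_apply)
    then show ?thesis using ab assms cyc_rotate[of b 1 a] by simp
  qed
qed

lemma liftable_cyc:
  assumes "{a, b, c} \<subseteq> {1..7}" "distinct [a, b, c]"
  shows "cyc a b c \<in> liftable"
proof -
  have gt: "x = 1 \<or> 1 < x" if "x \<in> {1..7}" for x :: nat
    using that by auto
  have abc: "a \<in> {1..7}" "b \<in> {1..7}" "c \<in> {1..7}" "a \<noteq> b" "b \<noteq> c" "a \<noteq> c"
    using assms by simp_all
  consider "a = 1" | "b = 1" | "c = 1" | "a \<noteq> 1" "b \<noteq> 1" "c \<noteq> 1" by blast
  then show ?thesis
  proof cases
    case 1
    then show ?thesis using abc gt[of b] gt[of c] liftable_cyc_1[of b c] by simp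
  next
    case 2
    then show ?thesis using abc gt[of a] gt[of c] liftable_cyc_1[of c a] cyc_rotate[of a b c] by simp
  next
    case 3
    then show ?thesis using abc gt[of a] gt[of b] liftable_cyc_1[of a b] cyc_rotate[of c a b] by simp
  next
    case 4
    \<comment> \<open>With one more point \<open>x\<close>, the cycle (1 c x) sends 1 to
      \<open>c\<close> and fixes \<open>a\<close> and \<open>b\<close>; it conjugates (1 a b) into
      (c a b).\<close>
    have "card {a, b, c, 1} \<le> 4" by (simp add: card_insert_if)
    then have "\<not> {1..7} \<subseteq> {a, b, c, 1}" using card_mono[of "{a, b, c, 1}" "{1..7::nat}"] by auto
    then obtain x where x: "x \<in> {1..7}" "x \<notin> {a, b, c, 1}" by blast
    have p: "cyc 1 c x \<in> liftable" by (rule liftable_cyc_1) (use gt[of c] gt[of x] abc x 4 in auto)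
    have "cyc 1 a b \<in> liftable" by (rule liftable_cyc_1) (use gt[of a] gt[of b] abc 4 in auto)
    from liftable_conj[OF p this] have "cyc (cyc 1 c x 1) (cyc 1 c x a) (cyc 1 c x b) \<in> liftable"
      using abc 4 by auto
    moreover have "cyc 1 c x 1 = c" "cyc 1 c x a = a" "cyc 1 c x b = b"
      using abc x 4 by (auto simp: cyc_apply)
    ultimately have "cyc c a b \<in> liftable" by (simp only:)
    then show ?thesis using assms cyc_rotate[of c a b] by simp
  qed
qed

lemma alt_group_7_liftable:
  assumes "g \<in> carrier (alt_group 7)"
  shows "g \<in> liftable"
proof -
  have lift_inv: "h \<in> liftable \<Longrightarrow> h \<in> carrier (alt_group 7) \<Longrightarrow> m_inv (alt_group 7) h \<in> liftable" for h
    using liftable_inv alt_group_inv_equality by metis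
  have three: "h \<in> liftable \<and> h \<in> carrier (alt_group 7)" if h: "h \<in> three_cycles 7" for h
  proof -
    obtain cs where cs: "h = cycle_of_list cs" "cycle cs" "length cs = 3" "set cs \<subseteq> {1..7}"
      using h by auto
    then obtain a b c where abc: "cs = [a, b, c]" using stupid_lemma by blast
    have "cyc a b c \<in> liftable" by (rule liftable_cyc) (use cs abc in auto)
    moreover have "h = cyc a b c" using cs abc by (simp add: cyc_def)
    moreover have "h \<in> carrier (alt_group 7)" using three_cycles_incl h by (rule subsetD)
    ultimately show ?thesis by simp
  qed
  have "g \<in> generate (alt_group 7) (three_cycles 7)"
    using assms alt_group_carrier_as_three_cycles by blast
  then show ?thesis
  proof (induction rule: generate.induct)
    case one
    then show ?case unfolding alt_group_one by (rule liftable_id)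
  next
    case (incl h)
    then show ?case using three by blast
  next
    case (inv h)
    then show ?case using three lift_inv by blast
  next
    case (eng h1 h2)
    then show ?case using liftable_comp by (simp only: alt_group_mult)
  qed
qed

section \<open>The group of lifts of alternating permutations\<close>

definition voltage_group :: "(nat \<Rightarrow> nat) monoid \<Rightarrow> ((nat \<Rightarrow> nat) \<times> (nat set \<Rightarrow> 3)) monoid" where
  "voltage_group G = \<lparr>carrier = {(g, f). g \<in> carrier G \<and> potential g f},
     mult = \<lambda>(g, f) (h, k). (g \<circ> h, \<lambda>e. k e + f (h ` e)), one = (id, \<lambda>e. 0)\<rparr>"

context
  fixes n :: nat
  assumes n7: "n \<le> 7"
begin

interpretation perm_group "alt_group n" n
  by (rule perm_group_alt)

lemma alt_permutes7: "g \<in> carrier (alt_group n) \<Longrightarrow> g permutes {1..7}"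
  using permutes permutes_subset n7 by (metis atLeastatMost_subset_iff order_refl)

lemma alt_liftable: "g \<in> carrier (alt_group n) \<Longrightarrow> g \<in> liftable"
  using alt_group_7_liftable alt_permutes7 by (simp add: alt_group_carrier)

lemma group_voltage_group: "group (voltage_group (alt_group n))"
proof (rule groupI)
  fix x assume "x \<in> carrier (voltage_group (alt_group n))"
  then obtain g f where x: "x = (g, f)" "g \<in> carrier (alt_group n)" "potential g f"
    by (auto simp: voltage_group_def)
  then have "(inv' g, \<lambda>e. - f (inv' g ` e)) \<in> carrier (voltage_group (alt_group n))"
    using potential_inv alt_permutes7 inv_perm_closed by (simp add: voltage_group_def)
  moreover have "inv' g \<circ> g = id" using permutes_inv_o(2)[OF permutes[OF x(2)]] .
  ultimately show "\<exists>y\<in>carrier (voltage_group (alt_group n)).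
      y \<otimes>\<^bsub>voltage_group (alt_group n)\<^esub> x = \<one>\<^bsub>voltage_group (alt_group n)\<^esub>"
    using x(1) by (intro bexI[of _ "(inv' g, \<lambda>e. - f (inv' g ` e))"]) (auto simp: voltage_group_def image_comp permutes_inverses[OF permutes[OF x(2)]])
qed (auto simp: voltage_group_def comp_closed id_closed potential_id comp_assoc image_comp algebra_simps
       intro: potential_comp alt_permutes7)

lemma finite_voltage_group: "finite (carrier (voltage_group (alt_group n)))"
proof (rule finite_subset)
  show "carrier (voltage_group (alt_group n)) \<subseteq> Sigma (carrier (alt_group n)) (\<lambda>g. {f. potential g f})"
    by (auto simp: voltage_group_def)
qed (intro finite_SigmaI finite_carrier finite_potentials)

lemma central_extension_voltage_group:
  "central_extension (voltage_group (alt_group n)) (alt_group n) fst"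
proof -
  interpret S: group "voltage_group (alt_group n)" by (rule group_voltage_group)
  show ?thesis
  proof
    show "fst \<in> hom (voltage_group (alt_group n)) (alt_group n)"
      by (auto simp: hom_def voltage_group_def mult_eq)
    show "fst ` carrier (voltage_group (alt_group n)) = carrier (alt_group n)"
      using alt_liftable by (force simp: voltage_group_def liftable_def)
    show "kernel (voltage_group (alt_group n)) (alt_group n) fst \<subseteq> grp_center (voltage_group (alt_group n))"
    proof
      fix x assume "x \<in> kernel (voltage_group (alt_group n)) (alt_group n) fst"
      then obtain f where x: "x = (id, f)" "potential id f" "(id, f) \<in> carrier (voltage_group (alt_group n))"
        by (auto simp: kernel_def voltage_group_def one_eq)
      obtain t where t: "\<And>e. e \<in> pairs7 \<Longrightarrow> f e = t" using potential_id_const[OF x(2)] by blast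
      \<comment> \<open>A potential of the identity is constant on \<open>pairs7\<close> and 0
        elsewhere, so relabelling the points does not change it. This makes the kernel
        central.\<close>
      have "f (h ` e) = f e" if "h \<in> carrier (alt_group n)" for h e
        using t[of e] t[of "h ` e"] x(2) image_in_pairs7[OF alt_permutes7[OF that], of e]
        by (cases "e \<in> pairs7") (auto simp: potential_def)
      then show "x \<in> grp_center (voltage_group (alt_group n))"
        using x by (auto simp: grp_center_def voltage_group_def add.commute)
    qed
  qed
qed

lemma voltage_group_not_commute:
  assumes "6 \<le> n"
  shows "\<not> lifts_commute (voltage_group (alt_group n)) fst (cyc 1 2 3) (cyc 4 5 6)"
proof
  let ?E = "voltage_group (alt_group n)"
  assume lc: "lifts_commute ?E fst (cyc 1 2 3) (cyc 4 5 6)"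
  interpret C: central_extension ?E "alt_group n" fst by (rule central_extension_voltage_group)
  have "cyc 1 2 3 \<in> carrier (alt_group n)" "cyc 4 5 6 \<in> carrier (alt_group n)"
    by (rule cyc_in_alt_group; use assms in simp)+
  then obtain f k where fk: "(cyc 1 2 3, f) \<in> carrier ?E" "(cyc 4 5 6, k) \<in> carrier ?E"
    using C.lift by (metis prod.collapse)
  then have "(cyc 1 2 3, f) \<otimes>\<^bsub>?E\<^esub> (cyc 4 5 6, k) = (cyc 4 5 6, k) \<otimes>\<^bsub>?E\<^esub> (cyc 1 2 3, f)"
    using C.lcD[of "(cyc 1 2 3, f)" "(cyc 4 5 6, k)"] lc by simp
  then have "(\<lambda>e. k e + f (cyc 4 5 6 ` e)) = (\<lambda>e. f e + k (cyc 1 2 3 ` e))"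
    by (simp add: voltage_group_def)
  \<comment> \<open>The pair {1, 7} is fixed by (4 5 6) and sent to {2, 7} by (1 2 3), so the
    unknown \<open>f\<close> cancels.\<close>
  from fun_cong[OF this, of "{1, 7}"] have k: "k {1, 7} = k {2, 7}"
    by (simp add: cyc_apply insert_commute)
  have pot: "potential (cyc 4 5 6) k" using fk by (simp add: voltage_group_def)
  have "of_int (voltage 3 5 2 7) - of_int (voltage 3 4 2 7) = k {2, 7} - k {3, 4}"
    using pot[unfolded potential_def, THEN conjunct2, rule_format, of 3 4 2 7] by (simp add: cyc_apply)
  moreover have "of_int (voltage 1 7 3 5) - of_int (voltage 1 7 3 4) = k {3, 4} - k {1, 7}"
    using pot[unfolded potential_def, THEN conjunct2, rule_format, of 1 7 3 4] by (simp add: cyc_apply)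
  ultimately have "(of_int (voltage 3 5 2 7 - voltage 3 4 2 7 + (voltage 1 7 3 5 - voltage 1 7 3 4)) :: 3)
      = (k {2, 7} - k {3, 4}) + (k {3, 4} - k {1, 7})"
    by (simp only: of_int_add of_int_diff)
  also have "\<dots> = 0" using k by simp
  finally have "(of_int (voltage 3 5 2 7 - voltage 3 4 2 7 + (voltage 1 7 3 5 - voltage 1 7 3 4)) :: 3) = 0" .
  moreover define z where "z = voltage 3 5 2 7 - voltage 3 4 2 7 + (voltage 1 7 3 5 - voltage 1 7 3 4)"
  moreover have "z = 3 * (z div 3) + 2" using voltage_123_456 unfolding z_def by presburger
  ultimately have "(of_int (3 * (z div 3) + 2) :: 3) = 0" by simp
  then show False by (simp add: mod3_triple)
qed

end

section \<open>Stem extensions of symmetric groups\<close>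

lemma ex_permutes_map:
  assumes "distinct xs" "distinct ys" "length xs = length ys" "set xs \<subseteq> S" "set ys \<subseteq> S"
  shows "\<exists>p. p permutes S \<and> map p xs = ys"
  using assms(3,1,2,4,5)
proof (induction xs ys rule: list_induct2)
  case Nil
  show ?case using permutes_id[of S] by (intro exI[of _ id]) (simp only: list.map simp_thms)
next
  case (Cons x xs y ys)
  then obtain p where p: "p permutes S" "map p xs = ys" by auto
  have "p x \<in> S" using Cons permutes_in_image[OF p(1)] by simp
  then have "transpose (p x) y permutes S" using Cons by (simp add: permutes_swap_id)
  then have "transpose (p x) y \<circ> p permutes S" using permutes_compose[OF p(1)] by blast
  have *: "transpose (p x) y (p z) = p z" if "z \<in> set xs" for z
  proof -
    have "p z \<noteq> p x" using that Cons permutes_inj[OF p(1)] by (auto simp: inj_eq)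
    moreover have "p z \<noteq> y" using that p(2) Cons by auto
    ultimately show ?thesis by simp
  qed
  have "map (transpose (p x) y \<circ> p) xs = map p xs" using * by simp
  then have "map (transpose (p x) y \<circ> p) (x # xs) = y # ys" using p(2) by simp
  with \<open>transpose (p x) y \<circ> p permutes S\<close> show ?case
    by (intro exI[of _ "transpose (p x) y \<circ> p"] conjI)
qed

lemma transpose_conj:
  assumes "bij p" "a \<noteq> b"
  shows "p \<circ> transpose a b \<circ> inv' p = transpose (p a) (p b)"
  using conjugation_of_cycle[of "[a, b]" p] assms by simp

locale sym_extension = central_extension H "sym_group n" \<pi>
  for H :: "('h, 'c) monoid_scheme" (structure) and n :: nat and \<pi> :: "'h \<Rightarrow> (nat \<Rightarrow> nat)"
begin

sublocale perm_group "sym_group n" n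
  by (rule perm_group_sym)

text \<open>S_n is transitive on quadruples of distinct points, so one pair of disjoint
  transpositions decides for all.\<close>

lemma lc_transpose_conj:
  assumes "lc (transpose a b) (transpose c d)" "distinct [a, b, c, d]" "{a, b, c, d} \<subseteq> {1..n}"
    and "distinct [a', b', c', d']" "{a', b', c', d'} \<subseteq> {1..n}"
  shows "lc (transpose a' b') (transpose c' d')"
proof -
  obtain p where p: "p permutes {1..n}" "map p [a, b, c, d] = [a', b', c', d']"
    using ex_permutes_map[of "[a, b, c, d]" "[a', b', c', d']" "{1..n}"] assms by auto
  have mem: "transpose a b \<in> carrier (sym_group n)" "transpose c d \<in> carrier (sym_group n)" "p \<in> carrier (sym_group n)"
    using assms(3) p(1) by (auto simp: sym_group_carrier intro: permutes_swap_id)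
  show ?thesis
    using lc_conj[OF assms(1) mem] p(2) assms(2) m_inv_eq[OF mem(3)] transpose_conj[OF permutes_bij[OF p(1)]]
    by (simp add: sym_group_mult)
qed

context
  assumes n2: "2 \<le> n"
    and disjoint_lc: "\<And>a b c d. distinct [a, b, c, d] \<Longrightarrow> {a, b, c, d} \<subseteq> {1..n} \<Longrightarrow>
      lc (transpose a b) (transpose c d)"
begin

lemma transp_mem: "{a, b} \<subseteq> {1..n} \<Longrightarrow> transpose a b \<in> carrier (sym_group n)"
  by (auto simp: sym_group_carrier intro: permutes_swap_id)

text \<open>The centralizer of (1 2) is generated by (1 2) and the transpositions of {3..n}, and the
  lifts of each generator commute with those of (1 2).\<close>

lemma lc_centralizer_of_transposition:
  assumes g: "g \<in> carrier (sym_group n)" and comm: "g \<circ> transpose 1 2 \<circ> inv' g = transpose 1 2"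
  shows "lc (transpose 1 2) g"
proof -
  let ?t = "transpose (1::nat) 2"
  have t: "?t \<in> carrier (sym_group n)" using n2 by (intro transp_mem) simp
  have fixing: "lc ?t h" if "h permutes {3..n}" for h
    using that finite_atLeastAtMost
  proof (induction rule: permutes_induct)
    case id
    then show ?case using lc_one[OF t] by (simp only: sym_group_one)
  next
    case (swap a b p)
    have "lc ?t (transpose a b)" using swap n2 by (intro disjoint_lc) auto
    moreover have "p \<in> carrier (sym_group n)"
      using permutes_subset[OF \<open>p permutes {3..n}\<close>, of "{1..n}"] by (auto simp: sym_group_carrier)
    moreover have "transpose a b \<in> carrier (sym_group n)" using swap by (intro transp_mem) auto
    ultimately show ?case using lc_mult[OF _ \<open>lc ?t p\<close> t] by (simp only: sym_group_mult)
  qed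
  have perm: "g permutes {1..n}" using g by (simp add: sym_group_carrier)
  have "transpose (g 1) (g 2) = ?t"
    using comm transpose_conj[OF permutes_bij[OF perm], of 1 2] by simp
  then have "transpose (g 1) (g 2) 1 = 2" by simp
  then have cases: "(g 1 = 1 \<and> g 2 = 2) \<or> (g 1 = 2 \<and> g 2 = 1)"
    by (auto simp: transpose_def split: if_splits)
  have pointwise: "lc ?t h" if "h permutes {1..n}" "h 1 = 1" "h 2 = 2" for h
  proof (rule fixing, rule permutes_superset[OF that(1)])
    fix x assume "x \<in> {1..n} - {3..n}"
    then have "x = 1 \<or> x = 2" by auto
    then show "h x = x" using that by auto
  qed
  from cases show ?thesis
  proof
    assume "g 1 = 2 \<and> g 2 = 1"
    then have "lc ?t (?t \<circ> g)"
      using perm t by (intro pointwise permutes_compose) (auto simp: sym_group_carrier)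
    then have "lc ?t (?t \<circ> (?t \<circ> g))"
      using lc_mult[OF lc_refl[OF t] _ t t] t g comp_closed by (simp only: sym_group_mult)
    then show ?thesis by (simp add: comp_assoc[symmetric])
  qed (use pointwise perm in blast)
qed

section \<open>A conjugacy class of lifts of transpositions\<close>

definition base :: 'h where
  "base = (SOME t. t \<in> carrier H \<and> \<pi> t = transpose 1 2)"

lemma base: "base \<in> carrier H" "\<pi> base = transpose 1 2"
proof -
  have "\<exists>t. t \<in> carrier H \<and> \<pi> t = transpose 1 2"
    using lift[OF transp_mem[of 1 2]] n2 by auto
  then show "base \<in> carrier H" "\<pi> base = transpose 1 2"
    unfolding base_def by (metis (mono_tags, lifting) someI_ex)+
qed

text \<open>The conjugates of one lift form a choice, invariant under conjugation, of exactly one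
  lift for each transposition: see \<open>transp_lifts_inj\<close> and
  \<open>ex_transp_lift\<close>.\<close>

definition transp_lifts :: "'h set" where
  "transp_lifts = {p \<otimes> base \<otimes> inv p | p. p \<in> carrier H}"

lemma transp_lifts_closed: "c \<in> transp_lifts \<Longrightarrow> c \<in> carrier H"
  unfolding transp_lifts_def using base by auto

lemma transp_lifts_conj:
  assumes "c \<in> transp_lifts" "p \<in> carrier H"
  shows "p \<otimes> c \<otimes> inv p \<in> transp_lifts"
proof -
  obtain q where q: "q \<in> carrier H" "c = q \<otimes> base \<otimes> inv q"
    using assms(1) unfolding transp_lifts_def by blast
  then have "p \<otimes> c \<otimes> inv p = (p \<otimes> q) \<otimes> base \<otimes> inv (p \<otimes> q)"
    using assms(2) base by (simp add: H.inv_mult_group H.m_assoc)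
  then show ?thesis unfolding transp_lifts_def using assms(2) q(1) by blast
qed

lemma \<pi>_conj:
  assumes "p \<in> carrier H" "c \<in> carrier H"
  shows "\<pi> (p \<otimes> c \<otimes> inv p) = \<pi> p \<circ> \<pi> c \<circ> inv' (\<pi> p)"
  using assms m_inv_eq[of "\<pi> p"] by (simp add: mult_eq)

lemma \<pi>_perm: "p \<in> carrier H \<Longrightarrow> \<pi> p permutes {1..n}"
  using permutes by simp

text \<open>If the conjugates by \<open>p\<close> and \<open>q\<close> have the same image, then
  \<open>inv q \<otimes> p\<close> lies over the centralizer of (1 2) and so commutes with
  \<open>base\<close>.\<close>

lemma transp_lifts_inj:
  assumes "c \<in> transp_lifts" "d \<in> transp_lifts" "\<pi> c = \<pi> d"
  shows "c = d"
proof -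
  obtain p q where p: "p \<in> carrier H" "c = p \<otimes> base \<otimes> inv p"
    and q: "q \<in> carrier H" "d = q \<otimes> base \<otimes> inv q"
    using assms(1,2) unfolding transp_lifts_def by blast
  define r where "r = inv q \<otimes> p"
  have r: "r \<in> carrier H" "p = q \<otimes> r" unfolding r_def using p q by (simp_all add: H.m_assoc[symmetric])
  have "\<pi> (inv q \<otimes> c \<otimes> q) = \<pi> (inv q \<otimes> d \<otimes> q)"
    using assms(3) transp_lifts_closed[OF assms(1)] transp_lifts_closed[OF assms(2)] q(1) by simp
  moreover have "inv q \<otimes> d \<otimes> q = base"
  proof -
    have "inv q \<otimes> (q \<otimes> base) = base" using q(1) base by (simp add: H.m_assoc[symmetric])
    then show ?thesis using q base by (simp add: H.m_assoc)
  qed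
  moreover have "inv q \<otimes> c \<otimes> q = r \<otimes> base \<otimes> inv r"
    unfolding r_def using p q(1) base by (simp add: H.inv_mult_group H.m_assoc)
  ultimately have "\<pi> r \<circ> transpose 1 2 \<circ> inv' (\<pi> r) = transpose 1 2"
    using \<pi>_conj[OF r(1) base(1)] base(2) by simp
  then have "lc (transpose 1 2) (\<pi> r)"
    using lc_centralizer_of_transposition r(1) by simp
  then have comm: "base \<otimes> r = r \<otimes> base" using lcD[of base r] base r(1) by simp
  have "r \<otimes> base \<otimes> inv r = base"
    unfolding comm[symmetric] using base r(1) by (simp add: H.m_assoc)
  then have "q \<otimes> (r \<otimes> base \<otimes> inv r) \<otimes> inv q = d" using q by simp
  then show "c = d" unfolding p(2) r(2) using q(1) r(1) base by (simp add: H.inv_mult_group H.m_assoc)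
qed

text \<open>The common square of all chosen lifts. It lies in the kernel but may be nontrivial,
  which is why word lengths are recorded below.\<close>

definition msq :: 'h where "msq = base \<otimes> base"

lemma msq: "msq \<in> carrier H" "\<And>h. h \<in> carrier H \<Longrightarrow> msq \<otimes> h = h \<otimes> msq"
proof -
  show m: "msq \<in> carrier H" unfolding msq_def using base by simp
  have "\<pi> msq = \<one>\<^bsub>sym_group n\<^esub>" unfolding msq_def using base by (simp add: sym_group_mult sym_group_one)
  then show "\<And>h. h \<in> carrier H \<Longrightarrow> msq \<otimes> h = h \<otimes> msq" using kernel_comm m by blast
qed

lemma msq_pow:
  fixes i :: nat
  assumes "h \<in> carrier H"
  shows "msq [^] i \<otimes> h = h \<otimes> msq [^] i"
proof (induction i)
  case (Suc i)
  have "msq [^] i \<otimes> (msq \<otimes> h) = (msq [^] i \<otimes> h) \<otimes> msq"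
    using msq assms by (simp add: H.m_assoc)
  then show ?case using Suc assms msq(1) by (simp add: H.m_assoc)
qed (use assms in simp)

lemma transp_lifts_sq:
  assumes "c \<in> transp_lifts"
  shows "c \<otimes> c = msq"
proof -
  obtain p where p: "p \<in> carrier H" "c = p \<otimes> base \<otimes> inv p"
    using assms unfolding transp_lifts_def by blast
  have "inv p \<otimes> (p \<otimes> (base \<otimes> inv p)) = base \<otimes> inv p"
    using p(1) base by (simp add: H.m_assoc[symmetric])
  then have "c \<otimes> c = p \<otimes> msq \<otimes> inv p"
    unfolding p(2) msq_def using p(1) base by (simp add: H.m_assoc)
  also have "\<dots> = msq" using msq(2)[OF p(1)] p(1) msq(1) by (metis H.inv_closed H.m_assoc H.r_inv H.r_one)
  finally show ?thesis .
qed

lemma transp_lifts_image: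
  assumes "c \<in> transp_lifts"
  obtains a b where "a \<noteq> b" "{a, b} \<subseteq> {1..n}" "\<pi> c = transpose a b"
proof -
  obtain p where p: "p \<in> carrier H" "c = p \<otimes> base \<otimes> inv p"
    using assms unfolding transp_lifts_def by blast
  then have "\<pi> c = transpose (\<pi> p 1) (\<pi> p 2)"
    using \<pi>_conj[OF p(1) base(1)] base(2) transpose_conj[OF permutes_bij[OF \<pi>_perm[OF p(1)]], of 1 2] by simp
  moreover have "\<pi> p 1 \<noteq> \<pi> p 2" using permutes_inj[OF \<pi>_perm[OF p(1)]] by (simp add: inj_eq)
  moreover have "{\<pi> p 1, \<pi> p 2} \<subseteq> {1..n}" using permutes_in_image[OF \<pi>_perm[OF p(1)]] n2 by auto
  ultimately show ?thesis using that by blast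
qed

lemma ex_transp_lift:
  assumes "a \<noteq> b" "{a, b} \<subseteq> {1..n}"
  obtains c where "c \<in> transp_lifts" "\<pi> c = transpose a b"
proof -
  obtain g where g: "g permutes {1..n}" "map g [1, 2] = [a, b]"
    using ex_permutes_map[of "[1, 2]" "[a, b]" "{1..n}"] assms n2 by auto
  then obtain p where p: "p \<in> carrier H" "\<pi> p = g" using lift[of g] by (auto simp: sym_group_carrier)
  let ?c = "p \<otimes> base \<otimes> inv p"
  have "\<pi> ?c = transpose a b"
    using \<pi>_conj[OF p(1) base(1)] base(2) p(2) g transpose_conj[OF permutes_bij[OF g(1)], of 1 2] by simp
  moreover have "?c \<in> transp_lifts" unfolding transp_lifts_def using p(1) by blast
  ultimately show ?thesis using that by blast
qed

section \<open>Words in the lifts of transpositions\<close>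

definition word :: "'h list \<Rightarrow> 'h" where
  "word l = foldr (\<otimes>\<^bsub>H\<^esub>) l \<one>"

lemma word_simps [simp]: "word [] = \<one>" "word (c # l) = c \<otimes> word l"
  by (simp_all add: word_def)

lemma word_closed: "set l \<subseteq> transp_lifts \<Longrightarrow> word l \<in> carrier H"
  by (induction l) (auto intro: transp_lifts_closed)

lemma word_append:
  "set l \<subseteq> transp_lifts \<Longrightarrow> set l' \<subseteq> transp_lifts \<Longrightarrow> word (l @ l') = word l \<otimes> word l'"
  by (induction l) (auto simp: H.m_assoc transp_lifts_closed word_closed)

text \<open>Hurwitz moves \<open>rc = (rcr\<inverse>)r\<close> and \<open>rc = c(c\<inverse>rc)\<close> push the transpositions that move the
  largest point to the right, where equal neighbours cancel.\<close>

lemma word_normal_form: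
  assumes "set l \<subseteq> {c \<in> transp_lifts. \<pi> c permutes {1..Suc j}}"
  shows "\<exists>i l' r. set l' \<subseteq> {c \<in> transp_lifts. \<pi> c permutes {1..j}} \<and>
     set r \<subseteq> {c \<in> transp_lifts. \<pi> c permutes {1..Suc j} \<and> \<pi> c (Suc j) \<noteq> Suc j} \<and> length r \<le> 1 \<and>
     length l = 2 * i + length l' + length r \<and> word l = msq [^] (i::nat) \<otimes> word (l' @ r)"
  using assms
proof (induction l rule: rev_induct)
  case Nil
  show ?case by (rule exI[of _ 0], rule exI[of _ "[]"], rule exI[of _ "[]"]) simp
next
  case (snoc c l)
  let ?C = "{c \<in> transp_lifts. \<pi> c permutes {1..j}}"
  let ?R = "{c \<in> transp_lifts. \<pi> c permutes {1..Suc j} \<and> \<pi> c (Suc j) \<noteq> Suc j}"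
  obtain i l' r where IH: "set l' \<subseteq> ?C" "set r \<subseteq> ?R" "length r \<le> 1"
     "length l = 2 * i + length l' + length r" "word l = msq [^] (i::nat) \<otimes> word (l' @ r)"
    using snoc by auto
  have c: "c \<in> transp_lifts" "\<pi> c permutes {1..Suc j}" using snoc(2) by auto
  have cC: "c \<in> ?C" if "\<pi> c (Suc j) = Suc j"
    using c that permutes_superset[OF c(2), of "{1..j}"] by (auto simp: le_Suc_eq)
  have cl: "c \<in> carrier H" using transp_lifts_closed c by blast
  have sub: "set l \<subseteq> transp_lifts" "set l' \<subseteq> transp_lifts" "set r \<subseteq> transp_lifts"
    using snoc(2) IH by auto
  have wc: "word l' \<in> carrier H" using sub(2) by (rule word_closed)
  have mc: "msq [^] i \<in> carrier H" using msq by simp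
  have step: "word (l @ [c]) = msq [^] i \<otimes> (word l' \<otimes> (word r \<otimes> c))"
    using IH(5) sub c(1) cl wc mc word_closed[OF sub(3)]
    by (simp add: word_append H.m_assoc)
  show ?case
  proof (cases r)
    case Nil
    show ?thesis
    proof (cases "\<pi> c (Suc j) = Suc j")
      case True
      show ?thesis
        by (rule exI[of _ i], rule exI[of _ "l' @ [c]"], rule exI[of _ "[]"])
           (use IH step Nil cC[OF True] sub c cl wc mc in \<open>simp add: word_append\<close>)
    next
      case False
      show ?thesis
        by (rule exI[of _ i], rule exI[of _ l'], rule exI[of _ "[c]"])
           (use IH step Nil False sub c cl wc mc in \<open>simp add: word_append\<close>)
    qed
  next
    case (Cons s r')
    then have r: "r = [s]" using IH(3) by simp
    then have s: "s \<in> transp_lifts" "\<pi> s permutes {1..Suc j}" "\<pi> s (Suc j) \<noteq> Suc j" using IH(2) by auto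
    then have sl: "s \<in> carrier H" using transp_lifts_closed by blast
    obtain x where x: "\<pi> s = transpose x (Suc j)" "x \<noteq> Suc j"
      using transp_lifts_image[OF s(1)] s(3) by (metis transpose_apply_other transpose_commute)
    show ?thesis
    proof (cases "\<pi> c (Suc j) = Suc j")
      case True
      \<comment> \<open>As \<open>c\<close> fixes \<open>Suc j\<close>, the conjugate
        \<open>s'\<close> still moves it, and \<open>s \<otimes> c = c \<otimes> s'\<close> passes
        \<open>c\<close> to the left. The form \<open>inv (inv c)\<close> matches
        \<open>transp_lifts_conj\<close>.\<close>
      define s' where "s' = inv c \<otimes> s \<otimes> inv (inv c)"
      have s': "s' \<in> transp_lifts" unfolding s'_def by (rule transp_lifts_conj) (use s cl in simp_all)
      have "\<pi> s' = inv' (\<pi> c) \<circ> \<pi> s \<circ> inv' (inv' (\<pi> c))"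
        unfolding s'_def using \<pi>_conj[of "inv c" s] cl sl m_inv_eq[of "\<pi> c"] by simp
      also have "\<dots> = transpose (inv' (\<pi> c) x) (inv' (\<pi> c) (Suc j))"
        unfolding x(1) by (rule transpose_conj) (use c x permutes_bij[OF permutes_inv] in auto)
      also have "inv' (\<pi> c) (Suc j) = Suc j" using True permutes_inv_eq[OF c(2)] by simp
      finally have \<pi>s': "\<pi> s' = transpose (inv' (\<pi> c) x) (Suc j)" .
      have xj: "inv' (\<pi> c) x \<noteq> Suc j" using True x(2) permutes_inv_eq[OF c(2)] by metis
      have "x \<in> {1..Suc j}" using s(2) x by (metis permutes_not_in transpose_apply_first)
      then have "inv' (\<pi> c) x \<in> {1..Suc j}" using permutes_in_image[OF permutes_inv[OF c(2)]] by blast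
      then have "\<pi> s' permutes {1..Suc j}" unfolding \<pi>s' by (intro permutes_swap_id) auto
      then have s'R: "s' \<in> ?R" using s' \<pi>s' xj by simp
      have sc: "s \<otimes> c = c \<otimes> s'"
        unfolding s'_def using sl cl by (simp add: H.m_assoc[symmetric])
      show ?thesis
        by (rule exI[of _ i], rule exI[of _ "l' @ [c]"], rule exI[of _ "[s']"])
           (use sc IH step r cC[OF True] s'R sub c cl sl wc mc transp_lifts_closed[OF s'] in
             \<open>simp add: word_append H.m_assoc\<close>)
    next
      case False
      obtain y where y: "\<pi> c = transpose y (Suc j)" "y \<noteq> Suc j"
        using transp_lifts_image[OF c(1)] False by (metis transpose_apply_other transpose_commute)
      show ?thesis
      proof (cases "x = y")
        case True
        \<comment> \<open>The class contains one lift per transposition, so equal images mean equal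
          letters, and these collapse to \<open>msq\<close>.\<close>
        then have "s = c" using transp_lifts_inj[OF s(1) c(1)] x y by simp
        then have "s \<otimes> c = msq" using transp_lifts_sq[OF c(1)] by simp
        then have w: "word (l @ [c]) = msq [^] (Suc i) \<otimes> word (l' @ [])"
          using step r sl cl wc mc msq by (simp add: H.m_assoc)
        show ?thesis
          by (rule exI[of _ "Suc i"], rule exI[of _ l'], rule exI[of _ "[]"]) (use w IH r in simp)
      next
        case xy: False
        \<comment> \<open>\<open>\<pi> s\<close> sends \<open>Suc j\<close> to \<open>x\<close> and
          fixes \<open>y\<close>, so \<open>c'\<close> lies over (y x) and fixes
          \<open>Suc j\<close>.\<close>
        define c' where "c' = s \<otimes> c \<otimes> inv s"
        have c': "c' \<in> transp_lifts" unfolding c'_def by (rule transp_lifts_conj) (use c sl in simp_all)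
        have "\<pi> c' = transpose (\<pi> s y) (\<pi> s (Suc j))"
          unfolding c'_def using \<pi>_conj[OF sl cl] y transpose_conj[OF permutes_bij[OF s(2)]] by simp
        also have "\<dots> = transpose y x" using x y xy by simp
        finally have \<pi>c': "\<pi> c' = transpose y x" .
        have "x \<in> {1..Suc j}" "y \<in> {1..Suc j}"
          using s(2) c(2) x y by (metis permutes_not_in transpose_apply_first)+
        then have "{y, x} \<subseteq> {1..j}" using x y by auto
        then have "\<pi> c' permutes {1..j}" unfolding \<pi>c' by (intro permutes_swap_id) auto
        then have c'C: "c' \<in> ?C" using c' by simp
        have sc: "s \<otimes> c = c' \<otimes> s"
          unfolding c'_def using sl cl by (simp add: H.m_assoc)
        show ?thesis
          by (rule exI[of _ i], rule exI[of _ "l' @ [c']"], rule exI[of _ "[s]"])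
             (use sc IH step r c'C s sub c cl sl wc mc transp_lifts_closed[OF c'] in
               \<open>simp add: word_append H.m_assoc\<close>)
      qed
    qed
  qed
qed

lemma \<pi>_word_permutes:
  assumes "set l \<subseteq> {c \<in> transp_lifts. \<pi> c permutes {1..j}}"
  shows "\<pi> (word l) permutes {1..j}"
  using assms
proof (induction l)
  case Nil
  have "\<pi> (word []) = id" by (simp add: sym_group_one)
  then show ?case using permutes_id by metis
next
  case (Cons c l)
  have "c \<in> carrier H" "word l \<in> carrier H"
    using Cons(2) transp_lifts_closed word_closed[of l] by auto
  then have "\<pi> (word (c # l)) = \<pi> c \<circ> \<pi> (word l)" by (simp add: mult_eq[symmetric])
  moreover have "\<pi> c permutes {1..j}" "\<pi> (word l) permutes {1..j}" using Cons by auto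
  ultimately show ?case using permutes_compose by metis
qed

text \<open>In the normal form, a letter in \<open>r\<close> would send \<open>Suc j\<close> to a
  smaller point, and \<open>l'\<close> cannot bring it back. So \<open>r\<close> is empty and the
  induction hypothesis applies to \<open>l'\<close>.\<close>

lemma word_in_kernel:
  assumes "set l \<subseteq> {c \<in> transp_lifts. \<pi> c permutes {1..j}}" "\<pi> (word l) = id"
  shows "\<exists>i. length l = 2 * i \<and> word l = msq [^] i"
  using assms
proof (induction j arbitrary: l)
  case 0
  have "l = []"
  proof (rule ccontr)
    assume "l \<noteq> []"
    then obtain c where c: "c \<in> transp_lifts" "\<pi> c permutes {1..0}" using 0(1) by (cases l) auto
    then have "\<pi> c = id" by simp
    then show False using transp_lifts_image[OF c(1)] by (metis transpose_eq_id_iff)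
  qed
  then show ?case by simp
next
  case (Suc j)
  let ?C = "{c \<in> transp_lifts. \<pi> c permutes {1..j}}"
  let ?R = "{c \<in> transp_lifts. \<pi> c permutes {1..Suc j} \<and> \<pi> c (Suc j) \<noteq> Suc j}"
  obtain i l' r where nf: "set l' \<subseteq> ?C" "set r \<subseteq> ?R" "length r \<le> 1"
     "length l = 2 * i + length l' + length r" "word l = msq [^] (i::nat) \<otimes> word (l' @ r)"
    using word_normal_form[OF Suc(2)] by blast
  have sub: "set l' \<subseteq> transp_lifts" "set r \<subseteq> transp_lifts" using nf by auto
  have wc: "word l' \<in> carrier H" "word r \<in> carrier H" using sub word_closed by blast+
  have "\<pi> msq = \<one>\<^bsub>sym_group n\<^esub>"
    unfolding msq_def using base by (simp add: sym_group_mult sym_group_one)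
  then have "\<pi> (msq [^] i) = \<one>\<^bsub>sym_group n\<^esub>"
    using msq(1) by (simp add: \<pi>.hom_nat_pow)
  then have id: "\<pi> (word l') \<circ> \<pi> (word r) = id"
  proof -
    have "\<pi> (word l) = \<pi> (word l') \<otimes>\<^bsub>sym_group n\<^esub> \<pi> (word r)"
      using nf(5) sub wc msq(1) \<open>\<pi> (msq [^] i) = _\<close> by (simp add: word_append)
    then show ?thesis using Suc(3) by (simp only: sym_group_mult)
  qed
  have "r = []"
  proof (rule ccontr)
    assume "r \<noteq> []"
    then obtain s where "r = [s]" using nf(3) by (cases r) auto
    then have s: "r = [s]" "s \<in> carrier H" "\<pi> s permutes {1..Suc j}" "\<pi> s (Suc j) \<noteq> Suc j"
      using nf(2) transp_lifts_closed by auto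
    have "\<pi> s (Suc j) \<in> {1..Suc j}" using permutes_in_image[OF s(3), of "Suc j"] by simp
    then have "\<pi> s (Suc j) \<in> {1..j}" using s(4) by auto
    then have "\<pi> (word l') (\<pi> s (Suc j)) \<in> {1..j}"
      using permutes_in_image[OF \<pi>_word_permutes[OF nf(1)]] by blast
    moreover have "\<pi> (word l') (\<pi> s (Suc j)) = Suc j"
      using fun_cong[OF id, of "Suc j"] s by simp
    ultimately show False by simp
  qed
  then have "\<pi> (word l') = id" using id by (simp add: sym_group_one)
  then obtain k where "length l' = 2 * k" "word l' = msq [^] k" using Suc(1)[OF nf(1)] by blast
  then show ?case using nf \<open>r = []\<close> msq(1) by (intro exI[of _ "i + k"]) (simp add: H.nat_pow_mult)
qed

text \<open>Equal letters collapse from the middle outwards. Thus the reversed word serves as an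
  inverse up to a power of \<open>msq\<close>.\<close>

lemma word_rev:
  assumes "set l \<subseteq> transp_lifts"
  shows "word l \<otimes> word (rev l) = msq [^] length l"
  using assms
proof (induction l)
  case (Cons c l)
  have cl: "c \<in> carrier H" "word l \<in> carrier H" "word (rev l) \<in> carrier H" "c \<in> transp_lifts"
    using Cons(2) transp_lifts_closed word_closed[of l] word_closed[of "rev l"] by auto
  have "word (c # l) \<otimes> word (rev (c # l)) = c \<otimes> ((word l \<otimes> word (rev l)) \<otimes> c)"
    using Cons(2) cl by (simp add: word_append H.m_assoc)
  also have "\<dots> = c \<otimes> (msq [^] length l \<otimes> c)" using Cons by simp
  also have "\<dots> = c \<otimes> (c \<otimes> msq [^] length l)" using msq_pow[OF cl(1)] by simp
  also have "\<dots> = msq \<otimes> msq [^] length l"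
    using transp_lifts_sq[OF cl(4)] cl(1) msq(1) by (simp add: H.m_assoc[symmetric])
  also have "\<dots> = msq [^] length (c # l)" using msq by simp
  finally show ?case .
qed simp

lemma word_generates:
  assumes "h \<in> carrier H"
  obtains l k where "set l \<subseteq> transp_lifts" "k \<in> carrier H" "\<pi> k = \<one>\<^bsub>sym_group n\<^esub>" "h = word l \<otimes> k"
proof -
  have "\<exists>l. set l \<subseteq> transp_lifts \<and> \<pi> (word l) = g" if "g permutes {1..n}" for g
    using that finite_atLeastAtMost
  proof (induction rule: permutes_induct)
    case id
    then show ?case by (intro exI[of _ "[]"]) (simp add: sym_group_one)
  next
    case (swap a b p)
    then obtain l where l: "set l \<subseteq> transp_lifts" "\<pi> (word l) = p" by blast
    obtain c where c: "c \<in> transp_lifts" "\<pi> c = transpose a b" using ex_transp_lift[of a b] swap by auto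
    show ?case
      by (intro exI[of _ "c # l"])
         (use l c word_closed[OF l(1)] transp_lifts_closed[OF c(1)] in \<open>simp add: sym_group_mult\<close>)
  qed
  then obtain l where l: "set l \<subseteq> transp_lifts" "\<pi> (word l) = \<pi> h" using \<pi>_perm[OF assms] by blast
  then obtain k where "k \<in> carrier H" "\<pi> k = \<one>\<^bsub>sym_group n\<^esub>" "h = word l \<otimes> k"
    using same_image[of "word l" h] assms word_closed by metis
  then show ?thesis using that l by blast
qed

text \<open>The factor \<open>msq [^] s\<close>, with \<open>s\<close> half of the length, is the
  value that \<open>word_in_kernel\<close> predicts for a word over the identity; this is what makes
  the kernel elements among the balanced ones trivial.\<close>

definition balanced :: "'h set" where
  "balanced = {h \<in> carrier H. \<exists>l s. set l \<subseteq> transp_lifts \<and> length l = 2 * s \<and> word l = msq [^] (s::nat) \<otimes> h}"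

lemma balanced_subgroup: "subgroup balanced H"
proof (rule H.subgroupI)
  show "balanced \<subseteq> carrier H" by (auto simp: balanced_def)
  have "\<one> \<in> balanced"
    unfolding balanced_def mem_Collect_eq
    by (intro conjI exI[of _ "[]"] exI[of _ "0::nat"]) simp_all
  then show "balanced \<noteq> {}" by blast
next
  fix h assume "h \<in> balanced"
  then obtain l s where h: "h \<in> carrier H" "set l \<subseteq> transp_lifts" "length l = 2 * s"
    "word l = msq [^] (s::nat) \<otimes> h" by (auto simp: balanced_def)
  let ?m = "msq [^] s"
  have cl: "?m \<in> carrier H" "word l \<in> carrier H" "word (rev l) \<in> carrier H"
    using h msq word_closed[of l] word_closed[of "rev l"] by auto
  have "(?m \<otimes> h) \<otimes> word (rev l) = ?m \<otimes> ?m"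
    using word_rev[OF h(2)] h(3,4) msq(1) by (simp add: H.nat_pow_mult mult_2)
  then have "h \<otimes> word (rev l) = ?m" using h(1) cl by (simp add: H.m_assoc)
  then have "word (rev l) = ?m \<otimes> inv h"
    using msq_pow[of "inv h" s] h(1) cl by (metis H.inv_closed H.inv_solve_left)
  then show "inv h \<in> balanced"
    unfolding balanced_def mem_Collect_eq using h
    by (intro conjI exI[of _ "rev l"] exI[of _ s]) simp_all
next
  fix h h' assume "h \<in> balanced" "h' \<in> balanced"
  then obtain l s l' s' where h: "h \<in> carrier H" "set l \<subseteq> transp_lifts" "length l = 2 * s"
    "word l = msq [^] (s::nat) \<otimes> h" and h': "h' \<in> carrier H" "set l' \<subseteq> transp_lifts" "length l' = 2 * s'"
    "word l' = msq [^] (s'::nat) \<otimes> h'" by (auto simp: balanced_def)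
  let ?m = "msq [^] s" and ?m' = "msq [^] s'"
  have cl: "?m \<in> carrier H" "?m' \<in> carrier H" using msq by simp_all
  have "word (l @ l') = ?m \<otimes> (h \<otimes> ?m') \<otimes> h'"
    using h h' cl by (simp add: word_append H.m_assoc)
  also have "\<dots> = msq [^] (s + s') \<otimes> (h \<otimes> h')"
    using msq_pow[OF h(1), of s', symmetric] h h' cl msq(1) by (simp add: H.m_assoc H.nat_pow_mult[symmetric])
  finally show "h \<otimes> h' \<in> balanced"
    unfolding balanced_def mem_Collect_eq using h h'
    by (intro conjI exI[of _ "l @ l'"] exI[of _ "s + s'"]) simp_all
qed

text \<open>Kernel factors cancel in a commutator and reversed words stand in for inverses, so the
  word \<open>l @ l' @ rev l @ rev l'\<close> yields the commutator times a power of
  \<open>msq\<close> whose exponent is half the length of the word.\<close>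

lemma derived_balanced: "derived H (carrier H) \<subseteq> balanced"
  unfolding derived_def
proof (rule H.generate_subgroup_incl[OF _ balanced_subgroup], rule subsetI)
  fix d assume "d \<in> derived_set H (carrier H)"
  then obtain a b where ab: "a \<in> carrier H" "b \<in> carrier H"
    and d: "d = a \<otimes> b \<otimes> inv a \<otimes> inv b" by blast
  obtain l k where l: "set l \<subseteq> transp_lifts" "k \<in> carrier H" "\<pi> k = \<one>\<^bsub>sym_group n\<^esub>" "a = word l \<otimes> k"
    using word_generates[OF ab(1)] by blast
  obtain l' k' where l': "set l' \<subseteq> transp_lifts" "k' \<in> carrier H" "\<pi> k' = \<one>\<^bsub>sym_group n\<^esub>" "b = word l' \<otimes> k'"
    using word_generates[OF ab(2)] by blast
  define A B where "A = word l" and "B = word l'"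
  let ?M = "\<lambda>l. msq [^] length (l :: 'h list)"
  have cl: "A \<in> carrier H" "B \<in> carrier H" "word (rev l) \<in> carrier H" "word (rev l') \<in> carrier H"
     "?M l \<in> carrier H" "?M l' \<in> carrier H"
    unfolding A_def B_def using l l' word_closed[of l] word_closed[of l'] word_closed[of "rev l"] word_closed[of "rev l'"] msq
    by auto
  have ba: "b \<otimes> a = (B \<otimes> A) \<otimes> (k' \<otimes> k)"
    unfolding l(4) l'(4) A_def[symmetric] B_def[symmetric]
    using cl l(2) l'(2) kernel_comm[OF l'(2,3) cl(1)] by (metis H.m_assoc H.m_closed)
  have kk: "k' \<otimes> k = k \<otimes> k'" using kernel_comm[OF l'(2,3) l(2)] .
  have abk: "a \<otimes> b = (A \<otimes> B) \<otimes> (k' \<otimes> k)"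
    unfolding kk unfolding l(4) l'(4) A_def[symmetric] B_def[symmetric]
    using cl l(2) l'(2) kernel_comm[OF l(2,3) cl(2)] by (metis H.m_assoc H.m_closed)
  have "d \<otimes> (b \<otimes> a) = a \<otimes> b"
    unfolding d using ab by (metis H.inv_closed H.inv_solve_right H.inv_solve_right' H.m_assoc H.m_closed)
  then have "(d \<otimes> (B \<otimes> A)) \<otimes> (k' \<otimes> k) = (A \<otimes> B) \<otimes> (k' \<otimes> k)"
    unfolding ba abk using ab d cl l(2) l'(2) by (simp add: H.m_assoc)
  moreover have dc: "d \<in> carrier H" unfolding d using ab by simp
  ultimately have dBA: "d \<otimes> (B \<otimes> A) = A \<otimes> B"
    using cl l(2) l'(2) by (metis H.m_closed H.right_cancel)
  have "word (l @ l' @ rev l @ rev l') = (A \<otimes> B) \<otimes> (word (rev l) \<otimes> word (rev l'))"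
    using l l' cl by (simp add: word_append A_def B_def H.m_assoc)
  also have "\<dots> = d \<otimes> (B \<otimes> (A \<otimes> word (rev l)) \<otimes> word (rev l'))"
    unfolding dBA[symmetric] using dc cl by (simp add: H.m_assoc)
  also have "A \<otimes> word (rev l) = ?M l" unfolding A_def by (rule word_rev[OF l(1)])
  also have "B \<otimes> ?M l \<otimes> word (rev l') = ?M l \<otimes> (B \<otimes> word (rev l'))"
    using msq_pow[OF cl(2), of "length l"] cl by (metis H.m_assoc)
  also have "B \<otimes> word (rev l') = ?M l'" unfolding B_def by (rule word_rev[OF l'(1)])
  also have "d \<otimes> (?M l \<otimes> ?M l') = msq [^] (length l + length l') \<otimes> d"
    using msq_pow[OF dc, of "length l + length l'"] msq(1) by (simp add: H.nat_pow_mult)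
  finally show "d \<in> balanced"
    unfolding balanced_def mem_Collect_eq using l(1) l'(1) dc
    by (intro conjI exI[of _ "l @ l' @ rev l @ rev l'"] exI[of _ "length l + length l'"]) auto
qed

text \<open>Being balanced, \<open>h\<close> comes with a word of length \<open>2 * s\<close> and
  value \<open>msq [^] s \<otimes> h\<close>, which \<open>word_in_kernel\<close> evaluates to
  \<open>msq [^] s\<close>.\<close>

lemma kernel_derived_trivial:
  assumes "h \<in> derived H (carrier H)" "\<pi> h = \<one>\<^bsub>sym_group n\<^esub>"
  shows "h = \<one>"
proof -
  obtain l s where h: "h \<in> carrier H" "set l \<subseteq> transp_lifts" "length l = 2 * s"
    "word l = msq [^] (s::nat) \<otimes> h"
    using derived_balanced assms(1) by (auto simp: balanced_def)
  have m: "msq [^] s \<in> carrier H" using msq by simp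
  have "\<pi> msq = \<one>\<^bsub>sym_group n\<^esub>"
    unfolding msq_def using base by (simp add: sym_group_mult sym_group_one)
  then have "\<pi> (word l) = id"
    using h msq(1) m assms(2) by (simp add: \<pi>.hom_nat_pow one_eq[symmetric])
  moreover have "set l \<subseteq> {c \<in> transp_lifts. \<pi> c permutes {1..n}}"
    using h(2) transp_lifts_closed \<pi>_perm by blast
  ultimately obtain i where "length l = 2 * i" "word l = msq [^] i"
    using word_in_kernel by blast
  then have "msq [^] s \<otimes> h = msq [^] s \<otimes> \<one>" using h(3,4) m by simp
  then show ?thesis using m h(1) by simp
qed

end

end

text \<open>Commuting lifts would make the kernel of the Schur cover trivial, although the spin
  group is a stem extension with the kernel elements 1 and -1.\<close>

lemma schur_cover_sym_transpositions:
  assumes cover: "schur_cover H (sym_group n) \<pi>" and n: "4 \<le> n" "n \<le> 8"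
    and abcd: "distinct [a, b, c, d]" "{a, b, c, d} \<subseteq> {1..n}"
  shows "\<not> lifts_commute H \<pi> (transpose a b) (transpose c d)"
proof
  assume lc: "lifts_commute H \<pi> (transpose a b) (transpose c d)"
  interpret central_extension H "sym_group n" \<pi> by (rule schur_cover_central_extension[OF cover])
  interpret sym_extension H n \<pi> by unfold_locales
  let ?S = "spin_group (sym_group n)"
  let ?K = "kernel ?S (sym_group n) fst"
  have stem: "stem_extension H (sym_group n) \<pi>" using cover unfolding schur_cover_def by blast
  have "h = \<one>\<^bsub>H\<^esub>" if "h \<in> kernel H (sym_group n) \<pi>" for h
  proof (rule kernel_derived_trivial)
    show "2 \<le> n" using n by simp
    show "lc (transpose a' b') (transpose c' d')" if "distinct [a', b', c', d']" "{a', b', c', d'} \<subseteq> {1..n}"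
      for a' b' c' d'
      using lc_transpose_conj[OF lc abcd that] .
    show "h \<in> derived H (carrier H)" "\<pi> h = \<one>\<^bsub>sym_group n\<^esub>"
      using that stem unfolding stem_extension_def kernel_def by blast+
  qed
  then have "kernel H (sym_group n) \<pi> \<subseteq> {\<one>\<^bsub>H\<^esub>}" by blast
  then have "card (kernel H (sym_group n) \<pi>) \<le> 1" using card_mono[of "{\<one>\<^bsub>H\<^esub>}"] by simp
  then have le: "card ?K \<le> 1"
    using schur_cover_kernel_maximal[OF cover stem_extension_spin_sym(1)[OF n]] by linarith
  have "finite ?K"
    using stem_extension_spin_sym(1)[OF n] unfolding stem_extension_def kernel_def by simp
  moreover have "(id, id) \<in> ?K"
    by (simp add: kernel_def spin_group_def spin_lift_id sym_group_one id_closed)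
  moreover have "(id, uminus) \<in> ?K" by (rule stem_extension_spin_sym(2)[OF n])
  ultimately have "(id, id) = ((id, uminus) :: (nat \<Rightarrow> nat) \<times> (clifford \<Rightarrow> clifford))"
    using le by (metis card_le_Suc0_iff_eq One_nat_def)
  then show False using spin_group_uminus_neq_one by simp
qed

section \<open>Holes\<close>

lemma not_perfect_if_hole5:
  assumes sym: "\<And>x y. E x y \<Longrightarrow> E y x" and irrefl: "\<And>x. \<not> E x x"
    and V: "{a, b, c, d, e} \<subseteq> V"
    and edges: "E a b" "E b c" "E c d" "E d e" "E e a"
    and nonedges: "\<not> E a c" "\<not> E a d" "\<not> E b d" "\<not> E b e" "\<not> E c e"
  shows "\<not> perfect_graph V E"
proof (rule not_perfect_if_triangle_free)
  let ?W = "{a, b, c, d, e}"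
  note nonedges' = nonedges[THEN contrapos_nn, OF sym]
  show "finite ?W" "?W \<subseteq> V" using V by simp_all
  show False if "x \<in> ?W" "y \<in> ?W" "z \<in> ?W" "x \<noteq> y" "x \<noteq> z" "y \<noteq> z" "E x y" "E x z" "E y z" for x y z
    using that nonedges nonedges' by auto
  show "\<exists>x\<in>?W. \<exists>y\<in>?W. x \<noteq> y \<and> E x y \<and> f x = f y" for f :: "_ \<Rightarrow> bool"
  proof -
    have "f a = f b \<or> f b = f c \<or> f c = f d \<or> f d = f e \<or> f e = f a" by auto
    moreover have "a \<noteq> b" "b \<noteq> c" "c \<noteq> d" "d \<noteq> e" "e \<noteq> a" using edges irrefl by auto
    ultimately show ?thesis using edges by blast
  qed
qed

lemma not_perfect_if_hole7:
  assumes sym: "\<And>x y. E x y \<Longrightarrow> E y x" and irrefl: "\<And>x. \<not> E x x"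
    and V: "{a, b, c, d, e, f, g} \<subseteq> V"
    and edges: "E a b" "E b c" "E c d" "E d e" "E e f" "E f g" "E g a"
    and nonedges: "\<not> E a c" "\<not> E a d" "\<not> E a e" "\<not> E a f" "\<not> E b d" "\<not> E b e" "\<not> E b f" "\<not> E b g"
      "\<not> E c e" "\<not> E c f" "\<not> E c g" "\<not> E d f" "\<not> E d g" "\<not> E e g"
  shows "\<not> perfect_graph V E"
proof (rule not_perfect_if_triangle_free)
  let ?W = "{a, b, c, d, e, f, g}"
  note nonedges' = nonedges[THEN contrapos_nn, OF sym]
  show "finite ?W" "?W \<subseteq> V" using V by simp_all
  show False if "x \<in> ?W" "y \<in> ?W" "z \<in> ?W" "x \<noteq> y" "x \<noteq> z" "y \<noteq> z" "E x y" "E x z" "E y z" for x y z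
    using that nonedges nonedges' by auto
  show "\<exists>x\<in>?W. \<exists>y\<in>?W. x \<noteq> y \<and> E x y \<and> h x = h y" for h :: "_ \<Rightarrow> bool"
  proof -
    have "h a = h b \<or> h b = h c \<or> h c = h d \<or> h d = h e \<or> h e = h f \<or> h f = h g \<or> h g = h a" by auto
    moreover have "a \<noteq> b" "b \<noteq> c" "c \<noteq> d" "d \<noteq> e" "e \<noteq> f" "f \<noteq> g" "g \<noteq> a" using edges irrefl by auto
    ultimately show ?thesis using edges by blast
  qed
qed

lemma cyc_transpose_conj:
  assumes "distinct [a, b, c]" "distinct [d, e, f]" "{a, b, c} \<inter> {d, e, f} = {}"
    "{p, q} \<inter> {a, b, c} = {}" "{p, q} \<inter> {d, e, f} = {}"
  shows "transpose d e \<circ> transpose p q \<circ> cyc a b c \<circ> inv' (transpose d e \<circ> transpose p q) = cyc a b c"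
    and "transpose d e \<circ> transpose p q \<circ> cyc d e f \<circ> inv' (transpose d e \<circ> transpose p q) = cyc e d f"
proof -
  have bij: "bij (transpose d e \<circ> transpose p q)" by (intro bij_comp bij_transpose)
  show "transpose d e \<circ> transpose p q \<circ> cyc a b c \<circ> inv' (transpose d e \<circ> transpose p q) = cyc a b c"
    using cyc_conj[OF bij assms(1)] assms(3,4) by (auto simp: transpose_def)
  have "(transpose d e \<circ> transpose p q) d = e" "(transpose d e \<circ> transpose p q) e = d" "(transpose d e \<circ> transpose p q) f = f"
    using assms(2,5) by (auto simp: transpose_def)
  then show "transpose d e \<circ> transpose p q \<circ> cyc d e f \<circ> inv' (transpose d e \<circ> transpose p q) = cyc e d f"
    using cyc_conj[OF bij assms(2)] by simp
qed

lemma disjoint_permutes_commute: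
  assumes p: "p permutes A" and q: "q permutes B" and "A \<inter> B = {}"
  shows "p \<circ> q = q \<circ> p"
proof
  fix x
  consider "x \<in> A" | "x \<in> B" | "x \<notin> A" "x \<notin> B" by blast
  then show "(p \<circ> q) x = (q \<circ> p) x"
  proof cases
    case 1
    then have "p x \<notin> B" "x \<notin> B" using permutes_in_image[OF p, of x] assms(3) by blast+
    then show ?thesis by (simp add: permutes_not_in[OF q])
  next
    case 2
    then have "q x \<notin> A" "x \<notin> A" using permutes_in_image[OF q, of x] assms(3) by blast+
    then show ?thesis by (simp add: permutes_not_in[OF p])
  qed (simp add: permutes_not_in[OF p] permutes_not_in[OF q])
qed

locale perm_extension = central_extension H G \<pi> + perm_group G n
  for H :: "('h, 'c) monoid_scheme" and G :: "(nat \<Rightarrow> nat) monoid" and \<pi> :: "'h \<Rightarrow> (nat \<Rightarrow> nat)" and n :: nat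
begin

lemma lc_commute': "lc x y \<Longrightarrow> x \<in> carrier G \<Longrightarrow> y \<in> carrier G \<Longrightarrow> x \<circ> y = y \<circ> x"
  using lc_commute by (simp only: mult_eq)

lemma not_lc:
  assumes "x \<in> carrier G" "y \<in> carrier G" "x (y k) \<noteq> y (x k)"
  shows "\<not> lc x y"
  using lc_commute'[OF _ assms(1,2)] assms(3) by (metis comp_apply)

lemma pow3_eq: "x [^]\<^bsub>G\<^esub> (3::nat) = x \<circ> x \<circ> x"
  by (simp add: numeral_3_eq_3 mult_eq one_eq)

lemma pow2_eq: "x [^]\<^bsub>G\<^esub> (2::nat) = x \<circ> x"
  by (simp add: numeral_2_eq_2 mult_eq one_eq)

lemma cyc_order: "distinct [a, b, c] \<Longrightarrow> cyc a b c [^]\<^bsub>G\<^esub> (3::nat) = \<one>\<^bsub>G\<^esub>"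
  using cyc_cube[of a b c] by (simp add: pow3_eq one_eq comp_assoc)

lemma cyc_disjoint_commute:
  assumes "distinct [a, b, c, d, e, f]"
  shows "cyc a b c \<otimes>\<^bsub>G\<^esub> cyc d e f = cyc d e f \<otimes>\<^bsub>G\<^esub> cyc a b c"
  unfolding mult_eq
  by (rule disjoint_permutes_commute[OF cyc_permutes[OF order_refl] cyc_permutes[OF order_refl]])
     (use assms in auto)

lemma cyc_m_inv:
  assumes "distinct [d, e, f]" "cyc d e f \<in> carrier G"
  shows "m_inv G (cyc d e f) = cyc e d f"
proof (rule G.inv_equality)
  show "cyc e d f \<otimes>\<^bsub>G\<^esub> cyc d e f = \<one>\<^bsub>G\<^esub>"
    unfolding mult_eq one_eq by (rule ext) (use assms(1) in \<open>simp add: cyc_apply\<close>)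
  have "cyc d e f \<circ> cyc d e f \<in> carrier G" using assms(2) by (rule comp_closed[rotated]) (rule assms(2))
  moreover have "cyc d e f \<circ> cyc d e f = cyc e d f"
    by (rule ext) (use assms(1) in \<open>simp add: cyc_apply\<close>)
  ultimately show "cyc e d f \<in> carrier G" by simp
qed (rule assms(2))

text \<open>(d e)(p q) fixes (a b c) and inverts (d e f). For distinct \<open>p\<close> and
  \<open>q\<close> it is even, as alternating groups demand; \<open>p = q\<close> reduces it to (d
  e), which serves symmetric groups.\<close>

lemma disjoint_cyc_lc:
  assumes "distinct [a, b, c, d, e, f]" "{p, q} \<inter> {a, b, c, d, e, f} = {}"
    and "cyc a b c \<in> carrier G" "cyc d e f \<in> carrier G" "transpose d e \<circ> transpose p q \<in> carrier G"
  shows "lc (cyc a b c) (cyc d e f)"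
proof (rule lc_if_inverted[OF assms(3-5) cyc_disjoint_commute[OF assms(1)]])
  show "cyc d e f [^]\<^bsub>G\<^esub> (3::nat) = \<one>\<^bsub>G\<^esub>" using assms(1) by (intro cyc_order) simp
  have *: "distinct [a, b, c]" "distinct [d, e, f]" "{a, b, c} \<inter> {d, e, f} = {}"
    "{p, q} \<inter> {a, b, c} = {}" "{p, q} \<inter> {d, e, f} = {}"
    using assms(1,2) by auto
  show "(transpose d e \<circ> transpose p q) \<otimes>\<^bsub>G\<^esub> cyc a b c \<otimes>\<^bsub>G\<^esub> m_inv G (transpose d e \<circ> transpose p q) = cyc a b c"
    unfolding m_inv_eq[OF assms(5)] mult_eq by (rule cyc_transpose_conj(1)[OF *])
  show "(transpose d e \<circ> transpose p q) \<otimes>\<^bsub>G\<^esub> cyc d e f \<otimes>\<^bsub>G\<^esub> m_inv G (transpose d e \<circ> transpose p q) = m_inv G (cyc d e f)"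
    unfolding m_inv_eq[OF assms(5)] mult_eq cyc_m_inv[OF *(2) assms(4)] by (rule cyc_transpose_conj(2)[OF *])
qed

lemma deep_adj_sym: "deep_adj H \<pi> x y \<Longrightarrow> deep_adj H \<pi> y x"
  using lc_sym by (auto simp: deep_adj_iff)

lemma deep_adj_irrefl: "\<not> deep_adj H \<pi> x x"
  by (simp add: deep_adj_iff)

end

lemma alt_not_perfect:
  assumes n: "8 \<le> n" and ext: "central_extension H (alt_group n) \<pi>"
  shows "\<not> perfect_graph (carrier (alt_group n)) (deep_adj H \<pi>)"
proof -
  interpret central_extension H "alt_group n" \<pi> by (rule ext)
  interpret perm_group "alt_group n" n by (rule perm_group_alt)
  interpret perm_extension H "alt_group n" \<pi> n by unfold_locales
  have mem: "cyc a b c \<in> carrier (alt_group n)" if "distinct [a, b, c]" "{a, b, c} \<subseteq> {1..8}" for a b c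
    using that n by (intro cyc_in_alt_group) auto
  have dbl: "transpose d e \<circ> transpose p q \<in> carrier (alt_group n)"
    if "d \<noteq> e" "p \<noteq> q" "{d, e, p, q} \<subseteq> {1..8}" for d e p q
    using that n
    by (auto simp: alt_group_carrier evenperm_comp permutation_swap_id evenperm_swap
        intro!: permutes_compose permutes_swap_id)
  have adj: "deep_adj H \<pi> (cyc a b c) (cyc d e f)"
    if *: "distinct [a, b, c, d, e, f]" "{a, b, c, d, e, f} \<subseteq> {1..8}" for a b c d e f
  proof -
    have "card {a, b, c, d, e, f} = 6" using *(1) by simp
    then have "2 \<le> card ({1..8} - {a, b, c, d, e, f})"
      using *(2) by (subst card_Diff_subset) auto
    then obtain D where "D \<subseteq> {1..8} - {a, b, c, d, e, f}" "card D = 2" using obtain_subset_with_card_n by metis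
    \<comment> \<open>The two points of {1..8} left over by the 3-cycles make the conjugator
      even.\<close>
    then obtain p q where pq: "p \<noteq> q" "{p, q} \<subseteq> {1..8} - {a, b, c, d, e, f}" unfolding card_2_iff by blast
    have "lc (cyc a b c) (cyc d e f)"
      by (rule disjoint_cyc_lc[OF *(1), of p q]; (intro mem dbl)?) (use * pq in auto)
    moreover have "cyc a b c \<noteq> cyc d e f"
      using *(1) by (auto dest!: fun_cong[of _ _ a] simp: cyc_apply)
    ultimately show ?thesis by (simp add: deep_adj_iff)
  qed
  have nadj: "\<not> deep_adj H \<pi> (cyc a b c) (cyc d e f)"
    if "distinct [a, b, c]" "distinct [d, e, f]" "{a, b, c, d, e, f} \<subseteq> {1..8}"
      "cyc a b c (cyc d e f k) \<noteq> cyc d e f (cyc a b c k)" for a b c d e f k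
    using not_lc[OF mem mem that(4)] that(1-3) by (auto simp: deep_adj_iff)
  show ?thesis
  proof (rule not_perfect_if_hole5[where a = "cyc 1 2 3" and b = "cyc 4 5 6" and c = "cyc 1 2 7"
        and d = "cyc 3 4 8" and e = "cyc 5 6 7"])
    show "{cyc 1 2 3, cyc 4 5 6, cyc 1 2 7, cyc 3 4 8, cyc 5 6 7} \<subseteq> carrier (alt_group n)"
      by (simp add: mem)
    \<comment> \<open>Here and below \<open>k\<close> is a point on which the two products
      differ.\<close>
    show "\<not> deep_adj H \<pi> (cyc 1 2 3) (cyc 1 2 7)" by (rule nadj[where k = 2]; simp add: cyc_apply)
    show "\<not> deep_adj H \<pi> (cyc 1 2 3) (cyc 3 4 8)" by (rule nadj[where k = 3]; simp add: cyc_apply)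
    show "\<not> deep_adj H \<pi> (cyc 4 5 6) (cyc 3 4 8)" by (rule nadj[where k = 4]; simp add: cyc_apply)
    show "\<not> deep_adj H \<pi> (cyc 4 5 6) (cyc 5 6 7)" by (rule nadj[where k = 6]; simp add: cyc_apply)
    show "\<not> deep_adj H \<pi> (cyc 1 2 7) (cyc 5 6 7)" by (rule nadj[where k = 7]; simp add: cyc_apply)
    show "deep_adj H \<pi> (cyc 1 2 3) (cyc 4 5 6)" "deep_adj H \<pi> (cyc 4 5 6) (cyc 1 2 7)"
      "deep_adj H \<pi> (cyc 1 2 7) (cyc 3 4 8)" "deep_adj H \<pi> (cyc 3 4 8) (cyc 5 6 7)"
      "deep_adj H \<pi> (cyc 5 6 7) (cyc 1 2 3)"
      by (rule adj; simp)+
  qed (erule deep_adj_sym, rule deep_adj_irrefl)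
qed

lemma sym_not_perfect:
  assumes n: "6 \<le> n" and ext: "central_extension H (sym_group n) \<pi>"
  shows "\<not> perfect_graph (carrier (sym_group n)) (deep_adj H \<pi>)"
proof -
  interpret central_extension H "sym_group n" \<pi> by (rule ext)
  interpret perm_group "sym_group n" n by (rule perm_group_sym)
  interpret perm_extension H "sym_group n" \<pi> n by unfold_locales
  interpret sym_extension H n \<pi> by unfold_locales
  have memc: "cyc a b c \<in> carrier (sym_group n)" if "{a, b, c} \<subseteq> {1..6}" for a b c
    using that n by (auto simp: sym_group_carrier intro!: cyc_permutes)
  have memt: "transpose a b \<in> carrier (sym_group n)" if "{a, b} \<subseteq> {1..6}" for a b
    using that n by (auto simp: sym_group_carrier intro!: permutes_swap_id)
  have nadj: "\<not> deep_adj H \<pi> x y"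
    if "x \<in> carrier (sym_group n)" "y \<in> carrier (sym_group n)" "x (y k) \<noteq> y (x k)" for x y k
    using not_lc[OF that] by (auto simp: deep_adj_iff)
  show ?thesis
  proof (cases "lc (transpose 1 2) (transpose 3 4)")
    case True
    have adj: "deep_adj H \<pi> (transpose a b) (transpose c d)"
      if *: "distinct [a, b, c, d]" "{a, b, c, d} \<subseteq> {1..6}" for a b c d
    proof -
      have "lc (transpose a b) (transpose c d)"
        by (rule lc_transpose_conj[OF True]) (use * n in auto)
      moreover have "transpose a b \<noteq> transpose c d"
        using *(1) by (auto dest!: fun_cong[of _ _ a] simp: transpose_def)
      ultimately show ?thesis by (simp add: deep_adj_iff)
    qed
    show ?thesis
    \<comment> \<open>A pentagon in the Petersen graph on the 2-subsets of {1..5}.\<close>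
    proof (rule not_perfect_if_hole5[where a = "transpose 1 2" and b = "transpose 3 4" and c = "transpose 1 5"
          and d = "transpose 2 3" and e = "transpose 4 5"])
      show "{transpose 1 2, transpose 3 4, transpose 1 5, transpose 2 3, transpose 4 5} \<subseteq> carrier (sym_group n)"
        by (simp add: memt)
      show "\<not> deep_adj H \<pi> (transpose 1 2) (transpose 1 5)"
        by (rule nadj[where k = 1]; (intro memt)?) (simp_all add: transpose_def)
      show "\<not> deep_adj H \<pi> (transpose 1 2) (transpose 2 3)"
        by (rule nadj[where k = 2]; (intro memt)?) (simp_all add: transpose_def)
      show "\<not> deep_adj H \<pi> (transpose 3 4) (transpose 2 3)"
        by (rule nadj[where k = 3]; (intro memt)?) (simp_all add: transpose_def)
      show "\<not> deep_adj H \<pi> (transpose 3 4) (transpose 4 5)"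
        by (rule nadj[where k = 4]; (intro memt)?) (simp_all add: transpose_def)
      show "\<not> deep_adj H \<pi> (transpose 1 5) (transpose 4 5)"
        by (rule nadj[where k = 5]; (intro memt)?) (simp_all add: transpose_def)
      show "deep_adj H \<pi> (transpose 1 2) (transpose 3 4)" "deep_adj H \<pi> (transpose 3 4) (transpose 1 5)"
        "deep_adj H \<pi> (transpose 1 5) (transpose 2 3)" "deep_adj H \<pi> (transpose 2 3) (transpose 4 5)"
        "deep_adj H \<pi> (transpose 4 5) (transpose 1 2)"
        by (rule adj; simp)+
    qed (erule deep_adj_sym, rule deep_adj_irrefl)
  next
    case False
    \<comment> \<open>The only two non-neighbours on the heptagon that commute in S_n; here the case
      assumption is used.\<close>
    have nlc: "\<not> deep_adj H \<pi> (transpose 3 4) (transpose 2 6)"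
      using lc_transpose_conj[of 3 4 2 6 1 2 3 4] False n by (auto simp: deep_adj_iff)
    have adjc: "deep_adj H \<pi> (cyc a b c) (cyc d e f)"
      if *: "distinct [a, b, c, d, e, f]" "{a, b, c, d, e, f} \<subseteq> {1..6}" for a b c d e f
    proof -
      \<comment> \<open>\<open>transpose 0 0\<close> is the identity: in S_n the odd conjugator (d
        e) is available.\<close>
      have t: "transpose d e \<circ> transpose 0 0 \<in> carrier (sym_group n)" using memt[of d e] * by simp
      have "{0::nat, 0} \<inter> {a, b, c, d, e, f} = {}" using *(2) by auto
      then have "lc (cyc a b c) (cyc d e f)"
        using * t by (intro disjoint_cyc_lc[of a b c d e f 0 0] memc) auto
      moreover have "cyc a b c \<noteq> cyc d e f"
      using *(1) by (auto dest!: fun_cong[of _ _ a] simp: cyc_apply)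
      ultimately show ?thesis by (simp add: deep_adj_iff)
    qed
    have adjt: "deep_adj H \<pi> (transpose a b) (cyc c d e)"
      if *: "distinct [a, b, c, d, e]" "{a, b, c, d, e} \<subseteq> {1..6}" for a b c d e
    proof -
      have "lc (transpose a b) (cyc c d e)"
      proof (rule lc_coprime_2_3)
        show "transpose a b \<in> carrier (sym_group n)" "cyc c d e \<in> carrier (sym_group n)"
          using * by (auto intro!: memt memc)
        show "transpose a b \<otimes>\<^bsub>sym_group n\<^esub> cyc c d e = cyc c d e \<otimes>\<^bsub>sym_group n\<^esub> transpose a b"
          unfolding mult_eq
          by (rule disjoint_permutes_commute[OF permutes_swap_id[of a "{a, b}"] cyc_permutes[OF order_refl]])
             (use *(1) in auto)
        show "transpose a b [^]\<^bsub>sym_group n\<^esub> (2::nat) = \<one>\<^bsub>sym_group n\<^esub>" by (simp add: pow2_eq one_eq)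
        show "cyc c d e [^]\<^bsub>sym_group n\<^esub> (3::nat) = \<one>\<^bsub>sym_group n\<^esub>" using *(1) by (intro cyc_order) simp
      qed
      moreover have "transpose a b \<noteq> cyc c d e"
        using *(1) by (auto dest!: fun_cong[of _ _ a] simp: cyc_apply transpose_def)
      ultimately show ?thesis by (simp add: deep_adj_iff)
    qed
    show ?thesis
    proof (rule not_perfect_if_hole7[where a = "cyc 3 4 5" and b = "cyc 1 2 6" and c = "transpose 3 4"
          and d = "cyc 1 2 5" and e = "transpose 4 6" and f = "cyc 1 3 5" and g = "transpose 2 6"])
      show "{cyc 3 4 5, cyc 1 2 6, transpose 3 4, cyc 1 2 5, transpose 4 6, cyc 1 3 5, transpose 2 6}
          \<subseteq> carrier (sym_group n)"
        by (simp add: memt memc)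
      show "\<not> deep_adj H \<pi> (cyc 3 4 5) (transpose 3 4)"
        by (rule nadj[where k = 3]; (intro memt memc)?) (simp_all add: transpose_def cyc_apply)
      show "\<not> deep_adj H \<pi> (cyc 3 4 5) (cyc 1 2 5)"
        by (rule nadj[where k = 5]; (intro memt memc)?) (simp_all add: cyc_apply)
      show "\<not> deep_adj H \<pi> (cyc 3 4 5) (transpose 4 6)"
        by (rule nadj[where k = 4]; (intro memt memc)?) (simp_all add: transpose_def cyc_apply)
      show "\<not> deep_adj H \<pi> (cyc 3 4 5) (cyc 1 3 5)"
        by (rule nadj[where k = 1]; (intro memt memc)?) (simp_all add: cyc_apply)
      show "\<not> deep_adj H \<pi> (cyc 1 2 6) (cyc 1 2 5)"
        by (rule nadj[where k = 2]; (intro memt memc)?) (simp_all add: cyc_apply)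
      show "\<not> deep_adj H \<pi> (cyc 1 2 6) (transpose 4 6)"
        by (rule nadj[where k = 6]; (intro memt memc)?) (simp_all add: transpose_def cyc_apply)
      show "\<not> deep_adj H \<pi> (cyc 1 2 6) (cyc 1 3 5)"
        by (rule nadj[where k = 1]; (intro memt memc)?) (simp_all add: cyc_apply)
      show "\<not> deep_adj H \<pi> (cyc 1 2 6) (transpose 2 6)"
        by (rule nadj[where k = 2]; (intro memt memc)?) (simp_all add: transpose_def cyc_apply)
      show "\<not> deep_adj H \<pi> (transpose 3 4) (transpose 4 6)"
        by (rule nadj[where k = 4]; (intro memt memc)?) (simp_all add: transpose_def)
      show "\<not> deep_adj H \<pi> (transpose 3 4) (cyc 1 3 5)"
        by (rule nadj[where k = 3]; (intro memt memc)?) (simp_all add: transpose_def cyc_apply)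
      show "\<not> deep_adj H \<pi> (cyc 1 2 5) (cyc 1 3 5)"
        by (rule nadj[where k = 1]; (intro memt memc)?) (simp_all add: cyc_apply)
      show "\<not> deep_adj H \<pi> (cyc 1 2 5) (transpose 2 6)"
        by (rule nadj[where k = 2]; (intro memt memc)?) (simp_all add: transpose_def cyc_apply)
      show "\<not> deep_adj H \<pi> (transpose 4 6) (transpose 2 6)"
        by (rule nadj[where k = 6]; (intro memt memc)?) (simp_all add: transpose_def)
      show "deep_adj H \<pi> (cyc 3 4 5) (cyc 1 2 6)" by (rule adjc) simp_all
      show "deep_adj H \<pi> (cyc 1 2 6) (transpose 3 4)" "deep_adj H \<pi> (cyc 1 2 5) (transpose 4 6)"
        "deep_adj H \<pi> (cyc 1 3 5) (transpose 2 6)"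
        by (rule deep_adj_sym, rule adjt; simp)+
      show "deep_adj H \<pi> (transpose 3 4) (cyc 1 2 5)" "deep_adj H \<pi> (transpose 4 6) (cyc 1 3 5)"
        "deep_adj H \<pi> (transpose 2 6) (cyc 3 4 5)"
        by (rule adjt; simp)+
      show "\<not> deep_adj H \<pi> (transpose 3 4) (transpose 2 6)" by (rule nlc)
    qed (erule deep_adj_sym, rule deep_adj_irrefl)
  qed
qed

section \<open>Centralizers in small degree\<close>

lemma distinct_length_le:
  assumes "distinct xs" "set xs \<subseteq> {1..n::nat}"
  shows "length xs \<le> n"
  using card_mono[OF _ assms(2)] distinct_card[OF assms(1)] by simp

section \<open>Permutations of small cycle type\<close>

lemma odd_transpose: "a \<noteq> b \<Longrightarrow> \<not> evenperm (transpose a b)"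
  by (simp add: evenperm_swap)

lemma odd_triple_transpose:
  "a \<noteq> b \<Longrightarrow> c \<noteq> d \<Longrightarrow> e \<noteq> f \<Longrightarrow> \<not> evenperm (transpose a b \<circ> transpose c d \<circ> transpose e f)"
  by (simp add: evenperm_comp evenperm_swap permutation_compose permutation_swap_id)

lemma four_cycle_eq:
  assumes "distinct [a, b, c, d]" "v a = b" "v b = c" "v c = d" "v d = a" "\<And>q. q \<notin> {a, b, c, d} \<Longrightarrow> v q = q"
  shows "v = transpose a b \<circ> transpose b c \<circ> transpose c d"
proof
  fix q
  consider "q = a" | "q = b" | "q = c" | "q = d" | "q \<notin> {a, b, c, d}" by blast
  moreover have "distinct [d, c, b, a]" using assms(1) by auto
  ultimately show "v q = (transpose a b \<circ> transpose b c \<circ> transpose c d) q"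
    by cases (use assms in \<open>simp_all add: transpose_def\<close>)
qed

lemma double_transpose_eq:
  assumes "distinct [a, b, c, d]" "v a = b" "v b = a" "v c = d" "v d = c" "\<And>q. q \<notin> {a, b, c, d} \<Longrightarrow> v q = q"
  shows "v = transpose a b \<circ> transpose c d"
proof
  fix q
  consider "q = a" | "q = b" | "q = c" | "q = d" | "q \<notin> {a, b, c, d}" by blast
  moreover have "distinct [d, c, b, a]" using assms(1) by auto
  ultimately show "v q = (transpose a b \<circ> transpose c d) q"
    by cases (use assms in \<open>simp_all add: transpose_def\<close>)
qed

lemma triple_transpose_eq:
  assumes "distinct [a, b, c, d, e, f]" "v a = b" "v b = a" "v c = d" "v d = c" "v e = f" "v f = e"
    "\<And>q. q \<notin> {a, b, c, d, e, f} \<Longrightarrow> v q = q"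
  shows "v = transpose a b \<circ> transpose c d \<circ> transpose e f"
proof
  fix q
  consider "q = a" | "q = b" | "q = c" | "q = d" | "q = e" | "q = f" | "q \<notin> {a, b, c, d, e, f}" by blast
  moreover have "distinct [f, e, d, c, b, a]" using assms(1) by auto
  ultimately show "v q = (transpose a b \<circ> transpose c d \<circ> transpose e f) q"
    by cases (use assms in \<open>simp_all add: transpose_def\<close>)
qed

lemma transpose_eq:
  assumes "v a = b" "v b = a" "\<And>q. q \<notin> {a, b} \<Longrightarrow> v q = q"
  shows "v = transpose a b"
proof
  fix q
  show "v q = transpose a b q"
    using assms by (cases "q \<in> {a, b}") (auto simp: transpose_def)
qed

lemma cyc_eq:
  assumes "distinct [a, b, c]" "v a = b" "v b = c" "v c = a" "\<And>q. q \<notin> {a, b, c} \<Longrightarrow> v q = q"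
  shows "v = cyc a b c"
proof
  fix q
  consider "q = a" | "q = b" | "q = c" | "q \<notin> {a, b, c}" by blast
  moreover have "distinct [c, b, a]" using assms(1) by auto
  ultimately show "v q = cyc a b c q"
    by cases (use assms in \<open>simp_all add: cyc_apply\<close>)
qed

text \<open>The centralizer of (a b)(d e) in the symmetric group of the four points is dihedral of
  order 8. Two transpositions and two 4-cycles in it are odd; the even elements form the Klein
  four-group.\<close>

lemma klein_centralizer:
  assumes i: "i = transpose a b \<circ> transpose d e" and dist: "distinct [a, b, d, e]"
    and v: "v permutes {a, b, d, e}" "evenperm v" and comm: "\<And>p. v (i p) = i (v p)"
  shows "v = id \<or> v = i \<or> v = transpose a d \<circ> transpose b e \<or> v = transpose a e \<circ> transpose b d"
proof -
  have iv: "i a = b" "i b = a" "i d = e" "i e = d" using dist unfolding i by (auto simp: transpose_def)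
  have outside: "\<And>q. q \<notin> {a, b, d, e} \<Longrightarrow> v q = q" using permutes_not_in[OF v(1)] by blast
  have inj: "v p = v q \<longleftrightarrow> p = q" for p q using permutes_inj[OF v(1)] by (simp add: inj_eq)
  have vb: "v b = i (v a)" and ve: "v e = i (v d)" using comm[of a] comm[of d] iv by simp_all
  have va: "v a \<in> {a, b, d, e}" and vd: "v d \<in> {a, b, d, e}"
    using permutes_in_image[OF v(1)] by blast+
  have dab: "v d \<noteq> v a" "v d \<noteq> v b" using inj dist by auto
  from va consider "v a = a" | "v a = b" | "v a = d" | "v a = e" by blast
  then show ?thesis
  proof cases
    case 1
    then have 2: "v b = b" using vb iv by simp
    then consider "v d = d" | "v d = e" using vd dab 1 by auto
    then show ?thesis
    proof cases
      case 1
      then have "v e = e" using ve iv by simp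
      then have "v q = q" for q using \<open>v a = a\<close> 2 1 outside[of q] by blast
      then show ?thesis by auto
    next
      case 3: 2
      have "v q = q" if "q \<notin> {d, e}" for q
        using \<open>v a = a\<close> 2 outside[of q] that by blast
      then have "v = transpose d e" using 3 ve iv by (intro transpose_eq) auto
      then show ?thesis using v(2) odd_transpose[of d e] dist by simp
    qed
  next
    case 2
    then have 3: "v b = a" using vb iv by simp
    then consider "v d = d" | "v d = e" using vd dab 2 by auto
    then show ?thesis
    proof cases
      case 1
      then have "v e = e" using ve iv by simp
      then have "v q = q" if "q \<notin> {a, b}" for q
        using 1 outside[of q] that by blast
      then have "v = transpose a b" using 2 3 by (intro transpose_eq) auto
      then show ?thesis using v(2) odd_transpose[of a b] dist by simp
    next
      case 4: 2
      then have "v e = d" using ve iv by simp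
      then have "v = i" unfolding i by (rule double_transpose_eq[OF dist 2 3 4 _ outside])
      then show ?thesis by simp
    qed
  next
    case 3
    then have 4: "v b = e" using vb iv by simp
    then consider "v d = a" | "v d = b" using vd dab 3 by auto
    then show ?thesis
    proof cases
      case 1
      then have "v e = b" using ve iv by simp
      moreover have "distinct [a, d, b, e]" "\<And>q. q \<notin> {a, d, b, e} \<Longrightarrow> v q = q"
        using dist outside by auto
      ultimately have "v = transpose a d \<circ> transpose b e"
        using double_transpose_eq[of a d b e v] 3 4 1 by metis
      then show ?thesis by simp
    next
      case 2
      then have "v e = a" using ve iv by simp
      moreover have "distinct [a, d, b, e]" "\<And>q. q \<notin> {a, d, b, e} \<Longrightarrow> v q = q"
        using dist outside by auto
      ultimately have "v = transpose a d \<circ> transpose d b \<circ> transpose b e"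
        using four_cycle_eq[of a d b e v] 3 4 2 by metis
      then show ?thesis using v(2) odd_triple_transpose[of a d d b b e] dist by auto
    qed
  next
    case 4
    then have 5: "v b = d" using vb iv by simp
    then consider "v d = a" | "v d = b" using vd dab 4 by auto
    then show ?thesis
    proof cases
      case 1
      then have "v e = b" using ve iv by simp
      moreover have "distinct [a, e, b, d]" "\<And>q. q \<notin> {a, e, b, d} \<Longrightarrow> v q = q"
        using dist outside by auto
      ultimately have "v = transpose a e \<circ> transpose e b \<circ> transpose b d"
        using four_cycle_eq[of a e b d v] 4 5 1 by metis
      then show ?thesis using v(2) odd_triple_transpose[of a e e b b d] dist by auto
    next
      case 2
      then have "v e = a" using ve iv by simp
      moreover have "distinct [a, e, b, d]" "\<And>q. q \<notin> {a, e, b, d} \<Longrightarrow> v q = q"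
        using dist outside by auto
      ultimately have "v = transpose a e \<circ> transpose b d"
        using double_transpose_eq[of a e b d v] 4 5 2 by metis
      then show ?thesis by simp
    qed
  qed
qed

lemma funpow_commute:
  assumes "\<And>p. y (x p) = x (y p)"
  shows "y ((x ^^ k) p) = (x ^^ k) (y p)"
  using assms by (induction k) simp_all

text \<open>Otherwise the group generated by \<open>x\<close> and \<open>y\<close> would have an orbit of 9 points.\<close>

lemma order3_orbit:
  fixes n :: nat
  assumes x: "x permutes {1..n}" and y: "y permutes {1..n}" and n: "n \<le> 7"
    and x3: "\<And>p. x (x (x p)) = p" and y3: "\<And>p. y (y (y p)) = p" and comm: "\<And>p. y (x p) = x (y p)"
    and a: "x a \<noteq> a"
  shows "y a = a \<or> y a = x a \<or> y a = x (x a)"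
proof (rule ccontr)
  assume no: "\<not> ?thesis"
  have injx: "x p = x q \<longleftrightarrow> p = q" for p q using permutes_inj[OF x] by (simp add: inj_eq)
  have injy: "y p = y q \<longleftrightarrow> p = q" for p q using permutes_inj[OF y] by (simp add: inj_eq)
  define O3 where "O3 c = {c, x c, x (x c)}" for c
  have cl: "O3 c' = O3 c" if "c' \<in> O3 c" for c c' using that x3 unfolding O3_def by auto
  have self: "c \<in> O3 c" for c by (simp add: O3_def)
  have meet: "c' \<in> O3 c" if "O3 c \<inter> O3 c' \<noteq> {}" for c c'
    using that cl self by blast
  have img: "y ` O3 c = O3 (y c)" for c using comm unfolding O3_def by auto
  have yimg: "y c' \<in> O3 (y c) \<longleftrightarrow> c' \<in> O3 c" for c c' unfolding img[symmetric] using injy by auto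
  have n1: "y a \<notin> O3 a" using no unfolding O3_def by auto
  then have n2: "y (y a) \<notin> O3 (y a)" using yimg by blast
  have n3: "y (y a) \<notin> O3 a"
  proof
    assume "y (y a) \<in> O3 a"
    then have "y (y (y a)) \<in> O3 (y a)" using yimg by blast
    then have "a \<in> O3 (y a)" using y3 by simp
    then show False using n1 cl self by blast
  qed
  have card3: "card (O3 c) = 3" if "x c \<noteq> c" for c
  proof -
    have "x (x c) \<noteq> c"
    proof
      assume "x (x c) = c"
      then have "x (x (x c)) = x c" by simp
      then show False using x3 that by simp
    qed
    then show ?thesis using that injx unfolding O3_def by auto
  qed
  have moved: "x (y a) \<noteq> y a" "x (y (y a)) \<noteq> y (y a)"
    using a comm injy by metis+
  have fin: "finite (O3 c)" for c by (simp add: O3_def)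
  have "card (O3 a \<union> O3 (y a) \<union> O3 (y (y a))) = 9"
    using card3[OF a] card3[OF moved(1)] card3[OF moved(2)] meet n1 n2 n3 fin
    by (subst card_Un_disjoint; (subst card_Un_disjoint)?) auto
  moreover have O3_in: "O3 c \<subseteq> {1..n}" if "c \<in> {1..n}" for c
    using that permutes_in_image[OF x] unfolding O3_def by blast
  moreover have "a \<in> {1..n}" using a permutes_not_in[OF x] by blast
  then have sub: "O3 a \<union> O3 (y a) \<union> O3 (y (y a)) \<subseteq> {1..n}"
    using O3_in permutes_in_image[OF y] by (meson Un_least)
  ultimately have "9 \<le> card {1..n}"
    using card_mono[OF _ sub] by simp
  then show False using n by simp
qed

context perm_extension
begin

lemma lc_funpow: "lc x y \<Longrightarrow> x \<in> carrier G \<Longrightarrow> y \<in> carrier G \<Longrightarrow> lc x (y ^^ k) \<and> y ^^ k \<in> carrier G"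
proof (induction k)
  case 0
  then show ?case using lc_one id_closed by (simp only: funpow.simps(1) one_eq)
next
  case (Suc k)
  then show ?case using lc_mult[of x y "y ^^ k"] comp_closed by (simp only: funpow.simps(2) mult_eq)
qed

text \<open>\<open>y \<circ> x ^^ k = id\<close> is how the lemmas below express that
  \<open>y\<close> is a power of \<open>x\<close>, avoiding negative exponents.\<close>

lemma lc_inverse_pow:
  assumes "lc z x" "x \<in> carrier G" "y \<in> carrier G" "z \<in> carrier G" "y \<circ> x ^^ k = id"
  shows "lc z y"
proof -
  have k: "lc z (x ^^ k)" "x ^^ k \<in> carrier G" using lc_funpow assms by blast+
  have "m_inv G (x ^^ k) = y"
    by (rule G.inv_equality) (use assms k in \<open>simp_all add: mult_eq one_eq\<close>)
  then show ?thesis using lc_inv[OF k(1) assms(4) k(2)] by simp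
qed

lemma inj_perm: "x \<in> carrier G \<Longrightarrow> x p = x q \<longleftrightarrow> p = q"
  using permutes_inj[OF permutes] by (simp add: inj_eq)

lemma moved_in: "x \<in> carrier G \<Longrightarrow> x p \<noteq> p \<Longrightarrow> p \<in> {1..n}"
  using permutes_not_in[OF permutes] by blast

lemma image_in: "x \<in> carrier G \<Longrightarrow> x p \<in> {1..n} \<longleftrightarrow> p \<in> {1..n}"
  using permutes_in_image[OF permutes] by blast

context
  assumes n7: "n \<le> 7" and parity: "n \<le> 5 \<or> (\<forall>g \<in> carrier G. evenperm g)"
begin

text \<open>Three 2-cycles form an odd permutation on 6 points, where \<open>parity\<close> leaves
  only even ones, and four would need 8 points. A single transposition is odd and occurs only in
  degree at most 5.\<close>

lemma involution_cases:
  assumes x: "x \<in> carrier G" and sq: "\<And>p. x (x p) = p" and a: "x a \<noteq> a"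
  shows "(n \<le> 5 \<and> x = transpose a (x a)) \<or>
    (\<exists>c. distinct [a, x a, c, x c] \<and> x = transpose a (x a) \<circ> transpose c (x c))"
proof (cases "\<exists>c. c \<notin> {a, x a} \<and> x c \<noteq> c")
  case False
  then have "x = transpose a (x a)" using sq by (intro transpose_eq) auto
  then show ?thesis using parity x odd_transpose[of a "x a"] a by auto
next
  case True
  then obtain c where c: "c \<notin> {a, x a}" "x c \<noteq> c" by blast
  have out: "x q \<notin> {r, x r}" if "q \<notin> {r, x r}" for q r
    using that sq by (metis insert_iff empty_iff)
  have dist: "distinct [a, x a, c, x c]" using a c out[OF c(1)] by auto
  have "x q = q" if q: "q \<notin> {a, x a, c, x c}" for q
  proof (rule ccontr)
    assume xq: "x q \<noteq> q"
    have d6: "distinct [a, x a, c, x c, q, x q]" using dist q xq out[of q a] out[of q c] by auto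
    have in6: "set [a, x a, c, x c, q, x q] \<subseteq> {1..n}"
      using moved_in[OF x a] moved_in[OF x c(2)] moved_in[OF x xq] image_in[OF x] by simp
    have "6 \<le> n" using distinct_length_le[OF d6 in6] by simp
    then have even: "evenperm x" using parity x by auto
    have rest: "x r = r" if r: "r \<notin> {a, x a, c, x c, q, x q}" for r
    proof (rule ccontr)
      assume xr: "x r \<noteq> r"
      have "distinct [a, x a, c, x c, q, x q, r, x r]" using d6 r xr out[of r a] out[of r c] out[of r q] by auto
      moreover have "set [a, x a, c, x c, q, x q, r, x r] \<subseteq> {1..n}"
        using in6 moved_in[OF x xr] image_in[OF x] by simp
      ultimately have "8 \<le> n"
        using distinct_length_le[of "[a, x a, c, x c, q, x q, r, x r]" n] by simp
      then show False using n7 by simp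
    qed
    have "x = transpose a (x a) \<circ> transpose c (x c) \<circ> transpose q (x q)"
      by (rule triple_transpose_eq[OF d6 refl sq refl sq refl sq rest])
    moreover have "\<not> evenperm (transpose a (x a) \<circ> transpose c (x c) \<circ> transpose q (x q))"
      using d6 by (intro odd_triple_transpose) auto
    ultimately show False using even by metis
  qed
  then have "x = transpose a (x a) \<circ> transpose c (x c)"
    by (rule double_transpose_eq[OF dist refl sq refl sq])
  then show ?thesis using dist by blast
qed

text \<open>The first four points \<open>A\<close> of the orbit and their image under
  \<open>y\<close> must meet within 7 points, so \<open>y\<close> times a power of \<open>x\<close>
  is some \<open>v\<close> fixing \<open>a\<close> and then all of \<open>A\<close>. At most 3
  points remain for \<open>v\<close>: a transposition there is odd, and beside a 3-cycle the product
  of \<open>x\<close> with some power of \<open>v\<close> would be a single 4-cycle, again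
  odd.\<close>

lemma long_orbit_centralizer:
  assumes x: "x \<in> carrier G" and y: "y \<in> carrier G" and comm: "\<And>p. y (x p) = x (y p)"
    and orbit: "inj_on (\<lambda>i. (x ^^ i) a) {..<4}"
  shows "\<exists>k. y \<circ> x ^^ k = id"
proof -
  define A where "A = (\<lambda>i. (x ^^ i) a) ` {..<4}"
  have A: "A = {a, x a, x (x a), x (x (x a))}"
    by (auto simp: A_def lessThan_Suc numeral_eq_Suc)
  have d4: "distinct [a, x a, x (x a), x (x (x a))]"
    using orbit by (auto simp: inj_on_def numeral_eq_Suc lessThan_Suc)
  have "x a \<noteq> a" using d4 by auto
  then have a: "a \<in> {1..n}" using moved_in[OF x] by blast
  have A_in: "A \<subseteq> {1..n}" using a image_in[OF x] unfolding A by simp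
  have cardA: "card A = 4" using d4 unfolding A by simp
  have pow_closed: "x ^^ i \<in> carrier G" for i using lc_funpow[OF lc_refl[OF x] x x] by blast
  obtain m where m: "x ^^ m = id" "m > 0"
    using permutation_is_nilpotent[of x] permutes[OF x] permutation_permutes by blast
  have "\<exists>i<4. \<exists>j<4. (x ^^ i) (y a) = (x ^^ j) a"
  proof (rule ccontr)
    assume no: "\<not> ?thesis"
    have "y ` A \<inter> A = {}"
      using no funpow_commute[of y x, OF comm] unfolding A_def by force
    then have "card (A \<union> y ` A) = card A + card (y ` A)"
      using cardA by (subst card_Un_disjoint) (auto simp: A_def)
    moreover have "card (y ` A) = card A"
      using inj_perm[OF y] by (intro card_image) (simp add: inj_on_def)
    moreover have "A \<union> y ` A \<subseteq> {1..n}" using A_in image_in[OF y] by blast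
    ultimately have "8 \<le> card {1..n}" using cardA card_mono[of "{1..n}" "A \<union> y ` A"] by simp
    then show False using n7 by simp
  qed
  then obtain i j where ij: "(x ^^ i) (y a) = (x ^^ j) a" by blast
  obtain k where k: "(x ^^ k) (y a) = a"
  proof
    \<comment> \<open>As \<open>x ^^ m = id\<close>, the exponent \<open>m * j - j\<close> undoes
      \<open>x ^^ j\<close>.\<close>
    have "(x ^^ (m * j - j + i)) (y a) = (x ^^ (m * j - j)) ((x ^^ j) a)"
      using ij by (simp add: funpow_add)
    also have "\<dots> = (x ^^ (m * j)) a"
      using m(2) funpow_add[of "m * j - j" j x] by (simp add: fun_eq_iff)
    also have "x ^^ (m * j) = id" using m(1) by (simp add: funpow_mult[symmetric])
    finally show "(x ^^ (m * j - j + i)) (y a) = a" by simp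
  qed
  define v where "v = y \<circ> x ^^ k"
  have v: "v \<in> carrier G" unfolding v_def using y pow_closed by (rule comp_closed)
  have vx: "v (x p) = x (v p)" for p
    unfolding v_def comp_apply using comm[of "(x ^^ k) p"] funpow_swap1[of x k p] by metis
  have va: "v a = a" using k funpow_commute[of y x, OF comm] unfolding v_def by simp
  have vA: "v p = p" if "p \<in> A" for p using that va vx unfolding A by auto
  have "v = id"
  proof (rule ccontr)
    assume "v \<noteq> id"
    then obtain p where p: "v p \<noteq> p" by (auto simp: fun_eq_iff)
    define R where "R = {1..n} - A"
    have cardR: "card R = n - 4" using cardA A_in unfolding R_def by (subst card_Diff_subset) (auto simp: A)
    have finR: "finite R" unfolding R_def by simp
    have R: "q \<in> R" if "v q \<noteq> q" for q using that vA moved_in[OF v that] unfolding R_def by auto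
    have vR: "v (v q) \<noteq> v q" if "v q \<noteq> q" for q using that inj_perm[OF v] by simp
    have "{p, v p} \<subseteq> R" using R[OF p] R[OF vR[OF p]] by simp
    then have "2 \<le> card R" using card_mono[OF finR, of "{p, v p}"] p by simp
    \<comment> \<open>Two points outside \<open>A\<close> force degree at least 6, where
      \<open>parity\<close> makes every element even.\<close>
    then have even: "\<And>g. g \<in> carrier G \<Longrightarrow> evenperm g" using parity cardR by auto
    have le3: "card R \<le> 3" using cardR n7 by simp
    show False
    proof (cases "v (v p) = p")
      case True
      have "v q = q" if q: "q \<notin> {p, v p}" for q
      proof (rule ccontr)
        assume vq: "v q \<noteq> q"
        have "v q \<noteq> p" using True q inj_perm[OF v, of q "v p"] by auto
        then have "distinct [p, v p, q, v q]" using p q vq inj_perm[OF v] by auto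
        then have "card {p, v p, q, v q} = 4" by simp
        moreover have "{p, v p, q, v q} \<subseteq> R" using R[OF p] R[OF vR[OF p]] R[OF vq] R[OF vR[OF vq]] by simp
        ultimately show False using card_mono[OF finR, of "{p, v p, q, v q}"] le3 by simp
      qed
      then have "v = transpose p (v p)" using True by (intro transpose_eq) auto
      then show False using even[OF v] odd_transpose[of p "v p"] p by auto
    next
      case False
      have d3: "distinct [p, v p, v (v p)]" using p False inj_perm[OF v] by auto
      have sub: "{p, v p, v (v p)} \<subseteq> R" using R[OF p] R[OF vR[OF p]] R[OF vR[OF vR[OF p]]] by simp
      then have eqR: "R = {p, v p, v (v p)}"
        using card_subset_eq[OF finR sub] card_mono[OF finR sub] d3 le3 by simp
      have "v (v (v p)) \<in> R" using R[OF vR[OF vR[OF vR[OF p]]]] by simp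
      then have v3: "v (v (v p)) = p" using eqR d3 inj_perm[OF v] by auto
      have movedR: "v q \<noteq> q" if "q \<in> R" for q using that d3 v3 unfolding eqR by auto
      have x4: "x (x (x (x a))) = a"
      proof -
        have "v (x (x (x (x a)))) = x (x (x (x a)))" using vx va by simp
        then have "x (x (x (x a))) \<notin> R" using movedR by blast
        moreover have "x (x (x (x a))) \<in> {1..n}" using a image_in[OF x] by simp
        ultimately have "x (x (x (x a))) \<in> A" unfolding R_def by blast
        then show ?thesis using d4 inj_perm[OF x] unfolding A by auto
      qed
      have "x p \<notin> A"
      proof
        assume "x p \<in> A"
        then have "x p = x (x (x (x a))) \<or> x p = x a \<or> x p = x (x a) \<or> x p = x (x (x a))"
          using x4 unfolding A by auto
        then have "p \<in> A" using inj_perm[OF x] unfolding A by auto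
        then show False using vA p by blast
      qed
      moreover have "x p \<in> {1..n}" using moved_in[OF v p] image_in[OF x] by blast
      ultimately have "x p \<in> {p, v p, v (v p)}" unfolding eqR[symmetric] R_def by blast
      then obtain j where j: "(v ^^ j) (x p) = p"
        using v3 by (metis (no_types, lifting) comp_apply empty_iff funpow_0 funpow_Suc_right insert_iff)
      \<comment> \<open>\<open>u\<close> agrees with \<open>x\<close> on \<open>A\<close> and is
        trivial on \<open>R\<close>.\<close>
      define u where "u = x \<circ> v ^^ j"
      have vj: "v ^^ j \<in> carrier G" using lc_funpow[OF lc_refl[OF v] v v] by blast
      have u: "u \<in> carrier G" unfolding u_def using x vj by (rule comp_closed)
      have vjA: "(v ^^ j) q = q" if "q \<in> A" for q using vA[OF that] by (induction j) simp_all
      have uA: "u q = x q" if "q \<in> A" for q using vjA[OF that] by (simp add: u_def)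
      have up: "u p = p" using j funpow_commute[of x v j p] vx unfolding u_def by simp
      have uv: "u (v q) = v (u q)" for q
        unfolding u_def comp_apply using vx[of "(v ^^ j) q"] funpow_swap1[of v j q] by metis
      have uR: "u q = q" if "q \<in> R" for q using that up uv unfolding eqR by auto
      have "u q = q" if "q \<notin> {a, x a, x (x a), x (x (x a))}" for q
        using that uR moved_in[OF u] unfolding A[symmetric] R_def by blast
      then have "u = transpose a (x a) \<circ> transpose (x a) (x (x a)) \<circ> transpose (x (x a)) (x (x (x a)))"
        using d4 uA x4 by (intro four_cycle_eq) (auto simp: A)
      then show False
        using even[OF u] odd_triple_transpose[of a "x a" "x a" "x (x a)" "x (x a)" "x (x (x a))"] d4 by auto
    qed
  qed
  then show ?thesis unfolding v_def by blast
qed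

end

end

section \<open>Elements of order 2, 3 and 6 with commuting lifts\<close>

lemma cyc_eq_order3:
  assumes "\<And>p. v (v (v p)) = p" "v a \<noteq> a" "\<And>q. q \<notin> {a, v a, v (v a)} \<Longrightarrow> v q = q"
  shows "distinct [a, v a, v (v a)]" "v = cyc a (v a) (v (v a))"
proof -
  have "v (v a) \<noteq> v a" using assms(1,2) by metis
  moreover have "v (v a) \<noteq> a" using assms(1,2) by metis
  ultimately show d: "distinct [a, v a, v (v a)]" using assms(2) by auto
  show "v = cyc a (v a) (v (v a))" by (rule cyc_eq[OF d refl refl assms(1,3)])
qed

lemma double_transpose_involution:
  assumes "distinct [a, b, c, d]"
  shows "(transpose a b \<circ> transpose c d) \<circ> (transpose a b \<circ> transpose c d) = id"
proof
  fix q
  consider "q = a" | "q = b" | "q = c" | "q = d" | "q \<notin> {a, b, c, d}" by blast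
  moreover have "distinct [d, c, b, a]" using assms by auto
  ultimately show "((transpose a b \<circ> transpose c d) \<circ> (transpose a b \<circ> transpose c d)) q = id q"
    by cases (use assms in \<open>simp_all add: transpose_def\<close>)
qed

lemma order3_on_three_points:
  fixes y z :: "nat \<Rightarrow> nat"
  assumes F: "finite F" "card F \<le> 3" and y3: "\<And>q. y (y (y q)) = q" and z3: "\<And>q. z (z (z q)) = q"
    and yF: "\<And>q. q \<notin> F \<Longrightarrow> y q = q" and zF: "\<And>q. q \<notin> F \<Longrightarrow> z q = q" and ne: "y \<noteq> id" "z \<noteq> id"
  shows "z = y \<or> z = y \<circ> y"
proof -
  have orbit: "F = {p, g p, g (g p)} \<and> distinct [p, g p, g (g p)] \<and> g = cyc p (g p) (g (g p))"
    if g3: "\<And>q. g (g (g q)) = q" and gF: "\<And>q. q \<notin> F \<Longrightarrow> g q = q" and p: "g p \<noteq> p" for g p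
  proof -
    have gp: "g (g p) \<noteq> g p" "g (g p) \<noteq> p" using g3 p by metis+
    have sub: "{p, g p, g (g p)} \<subseteq> F" using gF p gp g3 by (metis empty_subsetI insert_subset)
    have d: "distinct [p, g p, g (g p)]" using p gp by auto
    then have "card {p, g p, g (g p)} = 3" by simp
    then have FF: "{p, g p, g (g p)} = F"
      using card_subset_eq[OF F(1) sub] card_mono[OF F(1) sub] F(2) by simp
    have "g q = q" if "q \<notin> {p, g p, g (g p)}" for q using gF that FF by simp
    then show ?thesis using cyc_eq_order3(2)[OF g3 p] FF d by simp
  qed
  obtain p where p: "y p \<noteq> p" using ne(1) by (auto simp: fun_eq_iff)
  obtain p' where p': "z p' \<noteq> p'" using ne(2) by (auto simp: fun_eq_iff)
  note Y = orbit[OF y3 yF p]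
  have "p \<in> {p', z p', z (z p')}" using orbit[OF z3 zF p'] Y by blast
  then have "p = p' \<or> p = z p' \<or> p = z (z p')" by blast
  then have zp: "z p \<noteq> p" using z3[of p'] p' by metis
  note Z = orbit[OF z3 zF zp]
  have sub: "z p \<in> {p, y p, y (y p)}" "z (z p) \<in> {p, y p, y (y p)}" using Y Z by blast+
  have "distinct [p, z p, z (z p)]" using Z by blast
  then have ne_z: "z p \<noteq> p" "z (z p) \<noteq> p" "z (z p) \<noteq> z p" by auto
  have "z p = y p \<or> z p = y (y p)" "z (z p) = y p \<or> z (z p) = y (y p)"
    using sub ne_z(1,2) by simp_all
  then consider "z p = y p" "z (z p) = y (y p)" | "z p = y (y p)" "z (z p) = y p" using ne_z(3) by metis
  then show ?thesis
  proof cases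
    case 1
    have "z = cyc p (z p) (z (z p))" using Z by blast
    also have "\<dots> = cyc p (y p) (y (y p))" using 1 by simp
    also have "\<dots> = y" using Y by simp
    finally show ?thesis by simp
  next
    case 2
    have "z = cyc p (z p) (z (z p))" using Z by blast
    also have "\<dots> = cyc p (y (y p)) (y p)" using 2 by simp
    also have "\<dots> = cyc p (y p) (y (y p)) \<circ> cyc p (y p) (y (y p))" using cyc_inverse[of p "y p" "y (y p)"] Y
      by (metis distinct_length_2_or_more)
    also have "\<dots> = y \<circ> y" using Y by simp
    finally show ?thesis by simp
  qed
qed

lemma funpow_3: "(x ^^ 3) q = x (x (x q))"
  by (simp add: numeral_eq_Suc)

context perm_extension
begin

context
  assumes n7: "n \<le> 7" and parity: "n \<le> 5 \<or> (\<forall>g \<in> carrier G. evenperm g)"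
    and involutions: "\<And>x y. x \<in> carrier G \<Longrightarrow> y \<in> carrier G \<Longrightarrow> x \<circ> x = id \<Longrightarrow> y \<circ> y = id \<Longrightarrow>
      x \<noteq> id \<Longrightarrow> y \<noteq> id \<Longrightarrow> x \<noteq> y \<Longrightarrow> \<not> lc x y"
    and three_cycles: "\<And>a b c d e f. distinct [a, b, c, d, e, f] \<Longrightarrow> {a, b, c, d, e, f} \<subseteq> {1..n} \<Longrightarrow>
      \<not> lc (cyc a b c) (cyc d e f)"
begin

text \<open>Cycles of length 2 and 3 both occur, so \<open>x\<close> has order 6, and 7 points hold
  just one 3-cycle beside a 2-cycle. It is preserved by \<open>y\<close>, and multiplying
  \<open>y\<close> by a power of \<open>x\<close> gives a \<open>v\<close> fixing it pointwise. In
  degree 5 only two points are left for \<open>v\<close>; in degree 7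
  \<open>klein_centralizer\<close> and \<open>involutions\<close> leave only the identity and the
  involution \<open>x ^^ 3\<close>.\<close>

lemma short_orbits_centralizer:
  assumes x: "x \<in> carrier G" and y: "y \<in> carrier G" and lc: "lc x y"
    and short: "\<And>q. x q = q \<or> x (x q) = q \<or> x (x (x q)) = q"
    and p: "x (x p) \<noteq> p" and a: "x (x (x a)) \<noteq> a"
  shows "\<exists>k. y \<circ> x ^^ k = id"
proof -
  have comm: "y (x q) = x (y q)" for q using lc_commute'[OF lc x y] by (metis comp_apply)
  have pow: "x ^^ k \<in> carrier G" for k using lc_funpow[OF lc_refl[OF x] x x] by blast
  have orb: "x q \<noteq> q \<and> x (x (x q)) = q" if "x (x q) \<noteq> q" for q using short[of q] that by auto
  have d3: "distinct [q, x q, x (x q)]" if "x (x q) \<noteq> q" for q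
    using orb[OF that] that inj_perm[OF x] by auto
  have a2: "x (x a) = a" "x a \<noteq> a" using short[of a] a by auto
  have p3: "x (x (x p)) = p" using orb[OF p] by simp
  have in3: "{q, x q, x (x q)} \<subseteq> {1..n}" if "x (x q) \<noteq> q" for q
    using moved_in[OF x] orb[OF that] image_in[OF x] by blast
  have ina: "{a, x a} \<subseteq> {1..n}" using moved_in[OF x a2(2)] image_in[OF x] by blast
  have apart: "{a, x a} \<inter> {q, x q, x (x q)} = {}" if "x (x q) \<noteq> q" for q
    using a2 orb[OF that] that by auto
  have only: "q \<in> {p, x p, x (x p)}" if q: "x (x q) \<noteq> q" for q
  proof (rule ccontr)
    assume no: "q \<notin> {p, x p, x (x p)}"
    have "{q, x q, x (x q)} \<inter> {p, x p, x (x p)} = {}"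
    proof (rule ccontr)
      assume "{q, x q, x (x q)} \<inter> {p, x p, x (x p)} \<noteq> {}"
      then obtain r where r: "r \<in> {q, x q, x (x q)}" "r \<in> {p, x p, x (x p)}" by blast
      have "q \<in> {r, x r, x (x r)}" using r(1) orb[OF q] by auto
      moreover have "x r \<in> {p, x p, x (x p)}" "x (x r) \<in> {p, x p, x (x p)}" using r(2) p3 by auto
      ultimately show False using no r(2) by blast
    qed
    then have "distinct [p, x p, x (x p), q, x q, x (x q), x a, a]"
      using d3[OF p] d3[OF q] apart[OF p] apart[OF q] a2(2) by simp
    moreover have "set [p, x p, x (x p), q, x q, x (x q), x a, a] \<subseteq> {1..n}"
      using in3[OF p] in3[OF q] ina by simp
    ultimately have "8 \<le> n" using distinct_length_le[of "[p, x p, x (x p), q, x q, x (x q), x a, a]" n] by simp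
    then show False using n7 by simp
  qed
  have "x (x (y p)) \<noteq> y p" using p comm inj_perm[OF y] by metis
  then have "y p \<in> {p, x p, x (x p)}" by (rule only)
  then obtain k where k: "(x ^^ k) (y p) = p"
  proof -
    assume "y p \<in> {p, x p, x (x p)}"
    then consider "y p = p" | "y p = x p" | "y p = x (x p)" by blast
    then show ?thesis
    proof cases
      case 1
      then show ?thesis using that[of 0] by simp
    next
      case 2
      then show ?thesis using that[of 2] p3 by (simp add: numeral_eq_Suc)
    next
      case 3
      then show ?thesis using that[of 1] p3 by simp
    qed
  qed
  define v where "v = y \<circ> x ^^ k"
  have v: "v \<in> carrier G" unfolding v_def using y pow by (rule comp_closed)
  have lcxv: "lc x v"
    unfolding v_def using lc_mult[OF lc _ x y pow, of k] lc_funpow[OF lc_refl[OF x] x x] by (simp only: mult_eq)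
  have vx: "v (x q) = x (v q)" for q using lc_commute'[OF lcxv x v] by (metis comp_apply)
  have vp: "v p = p" using k funpow_commute[of y x, OF comm] unfolding v_def by simp
  have vP: "v q = q" if "q \<in> {p, x p, x (x p)}" for q using that vp vx by auto
  define i where "i = x ^^ 3"
  have i: "i \<in> carrier G" unfolding i_def by (rule pow)
  have iq: "i q = x (x (x q))" for q unfolding i_def by (rule funpow_3)
  have iP: "i q = q" if "q \<in> {p, x p, x (x p)}" for q using that p3 unfolding iq by auto
  have ix: "i q = x q" if "q \<notin> {p, x p, x (x p)}" for q using only that unfolding iq by metis
  have isq: "i (i q) = q" for q using short[of q] unfolding iq by metis
  have ia: "i a \<noteq> a" using a2 unfolding iq by simp
  have lciv: "lc i v" unfolding i_def using lc_funpow[OF lc_sym[OF lcxv] v x] lc_sym by blast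
  have concl_i: ?thesis if "v = i"
  proof -
    have "y \<circ> x ^^ (k + 3) = i \<circ> i" using that unfolding v_def i_def funpow_add by (simp add: comp_assoc[symmetric])
    also have "i \<circ> i = id" using isq by auto
    finally show ?thesis by blast
  qed
  have concl_id: ?thesis if "v = id" using that unfolding v_def by blast
  have iax: "i a = x a" using a2 iq by simp
  consider (small) "n \<le> 5" "i = transpose a (i a)"
    | (large) d where "distinct [a, i a, d, i d]" "i = transpose a (i a) \<circ> transpose d (i d)"
    using involution_cases[OF n7 parity i isq ia] by blast
  then show ?thesis
  proof cases
    case small
    have d5: "distinct [p, x p, x (x p), x a, a]" using d3[OF p] apart[OF p] a2(2) by simp
    have sub5: "set [p, x p, x (x p), x a, a] \<subseteq> {1..n}" using in3[OF p] ina by simp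
    have "{1..n} = set [p, x p, x (x p), x a, a]"
      using card_subset_eq[OF _ sub5] distinct_card[OF d5] card_mono[OF _ sub5] small(1) by simp
    then have out: "v q = q" if "q \<notin> {a, x a}" for q
      using that vP moved_in[OF v, of q] by auto
    have "v a \<in> {a, x a}"
    proof (rule ccontr)
      assume "v a \<notin> {a, x a}"
      then have "v (v a) = v a" using out by blast
      then show False using inj_perm[OF v] \<open>v a \<notin> {a, x a}\<close> by auto
    qed
    then consider "v a = a" | "v a = x a" by blast
    then show ?thesis
    proof cases
      case 1
      then have "v (x a) = x a" using vx by simp
      then have "v q = q" for q using 1 out[of q] by blast
      then have "v = id" by auto
      then show ?thesis by (rule concl_id)
    next
      case 2
      then have "v (x a) = a" using vx a2 by simp
      then have "v = transpose a (x a)" using 2 out by (intro transpose_eq)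
      then have "v = i" using small(2) iax by simp
      then show ?thesis by (rule concl_i)
    qed
  next
    case large
    have dnot: "d \<notin> {p, x p, x (x p)}" "i d \<notin> {p, x p, x (x p)}"
      using iP large(1) isq by (metis distinct_length_2_or_more)+
    have anot: "a \<notin> {p, x p, x (x p)}" "i a \<notin> {p, x p, x (x p)}"
      using iP large(1) isq by (metis distinct_length_2_or_more)+
    have d7: "distinct [a, i a, d, i d, p, x p, x (x p)]" using large(1) d3[OF p] dnot anot by auto
    have "i d \<noteq> d" using large(1) by auto
    then have sub7: "set [a, i a, d, i d, p, x p, x (x p)] \<subseteq> {1..n}"
      using in3[OF p] moved_in[OF i ia] moved_in[OF i] image_in[OF i] by simp
    have "7 \<le> n" using distinct_length_le[OF d7 sub7] by simp
    then have even: "evenperm v" using parity v by auto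
    have "{1..n} = set [a, i a, d, i d, p, x p, x (x p)]"
      using card_subset_eq[OF _ sub7] distinct_card[OF d7] card_mono[OF _ sub7] n7 by simp
    then have "v q = q" if "q \<notin> {a, i a, d, i d}" for q
      using that vP moved_in[OF v, of q] by auto
    then have perm: "v permutes {a, i a, d, i d}"
      using permutes_superset[OF permutes[OF v]] by blast
    have "v (i q) = i (v q)" for q unfolding iq vx ..
    from klein_centralizer[OF large(2,1) perm even this]
    have "v \<circ> v = id"
    proof (elim disjE)
      assume "v = i"
      then show ?thesis using isq by auto
    next
      assume *: "v = transpose a d \<circ> transpose (i a) (i d)"
      show ?thesis unfolding * by (rule double_transpose_involution) (use large(1) in auto)
    next
      assume *: "v = transpose a (i d) \<circ> transpose (i a) d"
      show ?thesis unfolding * by (rule double_transpose_involution) (use large(1) in auto)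
    qed simp
    moreover have "i \<circ> i = id" using isq by auto
    moreover have "i \<noteq> id" using ia by auto
    ultimately have "v = id \<or> v = i" using involutions[OF i v] lciv by blast
    then show ?thesis using concl_i concl_id by blast
  qed
qed

text \<open>By \<open>order3_orbit\<close>, a power of \<open>x\<close> turns \<open>y\<close> into
  some \<open>v\<close> fixing \<open>a\<close>. If \<open>v\<close> moved a point \<open>b\<close>,
  a power of \<open>v\<close> would turn \<open>x\<close> into some \<open>w\<close> fixing
  \<open>b\<close>; then \<open>v\<close> and \<open>w\<close> would be disjoint 3-cycles with
  commuting lifts, against \<open>three_cycles\<close>.\<close>

lemma order3_centralizer:
  assumes x: "x \<in> carrier G" and y: "y \<in> carrier G" and lc: "lc x y"
    and x3: "\<And>q. x (x (x q)) = q" and y3: "\<And>q. y (y (y q)) = q" and a: "x a \<noteq> a"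
  shows "\<exists>k. y \<circ> x ^^ k = id"
proof -
  have comm: "y (x q) = x (y q)" for q using lc_commute'[OF lc x y] by (metis comp_apply)
  have pow: "x ^^ k \<in> carrier G" for k using lc_funpow[OF lc_refl[OF x] x x] by blast
  obtain k where k: "(x ^^ k) (y a) = a"
  proof -
    assume "\<And>k. (x ^^ k) (y a) = a \<Longrightarrow> thesis"
    note that = this
    from order3_orbit[OF permutes[OF x] permutes[OF y] n7 x3 y3 comm a]
    consider "y a = a" | "y a = x a" | "y a = x (x a)" by blast
    then show thesis
    proof cases
      case 1
      then show ?thesis using that[of 0] by simp
    next
      case 2
      then show ?thesis using that[of 2] x3 by (simp add: numeral_eq_Suc)
    next
      case 3
      then show ?thesis using that[of 1] x3 by simp
    qed
  qed
  define v where "v = y \<circ> x ^^ k"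
  have v: "v \<in> carrier G" unfolding v_def using y pow by (rule comp_closed)
  have lcxv: "lc x v"
    unfolding v_def using lc_mult[OF lc _ x y pow, of k] lc_funpow[OF lc_refl[OF x] x x] by (simp only: mult_eq)
  have vx: "v (x q) = x (v q)" for q using lc_commute'[OF lcxv x v] by (metis comp_apply)
  have va: "v a = a" using k funpow_commute[of y x, OF comm] unfolding v_def by simp
  have xpow3: "(x ^^ k) ((x ^^ k) ((x ^^ k) q)) = q" for q
  proof -
    have "(x ^^ k) ((x ^^ k) ((x ^^ k) q)) = (x ^^ (3 * k)) q"
    proof -
      have "3 * k = k + (k + k)" by simp
      then show ?thesis by (simp only: funpow_add comp_apply)
    qed
    also have "x ^^ (3 * k) = (x ^^ 3) ^^ k" by (rule funpow_mult[symmetric])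
    also have "x ^^ 3 = id" using x3 by (auto simp: funpow_3)
    also have "(id ^^ k) q = q" by (induction k) simp_all
    finally show ?thesis .
  qed
  have v3: "v (v (v q)) = q" for q
    unfolding v_def comp_apply using funpow_commute[of y x, OF comm] xpow3 y3 by simp
  have "v = id"
  proof (rule ccontr)
    assume "v \<noteq> id"
    then obtain b where b: "v b \<noteq> b" by (auto simp: fun_eq_iff)
    obtain l where l: "(v ^^ l) (x b) = b"
    proof -
      assume "\<And>k. (v ^^ k) (x b) = b \<Longrightarrow> thesis"
      note that = this
      from order3_orbit[OF permutes[OF v] permutes[OF x] n7 v3 x3 vx[symmetric] b]
      consider "x b = b" | "x b = v b" | "x b = v (v b)" by blast
      then show thesis
      proof cases
        case 1
        then show ?thesis using that[of 0] by simp
      next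
        case 2
        then show ?thesis using that[of 2] v3 by (simp add: numeral_eq_Suc)
      next
        case 3
        then show ?thesis using that[of 1] v3 by simp
      qed
    qed
    define w where "w = x \<circ> v ^^ l"
    have vl: "v ^^ l \<in> carrier G" using lc_funpow[OF lc_refl[OF v] v v] by blast
    have w: "w \<in> carrier G" unfolding w_def using x vl by (rule comp_closed)
    have lcvw: "lc v w"
      unfolding w_def using lc_mult[OF lc_sym[OF lcxv] _ v x vl] lc_funpow[OF lc_refl[OF v] v v] by (simp only: mult_eq)
    have wv: "w (v q) = v (w q)" for q using lc_commute'[OF lcvw v w] by (metis comp_apply)
    have wb: "w b = b" using l funpow_commute[of x v, OF vx[symmetric]] unfolding w_def by simp
    define A B where "A = {a, x a, x (x a)}" and "B = {b, v b, v (v b)}"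
    have vA: "v q = q" if "q \<in> A" for q using that va vx unfolding A_def by auto
    have wB: "w q = q" if "q \<in> B" for q using that wb wv unfolding B_def by auto
    have vB: "v q \<noteq> q" if "q \<in> B" for q using that b inj_perm[OF v] unfolding B_def by auto
    have AB: "A \<inter> B = {}" using vA vB by blast
    have wA: "w q = x q" if "q \<in> A" for q
    proof -
      have "(v ^^ l) q = q" using vA[OF that] by (induction l) simp_all
      then show ?thesis by (simp add: w_def)
    qed
    have dA: "distinct [a, x a, x (x a)]"
    proof -
      have "x (x a) \<noteq> x a" "x (x a) \<noteq> a" using x3 a by metis+
      then show ?thesis using a by auto
    qed
    have dB: "distinct [b, v b, v (v b)]"
    proof -
      have "v (v b) \<noteq> v b" "v (v b) \<noteq> b" using v3 b by metis+
      then show ?thesis using b by auto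
    qed
    have d6: "distinct [b, v b, v (v b), a, x a, x (x a)]" using dA dB AB unfolding A_def B_def by auto
    have sub6: "set [b, v b, v (v b), a, x a, x (x a)] \<subseteq> {1..n}"
      using moved_in[OF x a] moved_in[OF v b] image_in[OF x] image_in[OF v] by simp
    \<comment> \<open>At most one of the 7 points lies outside the two cycles, so it has nowhere to
      go.\<close>
    have fixed: "g q = q" if g: "g \<in> carrier G" "\<And>q. q \<in> A \<union> B \<Longrightarrow> g q \<in> A \<union> B" and q: "q \<notin> A \<union> B" for g q
    proof (rule ccontr)
      assume gq: "g q \<noteq> q"
      have gAB: "g ` (A \<union> B) = A \<union> B"
        using g(2) inj_perm[OF g(1)] by (intro endo_inj_surj) (auto simp: A_def B_def inj_on_def)
      have "g q \<notin> A \<union> B"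
      proof
        assume "g q \<in> A \<union> B"
        then obtain r where "r \<in> A \<union> B" "g q = g r" using gAB by blast
        then show False using inj_perm[OF g(1)] q by auto
      qed
      then have "distinct [g q, q, b, v b, v (v b), a, x a, x (x a)]"
        using d6 q gq unfolding A_def B_def by auto
      moreover have "set [g q, q, b, v b, v (v b), a, x a, x (x a)] \<subseteq> {1..n}"
        using sub6 moved_in[OF g(1) gq] image_in[OF g(1)] by simp
      ultimately have "8 \<le> n" using distinct_length_le[of "[g q, q, b, v b, v (v b), a, x a, x (x a)]" n] by simp
      then show False using n7 by simp
    qed
    have vAB: "v q \<in> A \<union> B" if "q \<in> A \<union> B" for q
    proof (cases "q \<in> A")
      case False
      then show ?thesis using that v3 unfolding B_def by auto
    qed (use vA in simp)
    have wAB: "w q \<in> A \<union> B" if "q \<in> A \<union> B" for q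
    proof (cases "q \<in> A")
      case True
      then show ?thesis using wA x3 unfolding A_def by auto
    next
      case False
      then show ?thesis using that wB by auto
    qed
    have "v q = q" if "q \<notin> {b, v b, v (v b)}" for q
      using that vA fixed[OF v vAB] unfolding B_def[symmetric] by blast
    then have vc: "v = cyc b (v b) (v (v b))" by (rule cyc_eq[OF dB refl refl v3])
    have "w q = q" if "q \<notin> {a, x a, x (x a)}" for q
      using that wB fixed[OF w wAB] unfolding A_def[symmetric] by blast
    moreover have "w a = x a" "w (x a) = x (x a)" "w (x (x a)) = a" using wA x3 by (auto simp: A_def)
    ultimately have wc: "w = cyc a (x a) (x (x a))" using cyc_eq[OF dA] by blast
    have "\<not> lc (cyc b (v b) (v (v b))) (cyc a (x a) (x (x a)))"
      by (rule three_cycles[OF d6]) (use sub6 in simp)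
    then show False using lcvw vc wc by metis
  qed
  then show ?thesis unfolding v_def by blast
qed

lemma involution_support:
  assumes x: "x \<in> carrier G" and sq: "\<And>q. x (x q) = q" and a: "x a \<noteq> a"
  shows "card {q. x q \<noteq> q} \<le> 4" "finite {q. x q \<noteq> q}" "card {q \<in> {1..n}. x q = q} \<le> 3"
proof -
  obtain S where S: "{q. x q \<noteq> q} = S" "card S \<le> 4" "n - card S \<le> 3" "finite S" "S \<subseteq> {1..n}"
  proof -
    assume that: "\<And>S. {q. x q \<noteq> q} = S \<Longrightarrow> card S \<le> 4 \<Longrightarrow> n - card S \<le> 3 \<Longrightarrow> finite S \<Longrightarrow> S \<subseteq> {1..n} \<Longrightarrow> thesis"
    have sub: "{q. x q \<noteq> q} \<subseteq> {1..n}" using moved_in[OF x] by blast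
    from involution_cases[OF n7 parity x sq a]
    consider "n \<le> 5" "x = transpose a (x a)"
      | c where "distinct [a, x a, c, x c]" "x = transpose a (x a) \<circ> transpose c (x c)"
      by blast
    then show thesis
    proof cases
      case 1
      have "x q = q" if "q \<notin> {a, x a}" for q
        using fun_cong[OF 1(2), of q] that by simp
      moreover have "x (x a) \<noteq> x a" using sq a by metis
      ultimately have eq: "{q. x q \<noteq> q} = {a, x a}" using a by blast
      show ?thesis by (rule that[OF eq]) (use a 1(1) sub eq in auto)
    next
      case 2
      have "x q = q" if "q \<notin> {a, x a, c, x c}" for q
        using fun_cong[OF 2(2), of q] that by simp
      moreover have "x c \<noteq> c" using 2(1) by auto
      moreover have "x (x a) \<noteq> x a" "x (x c) \<noteq> x c" using sq a \<open>x c \<noteq> c\<close> by metis+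
      ultimately have eq: "{q. x q \<noteq> q} = {a, x a, c, x c}" using a by blast
      have "card {a, x a, c, x c} = 4" using 2(1) by simp
      then show ?thesis by (intro that[OF eq]) (use n7 sub eq in auto)
    qed
  qed
  then show "card {q. x q \<noteq> q} \<le> 4" "finite {q. x q \<noteq> q}" by simp_all
  have "{q \<in> {1..n}. x q = q} = {1..n} - S" using S(1) by blast
  then show "card {q \<in> {1..n}. x q = q} \<le> 3" using S(3-5) by (simp add: card_Diff_subset)
qed

text \<open>A 3-cycle of \<open>y\<close> through a point moved by \<open>x\<close> is disjoint from
  its image under \<open>x\<close>, as an involution cannot act on it like a power of
  \<open>y\<close>. This takes 6 moved points, but an involution here moves at most 4.\<close>

lemma order3_fixes_involution_support:
  assumes x: "x \<in> carrier G" and y: "y \<in> carrier G" and sq: "\<And>q. x (x q) = q" and y3: "\<And>q. y (y (y q)) = q"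
    and comm: "\<And>q. y (x q) = x (y q)" and q: "x q \<noteq> q"
  shows "y q = q"
proof (rule ccontr)
  assume yq: "y q \<noteq> q"
  define Y where "Y = {q, y q, y (y q)}"
  have dY: "distinct [q, y q, y (y q)]"
  proof -
    have "y (y q) \<noteq> y q" "y (y q) \<noteq> q" using y3 yq by metis+
    then show ?thesis using yq by auto
  qed
  have yY: "r \<in> Y" if "y r \<in> Y" for r
  proof -
    have "y (y s) \<in> Y" if "s \<in> Y" for s using that y3 unfolding Y_def by auto
    then show ?thesis using that y3[of r] by metis
  qed
  have "x q \<notin> Y"
  proof
    assume "x q \<in> Y"
    then consider "x q = y q" | "x q = y (y q)" using q unfolding Y_def by blast
    then show False
    proof cases
      case 1
      then have "q = y (y q)" using sq[of q] comm[of q] by simp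
      then show False using dY by auto
    next
      case 2
      then have "q = y (y (y (y q)))" using sq[of q] comm by metis
      then show False using y3 yq by metis
    qed
  qed
  then have "x (y q) \<notin> Y" "x (y (y q)) \<notin> Y" using yY comm by metis+
  then have d6: "distinct [x q, x (y q), x (y (y q)), q, y q, y (y q)]"
    using \<open>x q \<notin> Y\<close> dY inj_perm[OF x] unfolding Y_def by auto
  have "x (y q) \<noteq> y q" "x (y (y q)) \<noteq> y (y q)" using q comm inj_perm[OF y] by metis+
  then have sub: "{x q, x (y q), x (y (y q)), q, y q, y (y q)} \<subseteq> {q. x q \<noteq> q}"
    using q inj_perm[OF x] by auto
  have "card {x q, x (y q), x (y (y q)), q, y q, y (y q)} = 6" using distinct_card[OF d6] by simp
  then have "6 \<le> card {q. x q \<noteq> q}"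
    using card_mono[OF involution_support(2)[OF x sq q] sub] by simp
  then show False using involution_support(1)[OF x sq q] by simp
qed

text \<open>The identity is adjacent to everything, so it comes last. Order 3 must outrank order 2:
  in A_7 the cycle (1 2 3) is adjacent to the three involutions on {4, 5, 6, 7}, which are pairwise
  nonadjacent.\<close>

definition rank :: "(nat \<Rightarrow> nat) \<Rightarrow> nat" where
  "rank x = (if x = id then 3 else if \<forall>q. x (x (x q)) = q then 2 else if \<forall>q. x (x q) = q then 1 else 0)"

text \<open>Usually \<open>y\<close> turns out to be a power of \<open>x\<close>, and its lifts then
  commute with those of \<open>z\<close>. The main exception is an involution \<open>x\<close> with
  neighbours of order 3: these live on the at most 3 fixed points of \<open>x\<close>, hence
  generate the same group.\<close>

lemma lc_transitive:
  assumes x: "x \<in> carrier G" and y: "y \<in> carrier G" and z: "z \<in> carrier G" and lcy: "lc x y" and lcz: "lc x z"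
    and ne: "x \<noteq> id" and ry: "rank x \<le> rank y" and rz: "rank x \<le> rank z"
  shows "lc y z"
proof -
  have commy: "y (x q) = x (y q)" for q using lc_commute'[OF lcy x y] by (metis comp_apply)
  have commz: "z (x q) = x (z q)" for q using lc_commute'[OF lcz x z] by (metis comp_apply)
  have power: "lc y z" if "y \<circ> x ^^ k = id" for k
    using lc_sym[OF lc_inverse_pow[OF lc_sym[OF lcz] x y z that]] .
  have idl: "lc g id" "lc id g" if "g \<in> carrier G" for g
    using lc_one[OF that] lc_sym by (simp_all only: one_eq)
  obtain a where a: "x a \<noteq> a" using ne by (auto simp: fun_eq_iff)
  consider "\<forall>q. x (x (x q)) = q" | "\<not> (\<forall>q. x (x (x q)) = q)" "\<forall>q. x (x q) = q"
    | "\<not> (\<forall>q. x (x (x q)) = q)" "\<not> (\<forall>q. x (x q) = q)" by blast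
  then show ?thesis
  proof cases
    case 1
    then have "2 \<le> rank y" using ry ne by (simp add: rank_def)
    then have "\<forall>q. y (y (y q)) = q" by (auto simp: rank_def split: if_splits)
    then obtain k where "y \<circ> x ^^ k = id" using order3_centralizer[OF x y lcy _ _ a] 1 by blast
    then show ?thesis by (rule power)
  next
    case 2
    then have "rank x = 1" using ne by (simp add: rank_def)
    then have "1 \<le> rank y" "1 \<le> rank z" using ry rz by simp_all
    then have cases: "(\<forall>q. y (y (y q)) = q) \<or> (\<forall>q. y (y q) = q)" "(\<forall>q. z (z (z q)) = q) \<or> (\<forall>q. z (z q) = q)"
      by (auto simp: rank_def split: if_splits)
    have inv: "g = id \<or> g = x" if "g \<in> carrier G" "lc x g" "\<forall>q. g (g q) = q" for g
    proof -
      have "x \<circ> x = id" "g \<circ> g = id" using 2 that by auto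
      then show ?thesis using involutions[OF x that(1)] ne that(2) by blast
    qed
    show ?thesis
    proof (cases "y \<in> {id, x} \<or> z \<in> {id, x}")
      case True
      then show ?thesis using idl y z lcy lcz lc_sym by auto
    next
      case False
      then have y3: "y (y (y q)) = q" and z3: "z (z (z q)) = q" for q
        using cases inv[OF y lcy] inv[OF z lcz] by blast+
      let ?F = "{q \<in> {1..n}. x q = q}"
      have fixed: "g q = q" if "g \<in> carrier G" "\<And>q. g (g (g q)) = q" "\<And>q. g (x q) = x (g q)" "q \<notin> ?F" for g q
        using order3_fixes_involution_support[OF x that(1) _ that(2,3)] 2 that(4) moved_in[OF that(1)] by blast
      have "z = y \<or> z = y \<circ> y"
        by (rule order3_on_three_points[of ?F])
           (use involution_support(3)[OF x _ a] 2 y3 z3 fixed[OF y y3 commy] fixed[OF z z3 commz] False in auto)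
      moreover have "lc y (y \<circ> y)" using lc_mult[OF lc_refl[OF y] lc_refl[OF y] y y y] by (simp only: mult_eq)
      ultimately show ?thesis using lc_refl[OF y] by auto
    qed
  next
    case 3
    show ?thesis
    proof (cases "\<exists>p. inj_on (\<lambda>i. (x ^^ i) p) {..<4}")
      case True
      then show ?thesis using long_orbit_centralizer[OF n7 parity x y commy] power by blast
    next
      case False
      have short: "x q = q \<or> x (x q) = q \<or> x (x (x q)) = q" for q
      proof (rule ccontr)
        assume no: "\<not> ?thesis"
        then have "q \<noteq> x q" "q \<noteq> x (x q)" "q \<noteq> x (x (x q))" by metis+
        then have "distinct [q, x q, x (x q), x (x (x q))]"
          by (simp add: inj_perm[OF x])
        then have "distinct (map (\<lambda>i. (x ^^ i) q) [0, 1, 2, 3])"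
          by (simp add: funpow_3 numeral_2_eq_2)
        then have inj: "inj_on (\<lambda>i. (x ^^ i) q) (set [0, 1, 2, 3])" by (simp only: distinct_map)
        have set4: "set [0, 1, 2, 3] = {..<4::nat}" by auto
        have "inj_on (\<lambda>i. (x ^^ i) q) {..<4}" using inj unfolding set4 .
        then show False using False by blast
      qed
      obtain p b where "x (x p) \<noteq> p" "x (x (x b)) \<noteq> b" using 3 by blast
      then show ?thesis using short_orbits_centralizer[OF x y lcy short] power by blast
    qed
  qed
qed

lemma perfect: "perfect_graph (carrier G) (deep_adj H \<pi>)"
proof (rule perfect_graph_if_simplicial[where r = rank])
  show "finite (carrier G)" by (rule finite_carrier)
  show "deep_adj H \<pi> y x" if "deep_adj H \<pi> x y" for x y using deep_adj_sym that .
  fix x y z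
  assume mem: "x \<in> carrier G" "y \<in> carrier G" "z \<in> carrier G" and adj: "deep_adj H \<pi> x y" "deep_adj H \<pi> x z"
    and r: "rank x \<le> rank y" "rank x \<le> rank z" and ne: "x \<noteq> y" "y \<noteq> z"
  have "x \<noteq> id"
  proof
    assume "x = id"
    then have "y = id" using r(1) by (auto simp: rank_def split: if_splits)
    then show False using ne \<open>x = id\<close> by simp
  qed
  then show "deep_adj H \<pi> y z"
    using lc_transitive[OF mem] adj r ne by (simp add: deep_adj_iff)
qed

end

end

section \<open>Covers of small degree\<close>

text \<open>Commuting lifts X, Y in the spin cover would satisfy (XY)^2 = X^2 Y^2 = (-1)(-1) = 1.
  But \<open>x \<circ> y\<close> is again an involution, so the left side is -1.\<close>

lemma cover_involutions_alt:
  assumes cover: "schur_cover H (alt_group n) \<pi>" and n: "5 \<le> n" "n \<le> 7"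
    and x: "x \<in> carrier (alt_group n)" "x \<circ> x = id" "x \<noteq> id"
    and y: "y \<in> carrier (alt_group n)" "y \<circ> y = id" "y \<noteq> id" and "x \<noteq> y"
  shows "\<not> lifts_commute H \<pi> x y"
proof
  assume "lifts_commute H \<pi> x y"
  let ?E = "spin_group (alt_group n)"
  interpret P: perm_group "alt_group n" n by (rule perm_group_alt)
  have n8: "n \<le> 8" using n by simp
  interpret E: central_extension ?E "alt_group n" fst by (rule P.central_extension_spin_group[OF n8])
  interpret perm_extension ?E "alt_group n" fst n by unfold_locales
  have lc: "E.lc x y"
    by (rule schur_cover_dominates[OF cover derived_alt_group_const[OF n(1)] E.central_extension_axioms
          P.finite_spin_group[OF n8] \<open>lifts_commute H \<pi> x y\<close> x(1) y(1)])
  have even: "\<forall>g \<in> carrier (alt_group n). evenperm g" by (simp add: alt_group_carrier)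
  have sq: "s \<otimes>\<^bsub>?E\<^esub> s = (id, uminus)" if s: "s \<in> carrier ?E" "fst s \<circ> fst s = id" "fst s \<noteq> id" for s
  proof -
    have g: "fst s \<in> carrier (alt_group n)" using s(1) by simp
    have inv: "fst s (fst s q) = q" for q using fun_cong[OF s(2), of q] by simp
    obtain a where a: "fst s a \<noteq> a" using s(3) by (auto simp: fun_eq_iff)
    from involution_cases[OF n(2) disjI2[OF even] g inv a]
    obtain c where c: "distinct [a, fst s a, c, fst s c]" "fst s = transpose a (fst s a) \<circ> transpose c (fst s c)"
      using even g odd_transpose[of a "fst s a"] a by metis
    have "fst s c \<noteq> c" using c(1) by auto
    then have "{a, fst s a, c, fst s c} \<subseteq> {1..n}"
      using moved_in[OF g] image_in[OF g] a by simp
    then have "{a, fst s a, c, fst s c} \<subseteq> {1..8}" using n8 by auto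
    then show ?thesis using P.spin_double_transp_sq[OF n8 _ c(1) s(1) c(2)] by blast
  qed
  obtain X Y where XY: "X \<in> carrier ?E" "fst X = x" "Y \<in> carrier ?E" "fst Y = y"
    using E.lift x(1) y(1) by metis
  have comm: "X \<otimes>\<^bsub>?E\<^esub> Y = Y \<otimes>\<^bsub>?E\<^esub> X" using E.lcD[of X Y] lc XY by simp
  have xy: "x \<circ> y = y \<circ> x" using E.lc_commute[OF lc x(1) y(1)] by (simp only: alt_group_mult)
  have fXY: "fst (X \<otimes>\<^bsub>?E\<^esub> Y) = x \<circ> y" using XY by (simp add: alt_group_mult)
  have "(x \<circ> y) \<circ> (x \<circ> y) = id"
    using x(2) y(2) xy by (metis comp_assoc comp_id)
  moreover have "x \<circ> y \<noteq> id"
  proof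
    assume "x \<circ> y = id"
    then have "x \<circ> (x \<circ> y) = x" by simp
    then show False using x(2) \<open>x \<noteq> y\<close> by (metis comp_assoc id_comp)
  qed
  ultimately have "(X \<otimes>\<^bsub>?E\<^esub> Y) \<otimes>\<^bsub>?E\<^esub> (X \<otimes>\<^bsub>?E\<^esub> Y) = (id, uminus)"
    using XY fXY by (intro sq) simp_all
  moreover have "(X \<otimes>\<^bsub>?E\<^esub> Y) \<otimes>\<^bsub>?E\<^esub> (X \<otimes>\<^bsub>?E\<^esub> Y) = (X \<otimes>\<^bsub>?E\<^esub> X) \<otimes>\<^bsub>?E\<^esub> (Y \<otimes>\<^bsub>?E\<^esub> Y)"
    using XY(1,3) comm by (metis E.H.m_assoc E.H.m_closed)
  moreover have "X \<otimes>\<^bsub>?E\<^esub> X = (id, uminus)" "Y \<otimes>\<^bsub>?E\<^esub> Y = (id, uminus)"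
    using XY x y by (auto intro!: sq)
  ultimately have "(id, uminus) \<otimes>\<^bsub>?E\<^esub> (id, uminus) = ((id, uminus) :: _ \<times> (clifford \<Rightarrow> clifford))" by simp
  then have "uminus \<circ> uminus = (uminus :: clifford \<Rightarrow> clifford)" by (simp add: spin_group_def)
  moreover have "uminus \<circ> uminus = (id :: clifford \<Rightarrow> clifford)" by auto
  ultimately show False using spin_group_uminus_neq_one by simp
qed

lemma cover_three_cycles_alt:
  assumes cover: "schur_cover H (alt_group n) \<pi>" and n: "n \<le> 7"
    and dist: "distinct [a, b, c, d, e, f]" and sub: "{a, b, c, d, e, f} \<subseteq> {1..n}"
  shows "\<not> lifts_commute H \<pi> (cyc a b c) (cyc d e f)"
proof
  assume lc: "lifts_commute H \<pi> (cyc a b c) (cyc d e f)"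
  have n6: "6 \<le> n" using distinct_length_le[OF dist, of n] sub by simp
  interpret central_extension H "alt_group n" \<pi> by (rule schur_cover_central_extension[OF cover])
  interpret perm_group "alt_group n" n by (rule perm_group_alt)
  interpret perm_extension H "alt_group n" \<pi> n by unfold_locales
  have mem: "cyc a b c \<in> carrier (alt_group n)" "cyc d e f \<in> carrier (alt_group n)"
    using dist sub by (auto intro!: cyc_in_alt_group)
  have mem6: "cyc a b c \<in> carrier (alt_group n)" if "distinct [a, b, c]" "{a, b, c} \<subseteq> {1..6}" for a b c
    using that n6 by (intro cyc_in_alt_group) auto
  have conj: "lc (cyc (g a) (g b) (g c)) (cyc (g d) (g e) (g f))" if g: "g \<in> carrier (alt_group n)" for g
  proof -
    have "bij g" using permutes_bij[OF permutes[OF g]] .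
    then show ?thesis
      using lc_conj[OF lc mem g] cyc_conj[of g a b c] cyc_conj[of g d e f] dist m_inv_eq[OF g]
      by (simp add: alt_group_mult)
  qed
  obtain p where p: "p permutes {1..n}" "map p [a, b, c, d, e, f] = [1, 2, 3, 4, 5, 6]"
    using ex_permutes_map[OF dist, of "[1, 2, 3, 4, 5, 6]" "{1..n}"] sub n6 by auto
  have lc123: "lc (cyc 1 2 3) (cyc 4 5 6)"
  proof (cases "evenperm p")
    case True
    then show ?thesis using conj[of p] p by (simp add: alt_group_carrier)
  next
    case False
    \<comment> \<open>An odd \<open>p\<close> is corrected by (4 5), which replaces (4 5 6) by its
      inverse (5 4 6); squaring that restores (4 5 6).\<close>
    let ?g = "transpose 4 5 \<circ> p"
    have "?g permutes {1..n}" using n6 by (intro permutes_compose[OF p(1)] permutes_swap_id) auto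
    moreover have "evenperm ?g"
      using False p(1) permutation_permutes by (subst evenperm_comp) (auto simp: permutation_swap_id evenperm_swap)
    ultimately have lc546: "lc (cyc 1 2 3) (cyc 5 4 6)" using conj[of ?g] p(2) by (simp add: alt_group_carrier)
    have m: "cyc 1 2 3 \<in> carrier (alt_group n)" "cyc 5 4 6 \<in> carrier (alt_group n)"
      by (rule mem6; simp)+
    have "lc (cyc 1 2 3) (cyc 5 4 6 \<circ> cyc 5 4 6)"
      using lc_mult[OF lc546 lc546 m(1) m(2) m(2)] by (simp only: alt_group_mult)
    then show ?thesis using cyc_inverse[of 5 4 6] cyc_rotate[of 4 5 6] by simp
  qed
  have n5: "5 \<le> n" using n6 by simp
  have "lifts_commute (voltage_group (alt_group n)) fst (cyc 1 2 3) (cyc 4 5 6)"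
    by (rule schur_cover_dominates[OF cover derived_alt_group_const[OF n5]
          central_extension_voltage_group[OF n] finite_voltage_group[OF n] lc123])
       (rule mem6; simp)+
  then show False using voltage_group_not_commute[OF n n6] by blast
qed

section \<open>Involutions in symmetric groups of degree at most 5\<close>

context perm_extension
begin

context
  assumes n5: "n \<le> 5" and symmetric: "G = sym_group n"
    and disjoint_transpositions: "\<And>a b c d. distinct [a, b, c, d] \<Longrightarrow> {a, b, c, d} \<subseteq> {1..n} \<Longrightarrow>
      \<not> lc (transpose a b) (transpose c d)"
begin

lemma no_six: "distinct [a, b, c, d, e, f] \<Longrightarrow> {a, b, c, d, e, f} \<subseteq> {1..n} \<Longrightarrow> False"
  using distinct_length_le[of "[a, b, c, d, e, f]" n] n5 by simp

lemma transpose_closed: "{a, b} \<subseteq> {1..n} \<Longrightarrow> transpose a b \<in> carrier G"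
  unfolding symmetric by (auto simp: sym_group_carrier intro: permutes_swap_id)

text \<open>\<open>y\<close> fixes \<open>a\<close> and \<open>x a\<close>, and the at most 3
  remaining points hold a single 2-cycle, so \<open>y\<close> is a transposition (c d). Then
  \<open>x\<close> or \<open>x \<circ> y\<close> is the disjoint transposition of \<open>a\<close>
  and \<open>x a\<close>, and its lifts commute with those of \<open>y\<close>.\<close>

lemma involutions_fixed_point:
  assumes x: "x \<in> carrier G" "\<And>q. x (x q) = q" and y: "y \<in> carrier G" "\<And>q. y (y q) = q" and lc: "lc x y"
    and a: "x a \<noteq> a" "y a = a" and c: "y c \<noteq> c"
  shows False
proof -
  have comm: "y (x q) = x (y q)" for q using lc_commute'[OF lc x(1) y(1)] by (metis comp_apply)
  define b d where "b = x a" and "d = y c"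
  have yb: "y b = b" unfolding b_def using comm a by simp
  have cab: "c \<notin> {a, b}" "d \<notin> {a, b}" "d \<noteq> c" using c a(2) yb y(2) unfolding d_def by auto
  have dist: "distinct [a, b, c, d]" using cab a unfolding b_def by auto
  have sub: "{a, b, c, d} \<subseteq> {1..n}"
    using moved_in[OF x(1) a(1)] moved_in[OF y(1) c] image_in[OF x(1)] image_in[OF y(1)]
    unfolding b_def d_def by simp
  have "y q = q" if "q \<notin> {c, d}" for q
  proof (rule ccontr)
    assume yq: "y q \<noteq> q"
    have "q \<notin> {a, b}" "y q \<notin> {a, b}" using yq a(2) yb y(2) by auto
    moreover have "y q \<notin> {c, d}" using that y(2) inj_perm[OF y(1), of q c] unfolding d_def by auto
    ultimately have "distinct [a, b, c, d, q, y q]" using dist that yq by auto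
    moreover have "{a, b, c, d, q, y q} \<subseteq> {1..n}"
      using sub moved_in[OF y(1) yq] image_in[OF y(1)] by simp
    ultimately show False by (rule no_six)
  qed
  then have yt: "y = transpose c d" using y(2) unfolding d_def by (intro transpose_eq) auto
  have xmoved: "q \<in> {a, b, c, d}" if "x q \<noteq> q" for q
  proof (rule ccontr)
    assume q: "q \<notin> {a, b, c, d}"
    have xab: "x q \<notin> {a, b}" using q x(2) inj_perm[OF x(1), of q a] unfolding b_def by auto
    have "y q = q" using yt q by simp
    then have "y (x q) = x q" using comm by simp
    then have "x q \<notin> {c, d}" using c y(2) unfolding d_def by auto
    then have "distinct [a, b, c, d, q, x q]" using dist q xab that by auto
    moreover have "{a, b, c, d, q, x q} \<subseteq> {1..n}"
      using sub moved_in[OF x(1) that] image_in[OF x(1)] by simp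
    ultimately show False by (rule no_six)
  qed
  have t: "transpose a b \<in> carrier G" using sub by (intro transpose_closed) simp
  show False
  proof (cases "x c = c")
    case True
    then have "x d = d" using comm[of c] unfolding d_def by simp
    then have "x = transpose a b"
      using True xmoved x(2) unfolding b_def by (intro transpose_eq) blast+
    then show False using disjoint_transpositions[OF dist sub] lc yt by simp
  next
    case False
    have "x c \<notin> {a, b}" using x(2) cab(1) unfolding b_def by (metis insert_iff singletonD)
    moreover have "x c \<in> {a, b, c, d}" using xmoved[of "x c"] False x(2) by metis
    ultimately have xc: "x c = d" using False by blast
    then have xd: "x d = c" using x(2) by metis
    have "x = transpose a b \<circ> transpose c d"
      using x(2) xc xd xmoved unfolding b_def
      by (intro double_transpose_eq) (use dist b_def in auto)
    then have "x \<circ> y = transpose a b" unfolding yt by (simp add: comp_assoc)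
    moreover have "lc y (x \<circ> y)"
      using lc_mult[OF lc_sym[OF lc] lc_refl[OF y(1)] y(1) x(1) y(1)] by (simp only: mult_eq)
    ultimately show False using disjoint_transpositions[OF dist sub] lc_sym yt by metis
  qed
qed

text \<open>If \<open>y\<close> or \<open>x \<circ> y\<close> fixes a point moved by
  \<open>x\<close>, then \<open>involutions_fixed_point\<close> applies. Otherwise x = (a b)(c d)
  and y = (a c)(b d). With t = (a b), the 4-cycle r = t y has square x, so the lifts of x commute
  with those of r and of r y = t, and the lifts of t with those of t x = (c d).\<close>

lemma cover_involutions_sym:
  assumes x: "x \<in> carrier G" "x \<circ> x = id" "x \<noteq> id" and y: "y \<in> carrier G" "y \<circ> y = id" "y \<noteq> id"
    and "x \<noteq> y"
  shows "\<not> lc x y"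
proof
  assume lc: "lc x y"
  have sqx: "x (x q) = q" for q using fun_cong[OF x(2), of q] by simp
  have sqy: "y (y q) = q" for q using fun_cong[OF y(2), of q] by simp
  have comm: "y (x q) = x (y q)" for q using lc_commute'[OF lc x(1) y(1)] by (metis comp_apply)
  obtain a where a: "x a \<noteq> a" using x(3) by (auto simp: fun_eq_iff)
  consider "y a = a" | "y a = x a" | "y a \<noteq> a" "y a \<noteq> x a" by blast
  then show False
  proof cases
    case 1
    obtain c where "y c \<noteq> c" using y(3) by (auto simp: fun_eq_iff)
    then show False using involutions_fixed_point[OF x(1) sqx y(1) sqy lc a 1] by blast
  next
    case 2
    have z: "x \<circ> y \<in> carrier G" using comp_closed x(1) y(1) by blast
    have sqz: "(x \<circ> y) ((x \<circ> y) q) = q" for q using comm sqx sqy by simp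
    have lcz: "lc x (x \<circ> y)"
      using lc_mult[OF lc_refl[OF x(1)] lc x(1) x(1) y(1)] by (simp only: mult_eq)
    have za: "(x \<circ> y) a = a" using 2 sqx by simp
    obtain c where "x c \<noteq> y c" using \<open>x \<noteq> y\<close> by (auto simp: fun_eq_iff)
    then have "(x \<circ> y) c \<noteq> c" using sqx by (metis comp_apply)
    then show False using involutions_fixed_point[OF x(1) sqx z sqz lcz a za] by blast
  next
    case 3
    define b c d where "b = x a" and "c = y a" and "d = x c"
    have xv: "x a = b" "x b = a" "x c = d" "x d = c" using sqx unfolding b_def c_def d_def by simp_all
    have yv: "y a = c" "y c = a" "y b = d" "y d = b" using sqx sqy comm unfolding b_def c_def d_def by simp_all
    have "c \<noteq> a" "c \<noteq> b" "b \<noteq> a" using 3 a unfolding b_def c_def by auto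
    moreover have "d \<noteq> a" "d \<noteq> b" "d \<noteq> c" using xv yv calculation by metis+
    ultimately have dist: "distinct [a, b, c, d]" "distinct [a, c, b, d]" by auto
    have sub: "{a, b, c, d} \<subseteq> {1..n}"
      using moved_in[OF x(1) a] image_in[OF x(1)] image_in[OF y(1)] unfolding b_def c_def d_def by simp
    have out: "g q = q" if g: "g \<in> carrier G" "\<And>q. g (g q) = q" "g ` {a, b, c, d} \<subseteq> {a, b, c, d}" and q: "q \<notin> {a, b, c, d}" for g q
    proof (rule ccontr)
      assume gq: "g q \<noteq> q"
      have "g q \<notin> {a, b, c, d}"
      proof
        assume "g q \<in> {a, b, c, d}"
        then have "g (g q) \<in> {a, b, c, d}" using g(3) by blast
        then show False using q g(2) by simp
      qed
      then have "distinct [a, b, c, d, q, g q]" using dist(1) q gq by auto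
      moreover have "{a, b, c, d, q, g q} \<subseteq> {1..n}"
        using sub moved_in[OF g(1) gq] image_in[OF g(1)] by simp
      ultimately show False by (rule no_six)
    qed
    have xo: "x q = q" if "q \<notin> {a, b, c, d}" for q using out[OF x(1) sqx _ that] xv by simp
    have yo: "y q = q" if "q \<notin> {a, b, c, d}" for q using out[OF y(1) sqy _ that] yv by simp
    have xt: "x = transpose a b \<circ> transpose c d" by (rule double_transpose_eq[OF dist(1) xv xo])
    define t where "t = transpose a b"
    have t: "t \<in> carrier G" unfolding t_def using sub by (intro transpose_closed) simp
    define r where "r = t \<circ> y"
    have r: "r \<in> carrier G" unfolding r_def using t y(1) by (rule comp_closed)
    have rv: "r a = c" "r c = b" "r b = d" "r d = a"
      using yv dist unfolding r_def t_def by auto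
    have ro: "r q = q" if "q \<notin> {a, b, c, d}" for q using yo[OF that] that unfolding r_def t_def by simp
    have "r \<circ> r = x"
    proof
      fix q
      consider "q = a" | "q = b" | "q = c" | "q = d" | "q \<notin> {a, b, c, d}" by blast
      then show "(r \<circ> r) q = x q" using rv xv ro[of q] xo[of q] by cases auto
    qed
    moreover have "lc r (r \<circ> r)"
      using lc_mult[OF lc_refl[OF r] lc_refl[OF r] r r r] by (simp only: mult_eq)
    ultimately have "lc x r" using lc_sym by simp
    then have "lc x (r \<circ> y)" using lc_mult[OF _ lc x(1) r y(1)] by (simp only: mult_eq)
    moreover have "r \<circ> y = t" unfolding r_def using y(2) by (simp add: comp_assoc)
    ultimately have "lc t x" using lc_sym by simp
    then have "lc t (t \<circ> x)" using lc_mult[OF lc_refl[OF t] _ t t x(1)] by (simp only: mult_eq)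
    moreover have "t \<circ> x = transpose c d" unfolding t_def xt by (simp add: comp_assoc[symmetric])
    ultimately show False using disjoint_transpositions[OF dist(1) sub] unfolding t_def by simp
  qed
qed

end

end

lemma sym_perfect:
  assumes cover: "schur_cover H (sym_group n) \<pi>" and n: "4 \<le> n" "n \<le> 5"
  shows "perfect_graph (carrier (sym_group n)) (deep_adj H \<pi>)"
proof -
  interpret central_extension H "sym_group n" \<pi> by (rule schur_cover_central_extension[OF cover])
  interpret perm_group "sym_group n" n by (rule perm_group_sym)
  interpret perm_extension H "sym_group n" \<pi> n by unfold_locales
  have n8: "n \<le> 8" using n by simp
  note transpositions = schur_cover_sym_transpositions[OF cover n(1) n8]
  show ?thesis
  proof (rule perfect)
    show "n \<le> 7" "n \<le> 5 \<or> (\<forall>g\<in>carrier (sym_group n). evenperm g)" using n by simp_all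
    show "\<not> lc x y" if "x \<in> carrier (sym_group n)" "y \<in> carrier (sym_group n)" "x \<circ> x = id" "y \<circ> y = id"
      "x \<noteq> id" "y \<noteq> id" "x \<noteq> y" for x y
      by (rule cover_involutions_sym[OF n(2) refl transpositions]) (use that in simp_all)
    show "\<not> lc (cyc a b c) (cyc d e f)" if "distinct [a, b, c, d, e, f]" "{a, b, c, d, e, f} \<subseteq> {1..n}"
      for a b c d e f
      using distinct_length_le[OF that(1), of n] that(2) n(2) by simp
  qed
qed

lemma alt_perfect:
  assumes cover: "schur_cover H (alt_group n) \<pi>" and n: "5 \<le> n" "n \<le> 7"
  shows "perfect_graph (carrier (alt_group n)) (deep_adj H \<pi>)"
proof -
  interpret central_extension H "alt_group n" \<pi> by (rule schur_cover_central_extension[OF cover])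
  interpret perm_group "alt_group n" n by (rule perm_group_alt)
  interpret perm_extension H "alt_group n" \<pi> n by unfold_locales
  show ?thesis
  proof (rule perfect[OF n(2)])
    show "n \<le> 5 \<or> (\<forall>g\<in>carrier (alt_group n). evenperm g)" by (simp add: alt_group_carrier)
    show "\<not> lc x y" if "x \<in> carrier (alt_group n)" "y \<in> carrier (alt_group n)" "x \<circ> x = id" "y \<circ> y = id"
      "x \<noteq> id" "y \<noteq> id" "x \<noteq> y" for x y
      by (rule cover_involutions_alt[OF cover n]) (use that in simp_all)
  qed (rule cover_three_cycles_alt[OF cover n(2)])
qed

text \<open>Degree 4 is separate because \<open>A\<^sub>4\<close> is not a perfect group; here it does not matter whether the
  Klein four-group lifts to an abelian group.\<close>

lemma alt_4_perfect:
  assumes ext: "central_extension H (alt_group 4) \<pi>"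
  shows "perfect_graph (carrier (alt_group 4)) (deep_adj H \<pi>)"
proof -
  interpret central_extension H "alt_group 4" \<pi> by (rule ext)
  interpret perm_group "alt_group 4" 4 by (rule perm_group_alt)
  interpret perm_extension H "alt_group 4" \<pi> 4 by unfold_locales
  have par: "4 \<le> (5::nat) \<or> (\<forall>g\<in>carrier (alt_group 4). evenperm g)" by simp
  have n7: "4 \<le> (7::nat)" by simp
  have even: "evenperm g" if "g \<in> carrier (alt_group 4)" for g using that by (simp add: alt_group_carrier)
  have transitive: "lc y z"
    if x: "x \<in> carrier (alt_group 4)" and y: "y \<in> carrier (alt_group 4)" and z: "z \<in> carrier (alt_group 4)"
      and lcy: "lc x y" and lcz: "lc x z" and ne: "x \<noteq> id" for x y z
  proof -
    have commy: "y (x q) = x (y q)" for q using lc_commute'[OF lcy x y] by (metis comp_apply)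
    have commz: "z (x q) = x (z q)" for q using lc_commute'[OF lcz x z] by (metis comp_apply)
    have power: "lc y z" if "y \<circ> x ^^ k = id" for k
      using lc_sym[OF lc_inverse_pow[OF lc_sym[OF lcz] x y z that]] .
    have idl: "lc g id" "lc id g" if "g \<in> carrier (alt_group 4)" for g
      using lc_one[OF that] lc_sym by (simp_all only: one_eq)
    show ?thesis
    proof (cases "\<forall>q. x (x q) = q")
      case True
      then have sq: "x (x q) = q" for q by blast
      obtain a where a: "x a \<noteq> a" using ne by (auto simp: fun_eq_iff)
      obtain c where c: "distinct [a, x a, c, x c]" "x = transpose a (x a) \<circ> transpose c (x c)"
        using involution_cases[OF n7 par x sq a] even[OF x] odd_transpose[of a "x a"] a by metis
      have "x c \<noteq> c" using c(1) by auto
      then have sub: "set [a, x a, c, x c] \<subseteq> {1..4}" using moved_in[OF x] image_in[OF x] a by simp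
      have "card (set [a, x a, c, x c]) = 4" using distinct_card[OF c(1)] by simp
      then have "set [a, x a, c, x c] = {1..4}" by (intro card_subset_eq[OF _ sub]) simp_all
      then have perm: "g permutes {a, x a, c, x c}" if "g \<in> carrier (alt_group 4)" for g
        using permutes[OF that] by simp
      define j k where "j = transpose a c \<circ> transpose (x a) (x c)" and "k = transpose a (x c) \<circ> transpose (x a) c"
      have cases: "g = id \<or> g = x \<or> g = j \<or> g = k"
        if "g \<in> carrier (alt_group 4)" "\<And>q. g (x q) = x (g q)" for g
        unfolding j_def k_def by (rule klein_centralizer[OF c(2,1) perm[OF that(1)] even[OF that(1)] that(2)])
      have jk: "x \<circ> j = k" "x \<circ> k = j"
      proof -
        have ne4: "distinct [x c, c, x a, a]" using c(1) by auto
        have xc: "x q = (transpose a (x a) \<circ> transpose c (x c)) q" for q using c(2) by simp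
        have "x (j q) = k q \<and> x (k q) = j q" for q
        proof -
          consider "q = a" | "q = x a" | "q = c" | "q = x c" | "q \<notin> {a, x a, c, x c}" by blast
          then show ?thesis
          proof cases
            case 5
            then show ?thesis using xc[of q] by (simp add: j_def k_def)
          qed (use c(1) ne4 sq in \<open>simp_all add: j_def k_def transpose_def\<close>)
        qed
        then show "x \<circ> j = k" "x \<circ> k = j" by auto
      qed
      have mult: "lc g (x \<circ> g)" if "g \<in> carrier (alt_group 4)" "lc x g" for g
        using lc_mult[OF lc_sym[OF that(2)] lc_refl[OF that(1)] that(1) x that(1)] by (simp only: mult_eq)
      \<comment> \<open>In the Klein four-group, two distinct elements outside
        \<open>{id, x}\<close> differ by the factor \<open>x\<close>.\<close>
      have "y \<in> {id, x} \<or> z \<in> {id, x} \<or> y = z \<or> z = x \<circ> y"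
        using cases[OF y commy] cases[OF z commz] jk by auto
      then show ?thesis
        using idl y z lcy lcz lc_sym lc_refl[OF y] mult[OF y lcy] by auto
    next
      case False
      then obtain p where p: "x (x p) \<noteq> p" by blast
      have xp: "x p \<noteq> p" using p by auto
      have p_in: "p \<in> {1..4}" using moved_in[OF x xp] .
      show ?thesis
      proof (cases "x (x (x p)) = p")
        case False
        have "distinct [p, x p, x (x p), x (x (x p))]"
          using xp p False[symmetric] xp[symmetric] p[symmetric] by (simp add: inj_perm[OF x])
        then have "distinct (map (\<lambda>i. (x ^^ i) p) [0, 1, 2, 3])"
          by (simp add: funpow_3 numeral_2_eq_2)
        then have inj: "inj_on (\<lambda>i. (x ^^ i) p) (set [0, 1, 2, 3])" by (simp only: distinct_map)
        have set4: "set [0, 1, 2, 3] = {..<4::nat}" by auto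
        have "inj_on (\<lambda>i. (x ^^ i) p) {..<4}" using inj unfolding set4 .
        then show ?thesis using long_orbit_centralizer[OF n7 par x y commy] power by blast
      next
        case p3: True
        have d3: "distinct [p, x p, x (x p)]" using xp p xp[symmetric] p[symmetric] by (simp add: inj_perm[OF x])
        have sub3: "{p, x p, x (x p)} \<subseteq> {1..4}" using p_in image_in[OF x] by simp
        have yp: "y p \<in> {p, x p, x (x p)}"
        proof (rule ccontr)
          assume no: "y p \<notin> {p, x p, x (x p)}"
          have "x (y p) \<noteq> y p" using xp commy inj_perm[OF y] by metis
          moreover have "x (y p) \<notin> {p, x p, x (x p)}" using no p3 inj_perm[OF x] by (metis insert_iff singletonD)
          ultimately have "distinct [x (y p), y p, p, x p, x (x p)]" using no d3 by simp
          moreover have "set [x (y p), y p, p, x p, x (x p)] \<subseteq> {1..4}"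
            using sub3 p_in image_in[OF x] image_in[OF y] by simp
          ultimately show False using distinct_length_le[of "[x (y p), y p, p, x p, x (x p)]" 4] by simp
        qed
        obtain k where k: "(x ^^ k) (y p) = p"
        proof -
          assume that: "\<And>k. (x ^^ k) (y p) = p \<Longrightarrow> thesis"
          from yp consider "y p = p" | "y p = x p" | "y p = x (x p)" by blast
          then show thesis
          proof cases
            case 1
            then show ?thesis using that[of 0] by simp
          next
            case 2
            then show ?thesis using that[of 2] p3 by (simp add: numeral_2_eq_2)
          next
            case 3
            then show ?thesis using that[of 1] p3 by simp
          qed
        qed
        have pow: "x ^^ k \<in> carrier (alt_group 4)" using lc_funpow[OF lc_refl[OF x] x x] by blast
        define v where "v = y \<circ> x ^^ k"
        have v: "v \<in> carrier (alt_group 4)" unfolding v_def using y pow by (rule comp_closed)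
        have vx: "v (x q) = x (v q)" for q
          unfolding v_def comp_apply using commy[of "(x ^^ k) q"] funpow_swap1[of x k q] by metis
        have vp: "v p = p" using k funpow_commute[of y x, OF commy] unfolding v_def by simp
        have "v q = q" for q
        proof (rule ccontr)
          assume vq: "v q \<noteq> q"
          have fixed: "q' \<notin> {p, x p, x (x p)}" if "v q' \<noteq> q'" for q' using that vp vx by auto
          have "v (v q) \<noteq> v q" using vq inj_perm[OF v] by simp
          then have "distinct [v q, q, p, x p, x (x p)]" using fixed vq d3 by simp
          moreover have "set [v q, q, p, x p, x (x p)] \<subseteq> {1..4}"
            using sub3 moved_in[OF v vq] image_in[OF v] by simp
          ultimately show False using distinct_length_le[of "[v q, q, p, x p, x (x p)]" 4] by simp
        qed
        then have "v = id" by auto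
        then show ?thesis using power unfolding v_def by blast
      qed
    qed
  qed
  show ?thesis
  \<comment> \<open>In degree 4 \<open>transitive\<close> holds through every element but the
    identity, so only the identity gets a higher rank.\<close>
  proof (rule perfect_graph_if_simplicial[where r = "\<lambda>x. if x = id then 1 else 0"])
    show "finite (carrier (alt_group 4))" by (rule finite_carrier)
    show "deep_adj H \<pi> y x" if "deep_adj H \<pi> x y" for x y using deep_adj_sym that .
    fix x y z
    assume *: "x \<in> carrier (alt_group 4)" "y \<in> carrier (alt_group 4)" "z \<in> carrier (alt_group 4)"
      "deep_adj H \<pi> x y" "deep_adj H \<pi> x z" "x \<noteq> y" "y \<noteq> z"
      "(if x = id then 1 else 0 :: nat) \<le> (if y = id then 1 else 0)"
    then have "x \<noteq> id" by (auto split: if_splits)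
    then show "deep_adj H \<pi> y z" using transitive[OF *(1-3)] * by (simp add: deep_adj_iff)
  qed
qed

theorem theorem5p23:
  fixes n :: nat
    and H1 :: "'h monoid" and \<pi>1 :: "'h \<Rightarrow> (nat \<Rightarrow> nat)"
    and H2 :: "'k monoid" and \<pi>2 :: "'k \<Rightarrow> (nat \<Rightarrow> nat)"
  assumes "n \<ge> 4"
    and "schur_cover H1 (sym_group n) \<pi>1"
    and "schur_cover H2 (alt_group n) \<pi>2"
  shows "(perfect_graph (carrier (sym_group n)) (deep_adj H1 \<pi>1) \<longleftrightarrow> n \<le> 5) \<and>
         (perfect_graph (carrier (alt_group n)) (deep_adj H2 \<pi>2) \<longleftrightarrow> n \<le> 7)"
proof (intro conjI)
  note ext = assms(2,3)[THEN schur_cover_central_extension]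
  show "perfect_graph (carrier (sym_group n)) (deep_adj H1 \<pi>1) \<longleftrightarrow> n \<le> 5"
  proof (cases "n \<le> 5")
    case True
    then show ?thesis using sym_perfect[OF assms(2,1)] by simp
  next
    case False
    then show ?thesis using sym_not_perfect[OF _ ext(1)] by simp
  qed
  consider "n = 4" | "5 \<le> n" "n \<le> 7" | "8 \<le> n" using assms(1) by linarith
  then show "perfect_graph (carrier (alt_group n)) (deep_adj H2 \<pi>2) \<longleftrightarrow> n \<le> 7"
  proof cases
    case 1
    then show ?thesis using alt_4_perfect[of H2 \<pi>2] ext(2) by simp
  next
    case 2
    then show ?thesis using alt_perfect[OF assms(3)] by simp
  next
    case 3
    then show ?thesis using alt_not_perfect[OF _ ext(2)] by simp
  qed
qed

end
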